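(* Let $X$ be a compact $p$-adic analytic $n$-manifold over a finite extension $K$ of $\mathbb{Q}_p$, with integral structure $\Lambda$, canonical measure $\mu_\Lambda$, and a finite $O_K$-compatible atlas with pairwise distinct chart domains and connected nerve complex, and let $\alpha>0$. Then the Vladimirov–Taibleson operator $\Delta^\alpha$ is the generator of a strongly continuous semigroup $e^{-t\Delta^\alpha}$, $t\ge0$, on $W^{1,2}_{\Delta^\alpha}(X,\mu_\Lambda)$, which satisfies the Markov property.
   Context: $\Delta^\alpha u(x)=\int_Xd_\Lambda(x,y)^{-n\alpha}(u(x)-u(y))\,d\mu_\Lambda(y)$. $W^{1,2}_{\Delta^\alpha}(X,\mu_\Lambda)=\{f\in L^2(X,\mu_\Lambda):\|\Delta^\alpha f\|_{L^2}<\infty\}$ with norm $(\|f\|^2_{L^2}+\|\Delta^\alpha f\|^2_{L^2})^{1/2}$. Markov property: the semigroup maps a.e. nonnegative functions to a.e. nonnegative functions, functions $\le1$ a.e. to functions $\le1$ a.e., fixes the constant function $1_X$, and admits an invariant distribution. A $p$-adic analytic $n$-manifold is a paracompact Hausdorff space with an atlas of charts into $K^n$ with $K$-analytic transition maps. An integral structure $\Lambda$: locally constant assignment of finitely generated spanning $O_K$-submodules of $T_xX$; it induces a locally constant generator $\omega_X$ (up to $O_K^\times$) of the lattice in $\bigwedge^nT_xX$, and $\mu_\Lambda=|\omega_X|$. $O_K$-compatible: derivatives of transition maps in $\mathrm{GL}_n(O_K)$. Nerve: simplices are nonempty intersections of pairwise distinct chart domains. Balls in $X$: sets whose image under every chart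 containing them is a ball of fixed radius in $K^n$ (nerve faces excluded). $\mathfrak{B}$: inclusion poset of nerve faces and balls, points of $X$ adjoined as minimal elements; $U_\mathfrak{s}$ the set of $\mathfrak{s}$; $U^\circ_\mathfrak{s}(x)=U_\mathfrak{s}\setminus\bigcup_{\mathfrak{t}<\mathfrak{s},x\notin U_\mathfrak{t}}U_\mathfrak{t}$. Path between $x\ne y$: $(\gamma_x,\gamma^\circ_{xy},\gamma_y)$ with $\gamma_x,\gamma_y$ maximal descending chains of balls (no intermediate balls) rooted at faces $U_x,U_y$ with intersections $\{x\},\{y\}$, and $\gamma^\circ_{xy}$ a finite sequence of distinct elements of $\mathfrak{B}$ from $U_x$ to $U_y$ with consecutive elements strictly comparable; length $\sum_{\gamma_x}\mu_\Lambda(U^\circ_\mathfrak{s}(x))+\sum_{\gamma_y}\mu_\Lambda(U^\circ_\mathfrak{s}(x))+\sum_{\gamma^\circ_{xy}}\mu_\Lambda(U_\sigma)$; $d_\Lambda(x,y)$ = infimum of lengths. *)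

theory Defs
  imports "HOL-Probability.Probability_Measure" "HOL-Computational_Algebra.Primes"
begin

section \<open>Finite extensions of the field of p-adic numbers\<close>

definition kabs :: "'k::{zero,metric_space} \<Rightarrow> real" where
  "kabs x = dist x 0"

definition padic_abs :: "nat \<Rightarrow> rat \<Rightarrow> real" where
  "padic_abs p r =
     (if r = 0 then 0
      else real p powr (real (multiplicity (int p) (snd (quotient_of r)))
                        - real (multiplicity (int p) (fst (quotient_of r)))))"

definition val_ring :: "'k::{zero,metric_space} set" where
  "val_ring = {x. kabs x \<le> 1}"

definition max_ideal :: "'k::{zero,metric_space} set" where
  "max_ideal = {x. kabs x < 1}"

definition residue_field :: "'k::{minus,zero,metric_space} set set" where
  "residue_field = val_ring // {(x, y). x \<in> val_ring \<and> y \<in> val_ring \<and> x - y \<in> max_ideal}"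

text \<open>The closure of the rationals is the completion of the rationals for an absolute value
  equivalent to the p-adic one, that is, the field of p-adic numbers; the field is a finite extension
  of it. Its absolute value is normalised in the usual way: a uniformiser has absolute value
  1/q, where q is the cardinality of the residue field. The exponent s accounts for this
  normalisation.\<close>

definition padic_number_field :: "nat \<Rightarrow> 'k::{field_char_0,metric_space} itself \<Rightarrow> bool" where
  "padic_number_field p K \<longleftrightarrow>
     prime p \<and>
     (\<forall>x y :: 'k. dist x y = kabs (x - y)) \<and>
     (\<forall>x y :: 'k. kabs (x * y) = kabs x * kabs y) \<and>
     (\<forall>x y :: 'k. kabs (x + y) \<le> max (kabs x) (kabs y)) \<and>
     (\<exists>s>0. \<forall>r. kabs (of_rat r :: 'k) = padic_abs p r powr s) \<and>
     complete (closure (\<rat> :: 'k set)) \<and>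
     (\<exists>B :: 'k set. finite B \<and>
        (\<forall>x. \<exists>a. (\<forall>b\<in>B. a b \<in> closure \<rat>) \<and> x = (\<Sum>b\<in>B. a b * b))) \<and>
     (\<exists>\<pi> :: 'k. max_ideal = (\<lambda>x. \<pi> * x) ` val_ring \<and>
        kabs \<pi> = 1 / real (card (residue_field :: 'k set set)))"

section \<open>Analytic maps on powers of the field\<close>

definition vabs :: "'k::{zero,metric_space} ^ 'n::finite \<Rightarrow> real" where
  "vabs z = Max (range (\<lambda>i. kabs (z $ i)))"

definition kball :: "'k::{minus,zero,metric_space} ^ 'n \<Rightarrow> real \<Rightarrow> ('k ^ 'n) set" where
  "kball a r = {z. vabs (z - a) \<le> r}"

definition kanalytic_on ::
  "('k::{field,metric_space} ^ 'n::finite \<Rightarrow> 'k ^ 'm::finite) \<Rightarrow> ('k ^ 'n) set \<Rightarrow> bool" where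
  "kanalytic_on f S \<longleftrightarrow>
     (\<forall>a\<in>S. \<exists>r>0. \<exists>c :: 'm \<Rightarrow> ('n \<Rightarrow> nat) \<Rightarrow> 'k.
        \<forall>z\<in>S. vabs (z - a) < r \<longrightarrow>
          (\<forall>j. ((\<lambda>\<nu>. c j \<nu> * (\<Prod>i\<in>UNIV. (z $ i - a $ i) ^ \<nu> i)) has_sum (f z $ j)) UNIV))"

definition has_kderiv ::
  "('k::{field,metric_space} ^ 'n::finite \<Rightarrow> 'k ^ 'm::finite) \<Rightarrow> 'k ^ 'n ^ 'm \<Rightarrow> 'k ^ 'n \<Rightarrow> bool" where
  "has_kderiv f M a \<longleftrightarrow>
     (\<forall>e>0. \<exists>\<delta>>0. \<forall>h. vabs h < \<delta> \<longrightarrow> vabs (f (a + h) - f a - M *v h) \<le> e * vabs h)"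

definition kderiv ::
  "('k::{field,metric_space} ^ 'n::finite \<Rightarrow> 'k ^ 'm::finite) \<Rightarrow> 'k ^ 'n \<Rightarrow> 'k ^ 'n ^ 'm" where
  "kderiv f a = (THE M. has_kderiv f M a)"

definition GL_val_ring :: "('k::{field,metric_space} ^ 'n::finite ^ 'n) set" where
  "GL_val_ring =
     {M. (\<forall>i j. M $ i $ j \<in> val_ring) \<and>
         (\<exists>N. (\<forall>i j. N $ i $ j \<in> val_ring) \<and> M ** N = mat 1 \<and> N ** M = mat 1)}"

section \<open>Analytic manifolds\<close>

type_synonym ('x, 'k, 'n) chart = "'x set \<times> ('x \<Rightarrow> 'k ^ 'n)"

definition is_chart :: "('x::topological_space, 'k::metric_space, 'n::finite) chart \<Rightarrow> bool" where
  "is_chart c \<longleftrightarrow>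
     open (fst c) \<and> open (snd c ` fst c) \<and>
     homeomorphism (fst c) (snd c ` fst c) (snd c) (inv_into (fst c) (snd c))"

text \<open>Outside the image of the intersection of the two domains the value is irrelevant.\<close>

definition transition ::
  "('x, 'k, 'n) chart \<Rightarrow> ('x, 'k, 'n) chart \<Rightarrow> 'k ^ 'n \<Rightarrow> 'k ^ 'n" where
  "transition c d = snd d \<circ> inv_into (fst c) (snd c)"

definition jacobian ::
  "('x, 'k::{field,metric_space}, 'n::finite) chart \<Rightarrow> ('x, 'k, 'n) chart \<Rightarrow> 'x \<Rightarrow> 'k ^ 'n ^ 'n" where
  "jacobian c d x = kderiv (transition c d) (snd c x)"

definition analytic_atlas ::
  "('x::topological_space, 'k::{field,metric_space}, 'n::finite) chart set \<Rightarrow> bool" where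
  "analytic_atlas \<A> \<longleftrightarrow>
     (\<forall>c\<in>\<A>. is_chart c) \<and> \<Union> (fst ` \<A>) = UNIV \<and>
     (\<forall>c\<in>\<A>. \<forall>d\<in>\<A>. kanalytic_on (transition c d) (snd c ` (fst c \<inter> fst d)))"

definition integrally_compatible ::
  "('x, 'k::{field,metric_space}, 'n::finite) chart set \<Rightarrow> bool" where
  "integrally_compatible \<A> \<longleftrightarrow>
     (\<forall>c\<in>\<A>. \<forall>d\<in>\<A>. \<forall>x \<in> fst c \<inter> fst d. jacobian c d x \<in> GL_val_ring)"

section \<open>Integral structures and the canonical measure\<close>

text \<open>A tangent vector at x is given by its coordinate vectors in all charts around x, related
  by the derivatives of the transition maps; it is 0 at the other arguments.\<close>

definition tangent_space ::
  "('x, 'k::{field,metric_space}, 'n::finite) chart set \<Rightarrow> 'x \<Rightarrow> (('x, 'k, 'n) chart \<Rightarrow> 'k ^ 'n) set" where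
  "tangent_space \<A> x =
     {v. (\<forall>c. c \<notin> \<A> \<or> x \<notin> fst c \<longrightarrow> v c = 0) \<and>
         (\<forall>c\<in>\<A>. \<forall>d\<in>\<A>. x \<in> fst c \<inter> fst d \<longrightarrow> v d = jacobian c d x *v v c)}"

definition lin_combs :: "'k::field set \<Rightarrow> ('c \<Rightarrow> 'k ^ 'n) set \<Rightarrow> ('c \<Rightarrow> 'k ^ 'n) set" where
  "lin_combs R S = {(\<lambda>c. \<Sum>v\<in>S. a v *s v c) | a. \<forall>v\<in>S. a v \<in> R}"

text \<open>Local constancy is expressed in the coordinates of a chart; it does not depend on the chart,
  because the stabiliser of a lattice in the general linear group is open and the derivatives of
  the transition maps are continuous.\<close>

definition integral_structure ::
  "('x::topological_space, 'k::{field,metric_space}, 'n::finite) chart set \<Rightarrow>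
   ('x \<Rightarrow> (('x, 'k, 'n) chart \<Rightarrow> 'k ^ 'n) set) \<Rightarrow> bool" where
  "integral_structure \<A> \<Lambda> \<longleftrightarrow>
     (\<forall>x. \<exists>S. finite S \<and> S \<subseteq> tangent_space \<A> x \<and>
        \<Lambda> x = lin_combs val_ring S \<and> lin_combs UNIV S = tangent_space \<A> x) \<and>
     (\<forall>c\<in>\<A>. \<forall>x\<in>fst c. \<exists>V. open V \<and> x \<in> V \<and> V \<subseteq> fst c \<and>
        (\<forall>y\<in>V. (\<lambda>v. v c) ` \<Lambda> y = (\<lambda>v. v c) ` \<Lambda> x))"

definition val_submodule :: "'k::{field,metric_space} set \<Rightarrow> bool" where
  "val_submodule N \<longleftrightarrow>
     0 \<in> N \<and> (\<forall>x\<in>N. \<forall>y\<in>N. x + y \<in> N) \<and> (\<forall>a\<in>val_ring. \<forall>x\<in>N. a * x \<in> N)"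

text \<open>The chart c identifies the top exterior power of the tangent space at x with the field,
  a wedge product of n vectors corresponding to the determinant of their coordinate vectors. The
  following is the lattice generated by the wedge products of n vectors of \<open>\<Lambda> x\<close>.\<close>

definition wedge_lattice ::
  "('x \<Rightarrow> (('x, 'k::{field,metric_space}, 'n::finite) chart \<Rightarrow> 'k ^ 'n) set) \<Rightarrow>
   ('x, 'k, 'n) chart \<Rightarrow> 'x \<Rightarrow> 'k set" where
  "wedge_lattice \<Lambda> c x =
     val_submodule hull {det (\<chi> i. v i c) | v :: 'n \<Rightarrow> ('x, 'k, 'n) chart \<Rightarrow> 'k ^ 'n.
                                                 \<forall>i. v i \<in> \<Lambda> x}"

text \<open>The absolute value does not depend on the choice of the generator, which is unique up to
  units.\<close>

definition generator_abs ::
  "('x \<Rightarrow> (('x, 'k::{field,metric_space}, 'n::finite) chart \<Rightarrow> 'k ^ 'n) set) \<Rightarrow>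
   ('x, 'k, 'n) chart \<Rightarrow> 'x \<Rightarrow> real" where
  "generator_abs \<Lambda> c x = kabs (SOME \<omega>. wedge_lattice \<Lambda> c x = (\<lambda>a. a * \<omega>) ` val_ring)"

definition haar_measure :: "('k::{field,metric_space} ^ 'n::finite) measure \<Rightarrow> bool" where
  "haar_measure h \<longleftrightarrow>
     sets h = sets borel \<and> emeasure h {z. \<forall>i. z $ i \<in> val_ring} = 1 \<and>
     (\<forall>a. \<forall>A\<in>sets borel. emeasure h ((\<lambda>z. a + z) ` A) = emeasure h A)"

text \<open>The measure taking the generator of the top exterior power as unit of volume: infinitesimally
  \<open>\<Lambda> x\<close> has volume 1, so the density is the absolute value of the volume form dual to the
  generator. This is the choice that transforms as a density under arbitrary changes of charts.\<close>

definition canonical_measure ::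
  "('x::topological_space, 'k::{field,metric_space}, 'n::finite) chart set \<Rightarrow>
   ('x \<Rightarrow> (('x, 'k, 'n) chart \<Rightarrow> 'k ^ 'n) set) \<Rightarrow> 'x measure \<Rightarrow> bool" where
  "canonical_measure \<A> \<Lambda> \<mu> \<longleftrightarrow>
     sets \<mu> = sets borel \<and>
     (\<exists>h. haar_measure h \<and>
        (\<forall>c\<in>\<A>. \<forall>A\<in>sets borel. A \<subseteq> fst c \<longrightarrow>
           emeasure \<mu> A =
             (\<integral>\<^sup>+ z. ennreal (1 / generator_abs \<Lambda> c (inv_into (fst c) (snd c) z))
                    * indicator (snd c ` A) z \<partial>h)))"

section \<open>The nerve, the poset of faces and balls, and the distance\<close>

definition nerve :: "'x set set \<Rightarrow> 'x set set set" where
  "nerve \<U> = {\<sigma>. \<sigma> \<subseteq> \<U> \<and> finite \<sigma> \<and> \<sigma> \<noteq> {} \<and> \<Inter>\<sigma> \<noteq> {}}"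

definition connected_nerve :: "'x set set \<Rightarrow> bool" where
  "connected_nerve \<U> \<longleftrightarrow>
     nerve \<U> \<noteq> {} \<and>
     (\<forall>U V. {U} \<in> nerve \<U> \<and> {V} \<in> nerve \<U> \<longrightarrow> (U, V) \<in> {(A, B). {A, B} \<in> nerve \<U>}\<^sup>*)"

definition faces :: "('x, 'k, 'n) chart set \<Rightarrow> 'x set set" where
  "faces \<A> = Inter ` nerve (fst ` \<A>)"

definition balls_in :: "('x, 'k::{field,metric_space}, 'n::finite) chart set \<Rightarrow> 'x set set" where
  "balls_in \<A> =
     {B. (\<exists>c\<in>\<A>. B \<subseteq> fst c) \<and>
         (\<exists>r>0. \<forall>c\<in>\<A>. B \<subseteq> fst c \<longrightarrow> (\<exists>a. snd c ` B = kball a r))} - faces \<A>"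

text \<open>The elements of the poset are represented by their sets, ordered by inclusion.\<close>

definition face_ball_poset :: "('x, 'k::{field,metric_space}, 'n::finite) chart set \<Rightarrow> 'x set set" where
  "face_ball_poset \<A> = faces \<A> \<union> balls_in \<A> \<union> range (\<lambda>x. {x})"

definition punctured ::
  "('x, 'k::{field,metric_space}, 'n::finite) chart set \<Rightarrow> 'x set \<Rightarrow> 'x \<Rightarrow> 'x set" where
  "punctured \<A> s x = s - \<Union> {t \<in> face_ball_poset \<A>. t \<subset> s \<and> x \<notin> t}"

definition ball_chain ::
  "('x, 'k::{field,metric_space}, 'n::finite) chart set \<Rightarrow> 'x set \<Rightarrow> 'x \<Rightarrow> (nat \<Rightarrow> 'x set) \<Rightarrow> bool" where
  "ball_chain \<A> F x \<gamma> \<longleftrightarrow>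
     F \<in> faces \<A> \<and> \<gamma> 0 = F \<and>
     (\<forall>i. \<gamma> (Suc i) \<in> balls_in \<A> \<and> \<gamma> (Suc i) \<subset> \<gamma> i \<and>
          \<not> (\<exists>B\<in>balls_in \<A>. \<gamma> (Suc i) \<subset> B \<and> B \<subset> \<gamma> i)) \<and>
     (\<Inter>i. \<gamma> i) = {x}"

definition link ::
  "('x, 'k::{field,metric_space}, 'n::finite) chart set \<Rightarrow> 'x set \<Rightarrow> 'x set \<Rightarrow> 'x set list \<Rightarrow> bool" where
  "link \<A> F G l \<longleftrightarrow>
     l \<noteq> [] \<and> hd l = F \<and> last l = G \<and> distinct l \<and> set l \<subseteq> face_ball_poset \<A> \<and>
     successively (\<lambda>s t. s \<subset> t \<or> t \<subset> s) l"

text \<open>Both chain sums use the same base point x. Since all points belong to the poset,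
  \<open>punctured \<A> s x \<subseteq> {x}\<close>, so that using y in the second sum, or leaving out the
  root of a chain, changes no length.\<close>

definition path_lengths ::
  "('x, 'k::{field,metric_space}, 'n::finite) chart set \<Rightarrow> 'x measure \<Rightarrow> 'x \<Rightarrow> 'x \<Rightarrow> ennreal set" where
  "path_lengths \<A> \<mu> x y =
     {(\<Sum>i. emeasure \<mu> (punctured \<A> (\<gamma> i) x)) + (\<Sum>i. emeasure \<mu> (punctured \<A> (\<delta> i) x))
        + (\<Sum>s\<leftarrow>l. emeasure \<mu> s)
      | F G \<gamma> \<delta> l. ball_chain \<A> F x \<gamma> \<and> ball_chain \<A> G y \<delta> \<and> link \<A> F G l}"

definition path_dist ::
  "('x, 'k::{field,metric_space}, 'n::finite) chart set \<Rightarrow> 'x measure \<Rightarrow> 'x \<Rightarrow> 'x \<Rightarrow> real" where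
  "path_dist \<A> \<mu> x y = (if x = y then 0 else enn2real (Inf (path_lengths \<A> \<mu> x y)))"

section \<open>The Vladimirov-Taibleson operator\<close>

definition VT_integrand ::
  "('x, 'k::{field,metric_space}, 'n::finite) chart set \<Rightarrow> 'x measure \<Rightarrow> real \<Rightarrow>
   ('x \<Rightarrow> real) \<Rightarrow> 'x \<Rightarrow> 'x \<Rightarrow> real" where
  "VT_integrand \<A> \<mu> \<alpha> u x y =
     path_dist \<A> \<mu> x y powr (- (real CARD('n) * \<alpha>)) * (u x - u y)"

definition VT_operator ::
  "('x, 'k::{field,metric_space}, 'n::finite) chart set \<Rightarrow> 'x measure \<Rightarrow> real \<Rightarrow>
   ('x \<Rightarrow> real) \<Rightarrow> 'x \<Rightarrow> real" where
  "VT_operator \<A> \<mu> \<alpha> u x = (\<integral>y. VT_integrand \<A> \<mu> \<alpha> u x y \<partial>\<mu>)"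

text \<open>Elements of function spaces are functions, identified when they agree almost everywhere.\<close>

definition L2_space :: "'x measure \<Rightarrow> ('x \<Rightarrow> real) set" where
  "L2_space \<mu> = {f \<in> borel_measurable \<mu>. integrable \<mu> (\<lambda>x. (f x)\<^sup>2)}"

text \<open>The integrability condition is needed because the library assigns the value 0 to divergent
  integrals.\<close>

definition VT_sobolev ::
  "('x, 'k::{field,metric_space}, 'n::finite) chart set \<Rightarrow> 'x measure \<Rightarrow> real \<Rightarrow> ('x \<Rightarrow> real) set" where
  "VT_sobolev \<A> \<mu> \<alpha> =
     {f \<in> L2_space \<mu>. (AE x in \<mu>. integrable \<mu> (VT_integrand \<A> \<mu> \<alpha> f x)) \<and>
                        VT_operator \<A> \<mu> \<alpha> f \<in> L2_space \<mu>}"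

definition VT_norm ::
  "('x, 'k::{field,metric_space}, 'n::finite) chart set \<Rightarrow> 'x measure \<Rightarrow> real \<Rightarrow> ('x \<Rightarrow> real) \<Rightarrow> real" where
  "VT_norm \<A> \<mu> \<alpha> f =
     sqrt ((\<integral>x. (f x)\<^sup>2 \<partial>\<mu>) + (\<integral>x. (VT_operator \<A> \<mu> \<alpha> f x)\<^sup>2 \<partial>\<mu>))"

section \<open>Semigroups of operators on function spaces\<close>

text \<open>W is a linear space of functions modulo \<open>\<mu>\<close>-almost everywhere equality, and N a norm on
  this space.\<close>

definition C0_semigroup ::
  "'x measure \<Rightarrow> ('x \<Rightarrow> real) set \<Rightarrow> (('x \<Rightarrow> real) \<Rightarrow> real) \<Rightarrow>
   (real \<Rightarrow> ('x \<Rightarrow> real) \<Rightarrow> ('x \<Rightarrow> real)) \<Rightarrow> bool" where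
  "C0_semigroup \<mu> W N T \<longleftrightarrow>
     (\<forall>t\<ge>0. \<forall>f\<in>W. T t f \<in> W) \<and>
     (\<forall>t\<ge>0. \<forall>f\<in>W. \<forall>g\<in>W. (AE x in \<mu>. f x = g x) \<longrightarrow> (AE x in \<mu>. T t f x = T t g x)) \<and>
     (\<forall>t\<ge>0. \<forall>f\<in>W. \<forall>g\<in>W. \<forall>a b.
        AE x in \<mu>. T t (\<lambda>z. a * f z + b * g z) x = a * T t f x + b * T t g x) \<and>
     (\<forall>t\<ge>0. \<exists>C. \<forall>f\<in>W. N (T t f) \<le> C * N f) \<and>
     (\<forall>f\<in>W. AE x in \<mu>. T 0 f x = f x) \<and>
     (\<forall>s\<ge>0. \<forall>t\<ge>0. \<forall>f\<in>W. AE x in \<mu>. T (s + t) f x = T s (T t f) x) \<and>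
     (\<forall>f\<in>W. \<forall>s\<ge>0. ((\<lambda>t. N (\<lambda>x. T t f x - T s f x)) \<longlongrightarrow> 0) (at s within {0..}))"

text \<open>The infinitesimal generator of T is the operator A in W, with domain the set of all f in W
  whose image A f lies in W.\<close>

definition has_generator ::
  "'x measure \<Rightarrow> ('x \<Rightarrow> real) set \<Rightarrow> (('x \<Rightarrow> real) \<Rightarrow> real) \<Rightarrow>
   (real \<Rightarrow> ('x \<Rightarrow> real) \<Rightarrow> ('x \<Rightarrow> real)) \<Rightarrow> (('x \<Rightarrow> real) \<Rightarrow> ('x \<Rightarrow> real)) \<Rightarrow> bool" where
  "has_generator \<mu> W N T A \<longleftrightarrow>
     (\<forall>f\<in>W. \<forall>g\<in>W.
        ((\<lambda>t. N (\<lambda>x. (T t f x - f x) / t - g x)) \<longlongrightarrow> 0) (at_right 0) \<longleftrightarrow>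
        (AE x in \<mu>. A f x = g x))"

text \<open>An invariant distribution has to be absolutely continuous, because \<open>T t f\<close> is determined
  only up to \<open>\<mu>\<close>-null sets.\<close>

definition markov_property ::
  "'x measure \<Rightarrow> ('x \<Rightarrow> real) set \<Rightarrow> (real \<Rightarrow> ('x \<Rightarrow> real) \<Rightarrow> ('x \<Rightarrow> real)) \<Rightarrow> bool" where
  "markov_property \<mu> W T \<longleftrightarrow>
     (\<forall>t\<ge>0. \<forall>f\<in>W. (AE x in \<mu>. 0 \<le> f x) \<longrightarrow> (AE x in \<mu>. 0 \<le> T t f x)) \<and>
     (\<forall>t\<ge>0. \<forall>f\<in>W. (AE x in \<mu>. f x \<le> 1) \<longrightarrow> (AE x in \<mu>. T t f x \<le> 1)) \<and>
     (\<lambda>x. 1) \<in> W \<and> (\<forall>t\<ge>0. AE x in \<mu>. T t (\<lambda>x. 1) x = 1) \<and>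
     (\<exists>\<pi>. prob_space \<pi> \<and> sets \<pi> = sets \<mu> \<and> absolutely_continuous \<mu> \<pi> \<and>
        (\<forall>t\<ge>0. \<forall>f\<in>W. integrable \<pi> f \<longrightarrow>
           integrable \<pi> (T t f) \<and> (\<integral>x. T t f x \<partial>\<pi>) = (\<integral>x. f x \<partial>\<pi>)))"

end

theory Submission
  imports Defs
begin

text \<open>
  Distinct points are joined through faces of the nerve, and since single points are null sets only
  the measures of the elements linking two faces contribute to a path length. Hence the distance of
  x and y depends only on the sets of faces from which balls shrink down to x and to y. There are
  finitely many faces, so the operator has a bounded symmetric kernel: it is bounded on the space of
  square integrable functions, the Sobolev norm is equivalent to the norm of that space, and the
  semigroup is an exponential series. With c an upper bound for the total jump rate and B the
  positivity preserving operator c minus the Laplacian, the semigroup is exp(-ct) times the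
  exponential of tB; it fixes constants, and symmetry of the kernel makes the normalised canonical
  measure invariant.

  Measurability of the kernel holds because the balls of a face around x form a chain indexed by
  integers, and the set of x at which a given level occurs is open. The canonical measure is finite
  by compactness; it does not vanish because the chain rule makes the coordinates of the tangent
  space surjective, so that the lattice of the top exterior power is nonzero.
\<close>

section \<open>Exponential generating series\<close>

text \<open>The kernel is bounded although a negative power of the distance is taken: points are
  themselves elements of the poset, so every punctured set of a chain has at most one point and
  chains cost nothing. What remains is a function on pairs of sets of faces, a finite domain, and an
  infimum that is 0 or infinite gives the value 0 under \<open>enn2real\<close> and
  \<open>powr\<close>.

  The members of \<open>L2_space\<close> are functions, not classes, so the exponential is formed at
  each point x as a numerical series rather than in an algebra of operators. Its convergence needs a
  bound for all iterates at a fixed point. Here |f x| alone does not control the next iterate at x,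
  and the L1 norm does not control point values, but their sum is reproduced up to a constant.
  Continuity in t and the difference quotient then both take the form of a scalar factor times this
  majorant, and one comparison lemma carries such estimates over to the Sobolev norm.\<close>

definition egf :: "(nat \<Rightarrow> real) \<Rightarrow> real \<Rightarrow> real" where
  "egf \<beta> t = (\<Sum>n. t ^ n / fact n * \<beta> n)"

lemma exp_series: "summable (\<lambda>n. x ^ n / fact n)" "(\<Sum>n. x ^ n / fact n) = exp x" for x :: real
  using summable_exp[of x] by (simp_all add: exp_def divide_inverse mult.commute scaleR_conv_of_real)

lemma egf_term_bound:
  fixes G C t :: real
  assumes "\<And>n. \<bar>\<beta> n\<bar> \<le> G * C ^ n"
  shows "\<bar>t ^ n / fact n * \<beta> n\<bar> \<le> G * ((\<bar>t\<bar> * C) ^ n / fact n)"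
proof -
  have "\<bar>t ^ n / fact n * \<beta> n\<bar> = \<bar>t\<bar> ^ n / fact n * \<bar>\<beta> n\<bar>"
    by (simp add: abs_mult power_abs)
  also have "\<dots> \<le> \<bar>t\<bar> ^ n / fact n * (G * C ^ n)"
    by (intro mult_left_mono assms) auto
  finally show ?thesis
    by (simp add: power_mult_distrib mult_ac)
qed

lemma egf_abs_summable:
  fixes G C t :: real
  assumes "\<And>n. \<bar>\<beta> n\<bar> \<le> G * C ^ n"
  shows "summable (\<lambda>n. \<bar>t ^ n / fact n * \<beta> n\<bar>)"
  by (rule summable_comparison_test'[OF summable_mult[OF exp_series(1), of G "\<bar>t\<bar> * C"]])
     (simp only: real_norm_def abs_idempotent egf_term_bound[OF assms])

lemma egf_summable:
  fixes G C t :: real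
  assumes "\<And>n. \<bar>\<beta> n\<bar> \<le> G * C ^ n"
  shows "summable (\<lambda>n. t ^ n / fact n * \<beta> n)"
  using egf_abs_summable[OF assms, of t] by (rule summable_rabs_cancel)

lemma egf_bound:
  fixes G C t :: real
  assumes "\<And>n. \<bar>\<beta> n\<bar> \<le> G * C ^ n" "t \<ge> 0"
  shows "\<bar>egf \<beta> t\<bar> \<le> G * exp (t * C)"
proof -
  have "\<bar>egf \<beta> t\<bar> \<le> (\<Sum>n. \<bar>t ^ n / fact n * \<beta> n\<bar>)"
    unfolding egf_def by (rule summable_rabs[OF egf_abs_summable[OF assms(1)]])
  also have "\<dots> \<le> (\<Sum>n. G * ((\<bar>t\<bar> * C) ^ n / fact n))"
    by (intro suminf_le egf_term_bound assms egf_abs_summable[OF assms(1)] summable_mult exp_series)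
  finally show ?thesis
    using assms by (simp only: suminf_mult[OF exp_series(1)] exp_series(2))
qed

text \<open>For \<open>s \<le> t\<close> all \<open>t ^ n - s ^ n\<close> are nonnegative, so
  absolute values only touch \<open>\<beta> n\<close> and the majorants add up to a difference of
  two exponentials. Estimating the two series separately would lose the factor that tends to
  0.\<close>

lemma egf_diff_bound_aux:
  fixes G C s t :: real
  assumes "\<And>n. \<bar>\<beta> n\<bar> \<le> G * C ^ n" "0 \<le> s" "s \<le> t"
  shows "\<bar>egf \<beta> t - egf \<beta> s\<bar> \<le> G * (exp (t * C) - exp (s * C))"
proof -
  have eq: "egf \<beta> t - egf \<beta> s = (\<Sum>n. (t ^ n - s ^ n) / fact n * \<beta> n)"
    unfolding egf_def
    by (subst suminf_diff[OF egf_summable[OF assms(1)] egf_summable[OF assms(1)]])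
       (simp add: algebra_simps diff_divide_distrib)
  have le: "\<bar>(t ^ n - s ^ n) / fact n * \<beta> n\<bar> \<le> G * ((t * C) ^ n / fact n) - G * ((s * C) ^ n / fact n)" for n
  proof -
    have "s ^ n \<le> t ^ n" using assms by (intro power_mono)
    then have "\<bar>(t ^ n - s ^ n) / fact n * \<beta> n\<bar> = (t ^ n - s ^ n) / fact n * \<bar>\<beta> n\<bar>"
      by (simp add: abs_mult)
    also have "\<dots> \<le> (t ^ n - s ^ n) / fact n * (G * C ^ n)"
      using \<open>s ^ n \<le> t ^ n\<close> by (intro mult_left_mono assms) auto
    finally show ?thesis
      by (simp add: power_mult_distrib field_simps)
  qed
  have sm: "summable (\<lambda>n. G * ((t * C) ^ n / fact n) - G * ((s * C) ^ n / fact n))"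
    by (intro summable_diff summable_mult exp_series)
  have "summable (\<lambda>n. \<bar>(t ^ n - s ^ n) / fact n * \<beta> n\<bar>)"
    by (rule summable_comparison_test'[OF sm]) (simp only: real_norm_def abs_idempotent le)
  then have "\<bar>egf \<beta> t - egf \<beta> s\<bar> \<le> (\<Sum>n. G * ((t * C) ^ n / fact n) - G * ((s * C) ^ n / fact n))"
    unfolding eq by (intro order_trans[OF summable_rabs] suminf_le le sm)
  also have "\<dots> = G * exp (t * C) - G * exp (s * C)"
    by (subst suminf_diff[symmetric])
       (auto intro!: summable_mult exp_series simp: suminf_mult[OF exp_series(1)] exp_series(2) simp del: times_divide_eq_right)
  finally show ?thesis by (simp add: algebra_simps)
qed

lemma egf_diff_bound:
  fixes G C s t :: real
  assumes "\<And>n. \<bar>\<beta> n\<bar> \<le> G * C ^ n" "0 \<le> s" "0 \<le> t" "0 \<le> C" "0 \<le> G"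
  shows "\<bar>egf \<beta> t - egf \<beta> s\<bar> \<le> G * \<bar>exp (t * C) - exp (s * C)\<bar>"
proof (cases "s \<le> t")
  case True
  then have "s * C \<le> t * C" using assms by (intro mult_right_mono)
  then show ?thesis using egf_diff_bound_aux[OF assms(1,2) True] by simp
next
  case False
  then have "t * C \<le> s * C" using assms by (intro mult_right_mono) auto
  then show ?thesis using egf_diff_bound_aux[OF assms(1,3), of s] False by (simp add: abs_minus_commute)
qed

text \<open>The terms of index at least 2 are dominated by those of \<open>G * exp (t * C)\<close>.
  Divided by t, this bound tends to 0 with t, as the computation of the generator requires.\<close>

lemma egf_taylor_bound:
  fixes G C t :: real
  assumes "\<And>n. \<bar>\<beta> n\<bar> \<le> G * C ^ n" "0 \<le> t"
  shows "\<bar>egf \<beta> t - \<beta> 0 - t * \<beta> 1\<bar> \<le> G * (exp (t * C) - 1 - t * C)"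
proof -
  have split: "(\<Sum>n. f n) = (\<Sum>n. f (n + 2)) + f 0 + f 1" if "summable f" for f :: "nat \<Rightarrow> real"
    using suminf_split_initial_segment[OF that, of 2] by (simp add: numeral_2_eq_2)
  let ?a = "\<lambda>n. t ^ n / fact n * \<beta> n" and ?b = "\<lambda>n. G * ((t * C) ^ n / fact n)"
  have sb: "summable ?b" by (intro summable_mult exp_series)
  have le: "\<bar>?a n\<bar> \<le> ?b n" for n
    using egf_term_bound[OF assms(1), of t n] assms(2) by simp
  have sa: "summable (\<lambda>n. \<bar>?a (n + 2)\<bar>)"
    using summable_ignore_initial_segment[OF egf_abs_summable[OF assms(1)], of t 2] .
  have "\<bar>egf \<beta> t - \<beta> 0 - t * \<beta> 1\<bar> = \<bar>\<Sum>n. ?a (n + 2)\<bar>"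
    unfolding egf_def using split[OF egf_summable[OF assms(1)], of t] by simp
  also have "\<dots> \<le> (\<Sum>n. \<bar>?a (n + 2)\<bar>)"
    by (rule summable_rabs[OF sa])
  also have "\<dots> \<le> (\<Sum>n. ?b (n + 2))"
    by (intro suminf_le le sa summable_ignore_initial_segment[OF sb])
  also have "\<dots> = G * exp (t * C) - G - G * (t * C)"
    using split[OF sb] by (simp add: suminf_mult[OF exp_series(1)] exp_series(2) del: times_divide_eq_right)
  finally show ?thesis by (simp add: algebra_simps)
qed

text \<open>This is exp((s + t)B) = exp(sB) exp(tB), read at a point with \<open>\<beta> n\<close>
  in the role of B^n f: the double series with entries \<open>\<beta> (m + n)\<close> is summed by
  rows and by antidiagonals.\<close>

lemma egf_add:
  fixes G C s t :: real
  assumes \<beta>: "\<And>n. \<bar>\<beta> n\<bar> \<le> G * C ^ n" and "0 \<le> C"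
  shows "egf \<beta> (s + t) = egf (\<lambda>m. egf (\<lambda>n. \<beta> (m + n)) t) s"
proof -
  define a where "a = (\<lambda>m n. s ^ m / fact m * (t ^ n / fact n * \<beta> (m + n)))"
  have G: "0 \<le> G" using \<beta>[of 0] by simp
  define e where "e = (\<lambda>x n. x ^ n / fact n :: real)"
  have e_nonneg: "0 \<le> e x n" if "x \<ge> 0" for x n
    using that by (simp add: e_def)
  have sum_exp: "e x summable_on UNIV" if "x \<ge> 0" for x
    using that exp_series(1)[of x] unfolding e_def by (intro norm_summable_imp_summable_on) simp
  \<comment> \<open>The majorant is a product of two exponential series, since the growth bound
    splits as \<open>C ^ m * C ^ n\<close>.\<close>
  have "(\<lambda>p. norm ((\<lambda>(m, n). G * (e (\<bar>s\<bar> * C) m * e (\<bar>t\<bar> * C) n)) p)) summable_on (UNIV \<times> UNIV)"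
    using assms G
    by (intro Infinite_Sum.abs_summable_on_Sigma_iff[THEN iffD2] conjI ballI)
       (auto simp: abs_mult e_nonneg infsum_cmult_right' infsum_nonneg
         intro!: summable_on_cmult_right summable_on_cmult_left sum_exp)
  then have envelope: "(\<lambda>p. norm ((\<lambda>(m, n). G * ((\<bar>s\<bar> * C) ^ m / fact m * ((\<bar>t\<bar> * C) ^ n / fact n))) p)) summable_on (UNIV \<times> UNIV)"
    unfolding e_def .
  have "norm (a m n) \<le> G * ((\<bar>s\<bar> * C) ^ m / fact m * ((\<bar>t\<bar> * C) ^ n / fact n))" for m n
  proof -
    have "norm (a m n) = \<bar>s\<bar> ^ m / fact m * (\<bar>t\<bar> ^ n / fact n) * \<bar>\<beta> (m + n)\<bar>"
      by (simp add: a_def abs_mult power_abs)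
    also have "\<dots> \<le> \<bar>s\<bar> ^ m / fact m * (\<bar>t\<bar> ^ n / fact n) * (G * C ^ (m + n))"
      by (intro mult_left_mono \<beta>) auto
    finally show ?thesis by (simp add: power_mult_distrib power_add field_simps)
  qed
  then have "(\<lambda>p. norm ((\<lambda>(m, n). a m n) p)) summable_on (UNIV \<times> UNIV)"
    by (intro Infinite_Sum.abs_summable_on_comparison_test[OF envelope]) (auto intro: order_trans[OF _ abs_ge_self])
  then have sum_a: "(\<lambda>(m, n). a m n) summable_on (UNIV \<times> UNIV)"
    by (rule abs_summable_summable)
  have \<beta>': "\<bar>\<beta> (m + n)\<bar> \<le> (G * C ^ m) * C ^ n" for m n
    using \<beta>[of "m + n"] by (simp add: power_add mult_ac)
  have inner: "infsum (a m) UNIV = s ^ m / fact m * egf (\<lambda>n. \<beta> (m + n)) t" for m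
  proof -
    have "((\<lambda>n. t ^ n / fact n * \<beta> (m + n)) has_sum egf (\<lambda>n. \<beta> (m + n)) t) UNIV"
      unfolding egf_def
      by (intro norm_summable_imp_has_sum summable_sums egf_summable[OF \<beta>'])
         (simp only: real_norm_def egf_abs_summable[OF \<beta>'])
    from has_sum_cmult_right[OF this, of "s ^ m / fact m"] show ?thesis
      unfolding a_def by (rule infsumI)
  qed
  have "((\<lambda>m. infsum (a m) UNIV) has_sum infsum (\<lambda>(m, n). a m n) (UNIV \<times> UNIV)) UNIV"
    using summable_on_Sigma_banach[OF sum_a] infsum_Sigma'_banach[OF sum_a] by (metis has_sum_infsum)
  then have 1: "egf (\<lambda>m. egf (\<lambda>n. \<beta> (m + n)) t) s = infsum (\<lambda>(m, n). a m n) (UNIV \<times> UNIV)"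
    unfolding inner egf_def[of _ s] by (rule sums_unique[symmetric, OF has_sum_imp_sums])
  \<comment> \<open>\<open>?g\<close> describes a pair by its antidiagonal \<open>N\<close> and its
    position \<open>i\<close> there.\<close>
  let ?g = "\<lambda>(N, i). (i, N - i) :: nat \<times> nat"
  have bij: "bij_betw ?g (Sigma UNIV (\<lambda>N. {..N})) (UNIV \<times> UNIV)"
    by (rule bij_betwI[where g = "\<lambda>(m, n). (m + n, m)"]) auto
  have sum_N: "(\<lambda>(N, i). a i (N - i)) summable_on Sigma UNIV (\<lambda>N. {..N})"
    using summable_on_reindex_bij_betw[OF bij, of "\<lambda>(m, n). a m n"] sum_a by (simp add: case_prod_unfold)
  \<comment> \<open>On one antidiagonal the two factorials combine to a binomial coefficient over
    \<open>fact N\<close>, and the binomial theorem applies.\<close>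
  have fin: "infsum (\<lambda>i. a i (N - i)) {..N} = (s + t) ^ N / fact N * \<beta> N" for N
  proof -
    have "(\<Sum>i\<le>N. a i (N - i)) = (\<Sum>i\<le>N. of_nat (N choose i) * s ^ i * t ^ (N - i)) / fact N * \<beta> N"
      unfolding a_def sum_divide_distrib sum_distrib_right
      by (intro sum.cong) (auto simp: binomial_fact)
    then show ?thesis by (simp add: binomial_ring)
  qed
  have "((\<lambda>N. infsum (\<lambda>i. a i (N - i)) {..N}) has_sum infsum (\<lambda>(N, i). a i (N - i)) (Sigma UNIV (\<lambda>N. {..N}))) UNIV"
    using summable_on_Sigma_banach[OF sum_N] infsum_Sigma'_banach[OF sum_N] by (metis has_sum_infsum)
  then have "egf \<beta> (s + t) = infsum (\<lambda>(N, i). a i (N - i)) (Sigma UNIV (\<lambda>N. {..N}))"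
    unfolding fin egf_def by (rule sums_unique[symmetric, OF has_sum_imp_sums])
  also have "\<dots> = infsum (\<lambda>(m, n). a m n) (UNIV \<times> UNIV)"
    using infsum_reindex_bij_betw[OF bij, of "\<lambda>(m, n). a m n"] by (simp add: case_prod_unfold)
  finally show ?thesis using 1 by simp
qed

section \<open>The semigroup of a bounded symmetric kernel\<close>

text \<open>The bounds hold at every pair of points and not merely almost everywhere, because the
  estimates below are made at a fixed point.\<close>

locale bounded_kernel = finite_measure \<mu> for \<mu> :: "'a measure" +
  fixes k :: "'a \<Rightarrow> 'a \<Rightarrow> real" and M :: real
  assumes space_UNIV: "space \<mu> = UNIV"
    and kernel_measurable: "case_prod k \<in> borel_measurable (\<mu> \<Otimes>\<^sub>M \<mu>)"
    and kernel_nonneg: "0 \<le> k x y"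
    and kernel_le: "k x y \<le> M"
    and kernel_sym: "k x y = k y x"
begin

definition lap :: "('a \<Rightarrow> real) \<Rightarrow> 'a \<Rightarrow> real" where
  "lap f x = (\<integral>y. k x y * (f x - f y) \<partial>\<mu>)"

text \<open>\<open>M\<close> times the total mass bounds the integral of each \<open>k x\<close>,
  hence every \<open>deg x\<close>, so one constant serves at all points.\<close>

definition rate :: real where
  "rate = M * measure \<mu> UNIV"

definition deg :: "'a \<Rightarrow> real" where
  "deg x = (\<integral>y. k x y \<partial>\<mu>)"

text \<open>Subtracting the Laplacian from a multiple of the identity that exceeds all vertex degrees leaves
  a positivity preserving operator; its exponential series gives the semigroup up to a factor.\<close>

definition jump :: "('a \<Rightarrow> real) \<Rightarrow> 'a \<Rightarrow> real" where
  "jump f x = (rate - deg x) * f x + (\<integral>y. k x y * f y \<partial>\<mu>)"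

definition heat :: "real \<Rightarrow> ('a \<Rightarrow> real) \<Rightarrow> 'a \<Rightarrow> real" where
  "heat t f x = exp (- (rate * t)) * egf (\<lambda>n. (jump ^^ n) f x) t"

text \<open>Iterates of the jump operator at x are bounded by a geometric sequence times this function,
  which makes all series converge pointwise.\<close>

definition envelope :: "('a \<Rightarrow> real) \<Rightarrow> 'a \<Rightarrow> real" where
  "envelope f x = \<bar>f x\<bar> + (\<integral>y. \<bar>f y\<bar> \<partial>\<mu>)"

text \<open>\<open>jump_bound\<close> and \<open>jump_L1\<close> bound the envelope of
  \<open>jump f\<close> with coefficient \<open>rate\<close> at |f x| and
  \<open>M + 2 * rate\<close> at the L1 norm. The constant dominates both, and the summand 1 makes
  it at least 1.\<close>

definition growth :: real where
  "growth = 2 * rate + M + 1"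

definition graph_norm :: "('a \<Rightarrow> real) \<Rightarrow> real" where
  "graph_norm f = sqrt ((\<integral>x. (f x)\<^sup>2 \<partial>\<mu>) + (\<integral>x. (lap f x)\<^sup>2 \<partial>\<mu>))"

section \<open>Bounds for the kernel and for the iterates of the jump operator\<close>

lemma kernel_measurable2 [measurable]: "k x \<in> borel_measurable \<mu>"
  using measurable_compose[OF measurable_Pair1' kernel_measurable, of x] space_UNIV by simp

lemma M_nonneg: "0 \<le> M"
  using kernel_nonneg kernel_le order_trans by blast

lemma rate_nonneg: "0 \<le> rate"
  by (simp add: rate_def M_nonneg)

lemma growth_pos: "1 \<le> growth"
  using M_nonneg rate_nonneg by (simp add: growth_def)

lemma kernel_integrable [simp]: "integrable \<mu> (k x)"
  using kernel_nonneg kernel_le by (intro integrable_const_bound[of _ M]) auto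

lemma kernel_mult_integrable [simp]:
  assumes "integrable \<mu> f" shows "integrable \<mu> (\<lambda>y. k x y * f y)"
proof (rule Bochner_Integration.integrable_bound)
  show "integrable \<mu> (\<lambda>y. M * f y)" using assms by simp
  show "AE y in \<mu>. norm (k x y * f y) \<le> norm (M * f y)"
    using kernel_nonneg kernel_le M_nonneg by (auto simp: abs_mult intro!: mult_right_mono)
qed (use assms in measurable)

lemma deg_nonneg: "0 \<le> deg x"
  unfolding deg_def by (intro integral_nonneg_AE) (simp add: kernel_nonneg)

lemma deg_le_rate: "deg x \<le> rate"
proof -
  have "deg x \<le> (\<integral>y. M \<partial>\<mu>)"
    unfolding deg_def by (intro integral_mono) (auto simp: kernel_le)
  then show ?thesis by (simp add: rate_def space_UNIV mult.commute)
qed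

lemma deg_measurable [measurable]: "deg \<in> borel_measurable \<mu>"
  unfolding deg_def using kernel_measurable by (rule borel_measurable_lebesgue_integral)

lemma kernel_avg_measurable [measurable]:
  assumes [measurable]: "f \<in> borel_measurable \<mu>"
  shows "(\<lambda>x. \<integral>y. k x y * f y \<partial>\<mu>) \<in> borel_measurable \<mu>"
proof (rule borel_measurable_lebesgue_integral)
  note kernel_measurable [measurable]
  have "(\<lambda>p. case_prod k p * f (snd p)) \<in> borel_measurable (\<mu> \<Otimes>\<^sub>M \<mu>)"
    by measurable
  then show "(\<lambda>(x, y). k x y * f y) \<in> borel_measurable (\<mu> \<Otimes>\<^sub>M \<mu>)"
    by (simp add: case_prod_unfold)
qed

lemma jump_measurable [measurable]: "f \<in> borel_measurable \<mu> \<Longrightarrow> jump f \<in> borel_measurable \<mu>"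
  unfolding jump_def by (intro borel_measurable_add borel_measurable_times borel_measurable_diff kernel_avg_measurable) auto

lemma lap_integrand_integrable: "integrable \<mu> f \<Longrightarrow> integrable \<mu> (\<lambda>y. k x y * (f x - f y))"
  by (intro kernel_mult_integrable) simp

lemma lap_eq: "integrable \<mu> f \<Longrightarrow> lap f x = rate * f x - jump f x"
  unfolding lap_def jump_def deg_def right_diff_distrib
  by (subst Bochner_Integration.integral_diff) (auto simp: left_diff_distrib)

lemma kernel_avg_bound:
  assumes "integrable \<mu> f"
  shows "\<bar>\<integral>y. k x y * f y \<partial>\<mu>\<bar> \<le> M * (\<integral>y. \<bar>f y\<bar> \<partial>\<mu>)"
proof -
  have "\<bar>\<integral>y. k x y * f y \<partial>\<mu>\<bar> \<le> (\<integral>y. \<bar>k x y * f y\<bar> \<partial>\<mu>)"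
    by (rule integral_abs_bound)
  also have "\<dots> \<le> (\<integral>y. M * \<bar>f y\<bar> \<partial>\<mu>)"
    using assms kernel_nonneg kernel_le M_nonneg
    by (intro integral_mono) (auto simp: abs_mult intro!: mult_right_mono)
  finally show ?thesis by simp
qed

lemma jump_bound:
  assumes "integrable \<mu> f"
  shows "\<bar>jump f x\<bar> \<le> rate * \<bar>f x\<bar> + M * (\<integral>y. \<bar>f y\<bar> \<partial>\<mu>)"
proof -
  have "\<bar>(rate - deg x) * f x\<bar> \<le> rate * \<bar>f x\<bar>"
    using deg_nonneg[of x] deg_le_rate[of x] by (auto simp: abs_mult intro!: mult_right_mono)
  then show ?thesis
    unfolding jump_def using kernel_avg_bound[OF assms, of x] by linarith
qed

lemma jump_integrable [simp]:
  assumes "integrable \<mu> f" shows "integrable \<mu> (jump f)"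
proof (rule Bochner_Integration.integrable_bound)
  show "integrable \<mu> (\<lambda>x. rate * \<bar>f x\<bar> + M * (\<integral>y. \<bar>f y\<bar> \<partial>\<mu>))" using assms by simp
  show "jump f \<in> borel_measurable \<mu>" using assms by measurable
  show "AE x in \<mu>. norm (jump f x) \<le> norm (rate * \<bar>f x\<bar> + M * (\<integral>y. \<bar>f y\<bar> \<partial>\<mu>))"
    using jump_bound[OF assms] by (auto intro: order_trans[OF _ abs_ge_self])
qed

lemma envelope_nonneg: "0 \<le> envelope f x"
  by (simp add: envelope_def integral_nonneg_AE)

lemma envelope_integrable [simp]: "integrable \<mu> f \<Longrightarrow> integrable \<mu> (envelope f)"
  unfolding envelope_def by simp

lemma abs_le_envelope: "\<bar>f x\<bar> \<le> envelope f x"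
  by (simp add: envelope_def integral_nonneg_AE)

text \<open>Integrating \<open>jump_bound\<close> turns the constant summand with factor
  \<open>M\<close> into one with factor \<open>M * measure \<mu> UNIV\<close>, a second
  \<open>rate\<close>; hence the 2.\<close>

lemma jump_L1:
  assumes "integrable \<mu> f"
  shows "(\<integral>x. \<bar>jump f x\<bar> \<partial>\<mu>) \<le> 2 * rate * (\<integral>y. \<bar>f y\<bar> \<partial>\<mu>)"
proof -
  have "(\<integral>x. \<bar>jump f x\<bar> \<partial>\<mu>) \<le> (\<integral>x. rate * \<bar>f x\<bar> + M * (\<integral>y. \<bar>f y\<bar> \<partial>\<mu>) \<partial>\<mu>)"
    using assms jump_bound[OF assms] by (intro integral_mono) auto
  also have "\<dots> = 2 * rate * (\<integral>y. \<bar>f y\<bar> \<partial>\<mu>)"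
    using assms by (simp add: rate_def space_UNIV)
  finally show ?thesis .
qed

text \<open>The value of \<open>jump f\<close> at x is controlled by |f x| and the L1 norm of f, and
  its L1 norm by the L1 norm of f. The pair is thus closed under \<open>jump\<close>, which allows
  iteration.\<close>

lemma envelope_jump:
  assumes "integrable \<mu> f" shows "envelope (jump f) x \<le> growth * envelope f x"
proof -
  let ?n = "\<integral>y. \<bar>f y\<bar> \<partial>\<mu>"
  have n: "0 \<le> ?n" by (simp add: integral_nonneg_AE)
  have "envelope (jump f) x \<le> rate * \<bar>f x\<bar> + M * ?n + 2 * rate * ?n"
    unfolding envelope_def[of "jump f"] using jump_bound[OF assms, of x] jump_L1[OF assms] by linarith
  also have "\<dots> \<le> growth * \<bar>f x\<bar> + growth * ?n"
    unfolding growth_def distrib_right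
    using mult_nonneg_nonneg[OF rate_nonneg abs_ge_zero[of "f x"]] mult_nonneg_nonneg[OF M_nonneg abs_ge_zero[of "f x"]]
      mult_nonneg_nonneg[OF rate_nonneg n] mult_nonneg_nonneg[OF M_nonneg n] n by linarith
  finally show ?thesis by (simp add: envelope_def algebra_simps)
qed

lemma jump_pow:
  assumes "integrable \<mu> f"
  shows jump_pow_integrable: "integrable \<mu> ((jump ^^ n) f)"
    and jump_pow_envelope: "envelope ((jump ^^ n) f) x \<le> growth ^ n * envelope f x"
proof (induction n)
  case (Suc n)
  show "integrable \<mu> ((jump ^^ Suc n) f)" using Suc by simp
  have "envelope ((jump ^^ Suc n) f) x \<le> growth * envelope ((jump ^^ n) f) x"
    using envelope_jump[OF Suc(1)] by simp
  also have "\<dots> \<le> growth * (growth ^ n * envelope f x)"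
    using Suc(2) growth_pos by (intro mult_left_mono) auto
  finally show "envelope ((jump ^^ Suc n) f) x \<le> growth ^ Suc n * envelope f x" by simp
qed (use assms in auto)

lemma jump_pow_bound:
  assumes "integrable \<mu> f"
  shows "\<bar>(jump ^^ n) f x\<bar> \<le> envelope f x * growth ^ n"
  using order_trans[OF abs_le_envelope jump_pow_envelope[OF assms]] by (simp add: mult.commute)

lemma jump_linear:
  assumes "integrable \<mu> f" "integrable \<mu> g"
  shows "jump (\<lambda>z. a * f z + b * g z) = (\<lambda>x. a * jump f x + b * jump g x)"
proof
  fix x
  have "(\<integral>y. k x y * (a * f y + b * g y) \<partial>\<mu>)
      = (\<integral>y. a * (k x y * f y) + b * (k x y * g y) \<partial>\<mu>)"
    by (simp add: algebra_simps)
  also have "\<dots> = a * (\<integral>y. k x y * f y \<partial>\<mu>) + b * (\<integral>y. k x y * g y \<partial>\<mu>)"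
    using assms by simp
  finally show "jump (\<lambda>z. a * f z + b * g z) x = a * jump f x + b * jump g x"
    unfolding jump_def by (simp add: algebra_simps)
qed

lemma jump_pow_linear:
  assumes "integrable \<mu> f" "integrable \<mu> g"
  shows "(jump ^^ n) (\<lambda>z. a * f z + b * g z) = (\<lambda>x. a * (jump ^^ n) f x + b * (jump ^^ n) g x)"
  by (induction n) (simp_all add: jump_linear jump_pow_integrable assms)

section \<open>The exponential series: termwise integration and the semigroup law\<close>

lemma egf_measurable [measurable]:
  assumes "integrable \<mu> f"
  shows "(\<lambda>x. egf (\<lambda>n. (jump ^^ n) f x) t) \<in> borel_measurable \<mu>"
  unfolding egf_def using borel_measurable_integrable[OF jump_pow_integrable[OF assms]]
  by (intro borel_measurable_suminf borel_measurable_times) auto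

lemma heat_measurable:
  "integrable \<mu> f \<Longrightarrow> heat t f \<in> borel_measurable \<mu>"
  unfolding heat_def by measurable

text \<open>Termwise integration, justified by \<open>D * envelope f\<close> times an exponential
  series. With \<open>g\<close> a section \<open>k x\<close> it makes \<open>jump\<close> commute
  with the series; with \<open>g\<close> constant 1 it computes the integral of
  \<open>heat t f\<close>.\<close>

lemma egf_series_integral:
  assumes "integrable \<mu> f" "g \<in> borel_measurable \<mu>" "\<And>y. \<bar>g y\<bar> \<le> D"
  shows "(\<lambda>n. t ^ n / fact n * (\<integral>y. g y * (jump ^^ n) f y \<partial>\<mu>)) sums
           (\<integral>y. g y * egf (\<lambda>n. (jump ^^ n) f y) t \<partial>\<mu>)"
    and "integrable \<mu> (\<lambda>y. g y * egf (\<lambda>n. (jump ^^ n) f y) t)"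
proof -
  let ?u = "\<lambda>n y. t ^ n / fact n * (g y * (jump ^^ n) f y)"
  have D: "0 \<le> D" using assms(3) abs_ge_zero order_trans by blast
  have bound: "\<bar>?u n y\<bar> \<le> D * envelope f y * ((\<bar>t\<bar> * growth) ^ n / fact n)" for n y
  proof -
    have "\<bar>g y * (jump ^^ n) f y\<bar> \<le> (D * envelope f y) * growth ^ n"
      unfolding abs_mult mult.assoc
      by (intro mult_mono assms(3) jump_pow_bound[OF assms(1)] D) auto
    then have "\<bar>t ^ n / fact n\<bar> * \<bar>g y * (jump ^^ n) f y\<bar> \<le> \<bar>t ^ n / fact n\<bar> * ((D * envelope f y) * growth ^ n)"
      by (intro mult_left_mono) auto
    then show ?thesis
      by (simp add: abs_mult power_abs power_mult_distrib mult_ac)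
  qed
  have int_u: "integrable \<mu> (?u n)" for n
  proof (rule Bochner_Integration.integrable_bound)
    show "integrable \<mu> (\<lambda>y. D * envelope f y * ((\<bar>t\<bar> * growth) ^ n / fact n))"
      using assms(1) by simp
    show "?u n \<in> borel_measurable \<mu>"
      using assms(2) borel_measurable_integrable[OF jump_pow_integrable[OF assms(1)]] by measurable
    show "AE y in \<mu>. norm (?u n y) \<le> norm (D * envelope f y * ((\<bar>t\<bar> * growth) ^ n / fact n))"
      unfolding real_norm_def by (intro AE_I2 order_trans[OF bound abs_ge_self])
  qed
  have sum1: "AE y in \<mu>. summable (\<lambda>n. norm (?u n y))"
    by (intro AE_I2 summable_comparison_test'[OF summable_mult[OF exp_series(1)]])
       (simp only: real_norm_def abs_idempotent, rule bound)
  have sum2: "summable (\<lambda>n. \<integral>y. norm (?u n y) \<partial>\<mu>)"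
  proof (rule summable_comparison_test'[OF summable_mult[OF exp_series(1)]])
    fix n :: nat
    have "(\<integral>y. \<bar>?u n y\<bar> \<partial>\<mu>) \<le> (\<integral>y. D * envelope f y * ((\<bar>t\<bar> * growth) ^ n / fact n) \<partial>\<mu>)"
      using assms(1) by (intro integral_mono integrable_abs int_u bound) simp
    then show "norm (\<integral>y. norm (?u n y) \<partial>\<mu>) \<le> (D * (\<integral>y. envelope f y \<partial>\<mu>)) * ((\<bar>t\<bar> * growth) ^ n / fact n)"
      using assms(1) by (simp add: integral_nonneg_AE)
  qed
  have eq: "(\<Sum>n. ?u n y) = g y * egf (\<lambda>n. (jump ^^ n) f y) t" for y
    unfolding egf_def
    by (subst suminf_mult[symmetric, OF egf_summable[OF jump_pow_bound[OF assms(1)]]]) (simp add: mult_ac)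
  show "(\<lambda>n. t ^ n / fact n * (\<integral>y. g y * (jump ^^ n) f y \<partial>\<mu>)) sums
           (\<integral>y. g y * egf (\<lambda>n. (jump ^^ n) f y) t \<partial>\<mu>)"
    using sums_integral[OF int_u sum1 sum2] unfolding eq by simp
  show "integrable \<mu> (\<lambda>y. g y * egf (\<lambda>n. (jump ^^ n) f y) t)"
    using integrable_suminf[OF int_u sum1 sum2] unfolding eq .
qed

lemma egf_integrable:
  assumes "integrable \<mu> f" shows "integrable \<mu> (\<lambda>y. egf (\<lambda>n. (jump ^^ n) f y) t)"
  using egf_series_integral(2)[OF assms, of "\<lambda>_. 1" 1] by simp

lemma heat_integrable: "integrable \<mu> f \<Longrightarrow> integrable \<mu> (heat t f)"
  unfolding heat_def using egf_integrable by simp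

text \<open>The diagonal part of \<open>jump\<close> is multiplication by a number at x and passes
  through the series; the integral part passes by termwise integration.\<close>

lemma jump_egf:
  assumes "integrable \<mu> f"
  shows "jump (\<lambda>x. egf (\<lambda>n. (jump ^^ n) f x) t) = (\<lambda>x. egf (\<lambda>n. (jump ^^ n) (jump f) x) t)"
proof
  fix x
  have "(\<lambda>n. (rate - deg x) * (t ^ n / fact n * (jump ^^ n) f x)
          + t ^ n / fact n * (\<integral>y. k x y * (jump ^^ n) f y \<partial>\<mu>)) sums
        jump (\<lambda>x. egf (\<lambda>n. (jump ^^ n) f x) t) x"
    unfolding jump_def[of "\<lambda>x. egf (\<lambda>n. (jump ^^ n) f x) t"]
  proof (intro sums_add sums_mult)
    show "(\<lambda>n. t ^ n / fact n * (jump ^^ n) f x) sums egf (\<lambda>n. (jump ^^ n) f x) t"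
      unfolding egf_def by (rule summable_sums[OF egf_summable[OF jump_pow_bound[OF assms]]])
    show "(\<lambda>n. t ^ n / fact n * (\<integral>y. k x y * (jump ^^ n) f y \<partial>\<mu>)) sums
            (\<integral>y. k x y * egf (\<lambda>n. (jump ^^ n) f y) t \<partial>\<mu>)"
      using kernel_nonneg kernel_le
      by (intro egf_series_integral(1)[OF assms _, of "k x" M]) auto
  qed
  moreover have "(\<lambda>n. (rate - deg x) * (t ^ n / fact n * (jump ^^ n) f x)
          + t ^ n / fact n * (\<integral>y. k x y * (jump ^^ n) f y \<partial>\<mu>))
        = (\<lambda>n. t ^ n / fact n * (jump ^^ n) (jump f) x)"
    unfolding funpow_swap1[symmetric] by (simp add: jump_def algebra_simps diff_divide_distrib)
  ultimately show "jump (\<lambda>x. egf (\<lambda>n. (jump ^^ n) f x) t) x = egf (\<lambda>n. (jump ^^ n) (jump f) x) t"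
    unfolding egf_def by (simp add: sums_iff)
qed

text \<open>Iterating on the series shifts its index by m, which produces the double sequence of
  \<open>egf_add\<close>.\<close>

lemma jump_pow_egf:
  assumes "integrable \<mu> f"
  shows "(jump ^^ m) (\<lambda>x. egf (\<lambda>n. (jump ^^ n) f x) t) = (\<lambda>x. egf (\<lambda>n. (jump ^^ (m + n)) f x) t)"
proof (induction m)
  case (Suc m)
  have "(\<lambda>x. egf (\<lambda>n. (jump ^^ (m + n)) f x) t) = (\<lambda>x. egf (\<lambda>n. (jump ^^ n) ((jump ^^ m) f) x) t)"
    by (simp add: add.commute[of m] funpow_add)
  then have "(jump ^^ Suc m) (\<lambda>x. egf (\<lambda>n. (jump ^^ n) f x) t)
      = (\<lambda>x. egf (\<lambda>n. (jump ^^ n) (jump ((jump ^^ m) f)) x) t)"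
    using Suc jump_egf[OF jump_pow_integrable[OF assms]] by simp
  moreover have "(jump ^^ n) (jump ((jump ^^ m) f)) = (jump ^^ (Suc m + n)) f" for n
    unfolding add.commute[of "Suc m"] funpow_add by simp
  ultimately show ?case by simp
qed simp

lemma heat_add:
  assumes "integrable \<mu> f"
  shows "heat (s + t) f x = heat s (heat t f) x"
proof -
  let ?E = "\<lambda>x. egf (\<lambda>n. (jump ^^ n) f x) t"
  \<comment> \<open>The scalar \<open>exp (- (rate * t))\<close> is pulled out of the iterates by
    linearity with second coefficient 0; the second function is a dummy.\<close>
  have "(jump ^^ m) (heat t f) = (\<lambda>x. exp (- (rate * t)) * egf (\<lambda>n. (jump ^^ (m + n)) f x) t)" for m
    using jump_pow_linear[OF egf_integrable[OF assms] egf_integrable[OF assms], of m "exp (- (rate * t))" t 0 t]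
    by (simp add: heat_def[abs_def] jump_pow_egf[OF assms])
  then have "heat s (heat t f) x = exp (- (rate * s)) *
      egf (\<lambda>m. exp (- (rate * t)) * egf (\<lambda>n. (jump ^^ (m + n)) f x) t) s"
    by (simp add: heat_def[of s])
  also have "egf (\<lambda>m. exp (- (rate * t)) * egf (\<lambda>n. (jump ^^ (m + n)) f x) t) s
      = exp (- (rate * t)) * egf (\<lambda>m. egf (\<lambda>n. (jump ^^ (m + n)) f x) t) s"
  proof -
    \<comment> \<open>The outer sequence grows geometrically because it is the orbit under
      \<open>jump\<close> of the integrable function \<open>?E\<close>.\<close>
    have "\<bar>egf (\<lambda>n. (jump ^^ (m + n)) f x) t\<bar> \<le> envelope ?E x * growth ^ m" for m
      using jump_pow_bound[OF egf_integrable[OF assms], of m t x] by (simp add: jump_pow_egf[OF assms])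
    then show ?thesis
      unfolding egf_def[of _ s]
      by (subst suminf_mult[symmetric, OF egf_summable[of _ "envelope ?E x" growth]]) (auto simp: mult_ac)
  qed
  also have "egf (\<lambda>m. egf (\<lambda>n. (jump ^^ (m + n)) f x) t) s = egf (\<lambda>n. (jump ^^ n) f x) (s + t)"
    using growth_pos by (intro egf_add[symmetric, OF jump_pow_bound[OF assms]]) auto
  also have "exp (- (rate * s)) * (exp (- (rate * t)) * egf (\<lambda>n. (jump ^^ n) f x) (s + t)) = heat (s + t) f x"
    by (simp add: heat_def exp_add[symmetric] algebra_simps flip: mult.assoc)
  finally show ?thesis ..
qed

lemma heat_zero: "heat 0 f x = f x"
  using powser_zero[of "\<lambda>n. (jump ^^ n) f x / fact n"] by (simp add: heat_def egf_def mult.commute)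

lemma heat_linear:
  assumes "integrable \<mu> f" "integrable \<mu> g"
  shows "heat t (\<lambda>z. a * f z + b * g z) x = a * heat t f x + b * heat t g x"
proof -
  have "egf (\<lambda>n. a * (jump ^^ n) f x + b * (jump ^^ n) g x) t =
      (\<Sum>n. a * (t ^ n / fact n * (jump ^^ n) f x) + b * (t ^ n / fact n * (jump ^^ n) g x))"
    unfolding egf_def by (simp add: algebra_simps)
  also have "\<dots> = a * egf (\<lambda>n. (jump ^^ n) f x) t + b * egf (\<lambda>n. (jump ^^ n) g x) t"
    unfolding egf_def
    by (intro sums_unique[symmetric] sums_add sums_mult summable_sums egf_summable[OF jump_pow_bound] assms)
  finally show ?thesis
    by (simp add: heat_def jump_pow_linear[OF assms] algebra_simps)
qed

section \<open>Null sets, positivity, constants and the integral\<close>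

lemma jump_cong_AE:
  assumes "integrable \<mu> f" "integrable \<mu> g" "AE x in \<mu>. f x = g x"
  shows "AE x in \<mu>. jump f x = jump g x"
proof -
  have "(\<integral>y. k x y * f y \<partial>\<mu>) = (\<integral>y. k x y * g y \<partial>\<mu>)" for x
    using assms by (intro integral_cong_AE) auto
  then show ?thesis using assms(3) by (auto simp: jump_def)
qed

text \<open>There are countably many iterates, so outside one null set all of them agree and the
  series coincide term by term.\<close>

lemma heat_cong_AE:
  assumes "integrable \<mu> f" "integrable \<mu> g" "AE x in \<mu>. f x = g x"
  shows "AE x in \<mu>. heat t f x = heat t g x"
proof -
  have "AE x in \<mu>. (jump ^^ n) f x = (jump ^^ n) g x" for n
    by (induction n) (use assms in \<open>simp_all add: jump_cong_AE jump_pow_integrable\<close>)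
  then have "AE x in \<mu>. \<forall>n. (jump ^^ n) f x = (jump ^^ n) g x"
    by (simp add: AE_all_countable)
  then show ?thesis by eventually_elim (simp add: heat_def)
qed

text \<open>The diagonal coefficient \<open>rate - deg x\<close> is nonnegative by
  \<open>deg_le_rate\<close>, which is why \<open>rate\<close> was added.\<close>

lemma jump_nonneg_AE:
  assumes "AE x in \<mu>. 0 \<le> f x" shows "AE x in \<mu>. 0 \<le> jump f x"
proof -
  have "0 \<le> (\<integral>y. k x y * f y \<partial>\<mu>)" for x
    using assms by (intro integral_nonneg_AE) (auto simp: kernel_nonneg)
  then show ?thesis
    using assms deg_le_rate by (auto simp: jump_def intro!: add_nonneg_nonneg mult_nonneg_nonneg)
qed

lemma heat_nonneg_AE:
  assumes "integrable \<mu> f" "AE x in \<mu>. 0 \<le> f x" "0 \<le> t"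
  shows "AE x in \<mu>. 0 \<le> heat t f x"
proof -
  have "AE x in \<mu>. 0 \<le> (jump ^^ n) f x" for n
    by (induction n) (use assms in \<open>simp_all add: jump_nonneg_AE\<close>)
  then have "AE x in \<mu>. \<forall>n. 0 \<le> (jump ^^ n) f x"
    by (simp add: AE_all_countable)
  then show ?thesis
    by eventually_elim
       (use assms(3) in \<open>auto simp: heat_def egf_def simp del: times_divide_eq_left
          intro!: mult_nonneg_nonneg suminf_nonneg egf_summable[OF jump_pow_bound[OF assms(1)]]\<close>)
qed

text \<open>On constants the integral term restores exactly the \<open>deg x\<close> subtracted in
  the diagonal term, so 1 is an eigenvector with eigenvalue \<open>rate\<close>. The factor
  \<open>exp (- (rate * t))\<close> in \<open>heat\<close> compensates for this eigenvalue.\<close>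

lemma jump_pow_one: "(jump ^^ n) (\<lambda>_. 1) x = rate ^ n"
proof -
  have "(jump ^^ n) (\<lambda>_. 1) = (\<lambda>_. rate ^ n)"
    by (induction n) (auto simp: jump_def deg_def algebra_simps)
  then show ?thesis by simp
qed

lemma heat_one: "heat t (\<lambda>_. 1) x = 1"
proof -
  have "egf (\<lambda>n. rate ^ n) t = exp (rate * t)"
    using exp_series(2)[of "rate * t"] by (simp add: egf_def power_mult_distrib mult_ac)
  then show ?thesis by (simp add: heat_def jump_pow_one exp_minus)
qed

text \<open>By Fubini and the symmetry of the kernel, the integral of the kernel averages of f
  equals that of \<open>deg y * f y\<close>, which cancels the subtracted diagonal term.\<close>

lemma jump_integral:
  assumes "integrable \<mu> f" shows "(\<integral>x. jump f x \<partial>\<mu>) = rate * (\<integral>x. f x \<partial>\<mu>)"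
proof -
  interpret pair_sigma_finite \<mu> \<mu> ..
  have int: "integrable (\<mu> \<Otimes>\<^sub>M \<mu>) (\<lambda>(x, y). k x y * f y)"
  proof (rule Fubini_integrable)
    have "(\<lambda>p. case_prod k p * f (snd p)) \<in> borel_measurable (\<mu> \<Otimes>\<^sub>M \<mu>)"
      using assms kernel_measurable by measurable
    then show "(\<lambda>(x, y). k x y * f y) \<in> borel_measurable (\<mu> \<Otimes>\<^sub>M \<mu>)"
      by (simp add: case_prod_unfold)
    show "AE x in \<mu>. integrable \<mu> (\<lambda>y. case (x, y) of (x, y) \<Rightarrow> k x y * f y)"
      using assms by simp
    have [measurable]: "f \<in> borel_measurable \<mu>" using assms by simp
    have "(\<lambda>x. \<integral>y. k x y * \<bar>f y\<bar> \<partial>\<mu>) \<in> borel_measurable \<mu>" by measurable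
    moreover have "\<bar>\<integral>y. k x y * \<bar>f y\<bar> \<partial>\<mu>\<bar> \<le> M * (\<integral>y. \<bar>f y\<bar> \<partial>\<mu>)" for x
      using kernel_avg_bound[of "\<lambda>y. \<bar>f y\<bar>" x] assms by simp
    ultimately show "integrable \<mu> (\<lambda>x. \<integral>y. norm (case (x, y) of (x, y) \<Rightarrow> k x y * f y) \<partial>\<mu>)"
      by (intro integrable_const_bound) (auto simp: abs_mult kernel_nonneg)
  qed
  have "(\<integral>x. \<integral>y. k x y * f y \<partial>\<mu> \<partial>\<mu>) = (\<integral>y. \<integral>x. k x y * f y \<partial>\<mu> \<partial>\<mu>)"
    using Fubini_integral[OF int] by simp
  also have "\<dots> = (\<integral>y. deg y * f y \<partial>\<mu>)"
    by (simp add: deg_def kernel_sym[of _ y for y])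
  finally have *: "(\<integral>x. \<integral>y. k x y * f y \<partial>\<mu> \<partial>\<mu>) = (\<integral>y. deg y * f y \<partial>\<mu>)" .
  have i1: "integrable \<mu> (\<lambda>x. \<integral>y. k x y * f y \<partial>\<mu>)"
    using integrable_fst'[OF int] by simp
  have i2: "integrable \<mu> (\<lambda>x. deg x * f x)"
  proof (rule Bochner_Integration.integrable_bound)
    show "integrable \<mu> (\<lambda>x. rate * f x)" using assms by simp
    show "AE x in \<mu>. norm (deg x * f x) \<le> norm (rate * f x)"
      using deg_nonneg deg_le_rate rate_nonneg by (auto simp: abs_mult intro!: mult_right_mono)
  qed (use assms in measurable)
  have "(\<integral>x. jump f x \<partial>\<mu>) = (\<integral>x. rate * f x - deg x * f x + (\<integral>y. k x y * f y \<partial>\<mu>) \<partial>\<mu>)"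
    by (simp add: jump_def algebra_simps)
  also have "\<dots> = rate * (\<integral>x. f x \<partial>\<mu>)"
    using assms i1 i2 * by simp
  finally show ?thesis .
qed

lemma heat_integral:
  assumes "integrable \<mu> f" shows "(\<integral>x. heat t f x \<partial>\<mu>) = (\<integral>x. f x \<partial>\<mu>)"
proof -
  have pow: "(\<integral>x. (jump ^^ n) f x \<partial>\<mu>) = rate ^ n * (\<integral>x. f x \<partial>\<mu>)" for n
    by (induction n) (simp_all add: jump_integral jump_pow_integrable assms)
  have "(\<lambda>n. t ^ n / fact n * (rate ^ n * (\<integral>x. f x \<partial>\<mu>))) sums (\<integral>x. egf (\<lambda>n. (jump ^^ n) f x) t \<partial>\<mu>)"
    using egf_series_integral(1)[OF assms, of "\<lambda>_. 1" 1 t] by (simp add: pow)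
  moreover have "(\<lambda>n. (rate * t) ^ n / fact n * (\<integral>x. f x \<partial>\<mu>)) sums (exp (rate * t) * (\<integral>x. f x \<partial>\<mu>))"
    using exp_series by (intro sums_mult2) (simp add: sums_iff)
  ultimately have "(\<integral>x. egf (\<lambda>n. (jump ^^ n) f x) t \<partial>\<mu>) = exp (rate * t) * (\<integral>x. f x \<partial>\<mu>)"
    by (simp add: power_mult_distrib mult_ac sums_iff)
  then show ?thesis by (simp add: heat_def exp_minus field_simps)
qed

end

section \<open>Square integrable functions and estimates in the graph norm\<close>

context bounded_kernel
begin

lemma L2_integrable: "f \<in> L2_space \<mu> \<Longrightarrow> integrable \<mu> f"
  unfolding L2_space_def by (auto intro: square_integrable_imp_integrable)

lemma lap_measurable: "integrable \<mu> f \<Longrightarrow> lap f \<in> borel_measurable \<mu>"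
  using lap_eq[of f] by (subst measurable_cong[of _ _ "\<lambda>x. rate * f x - jump f x"]) auto

text \<open>Cauchy-Schwarz against the constant 1, obtained by expanding the nonnegative integral of
  the square of \<open>?m * \<bar>f x\<bar> - ?n\<close>. The factor \<open>?m\<close> can be
  cancelled only if the measure is nonzero; otherwise \<open>?n\<close> is 0.\<close>

lemma L1_le_L2:
  assumes "f \<in> L2_space \<mu>"
  shows "(\<integral>x. \<bar>f x\<bar> \<partial>\<mu>)\<^sup>2 \<le> measure \<mu> UNIV * (\<integral>x. (f x)\<^sup>2 \<partial>\<mu>)"
proof -
  let ?n = "\<integral>x. \<bar>f x\<bar> \<partial>\<mu>" and ?m = "measure \<mu> UNIV"
  note f = L2_integrable[OF assms]
  have sq: "integrable \<mu> (\<lambda>x. (f x)\<^sup>2)" using assms by (simp add: L2_space_def)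
  have "(\<integral>x. (?m * \<bar>f x\<bar> - ?n)\<^sup>2 \<partial>\<mu>) = (\<integral>x. ?m\<^sup>2 * (f x)\<^sup>2 - 2 * ?m * ?n * \<bar>f x\<bar> + ?n\<^sup>2 \<partial>\<mu>)"
    by (simp add: power2_diff power_mult_distrib algebra_simps)
  also have "\<dots> = ?m\<^sup>2 * (\<integral>x. (f x)\<^sup>2 \<partial>\<mu>) - 2 * ?m * ?n * ?n + ?m * ?n\<^sup>2"
    using f sq by (simp add: space_UNIV)
  also have "\<dots> = ?m * (?m * (\<integral>x. (f x)\<^sup>2 \<partial>\<mu>) - ?n\<^sup>2)"
    by (simp only: power2_eq_square) (simp add: algebra_simps)
  finally have "0 \<le> ?m * (?m * (\<integral>x. (f x)\<^sup>2 \<partial>\<mu>) - ?n\<^sup>2)"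
    by (metis integral_nonneg_AE AE_I2 zero_le_power2)
  moreover have "?n = 0" if "?m = 0"
  proof -
    have "emeasure \<mu> (space \<mu>) = 0"
      using that by (simp add: emeasure_eq_measure space_UNIV)
    then have "AE x in \<mu>. \<bar>f x\<bar> = 0"
      by (intro AE_I'[of "space \<mu>"]) auto
    then show ?thesis by (rule integral_eq_zero_AE)
  qed
  ultimately show ?thesis
    by (cases "?m = 0") (auto simp: zero_le_mult_iff measure_le_0_iff)
qed

text \<open>The inequality (u + v)^2 \<le> 2u^2 + 2v^2 splits the squared envelope. Integrating the
  constant v^2 gives one factor of the total mass and \<open>L1_le_L2\<close> a second one, whence
  the constant.\<close>

lemma dominated_L2:
  assumes f: "f \<in> L2_space \<mu>" and g: "g \<in> borel_measurable \<mu>" and "0 \<le> a"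
    and le: "\<And>x. \<bar>g x\<bar> \<le> a * envelope f x"
  shows "g \<in> L2_space \<mu>"
    and "(\<integral>x. (g x)\<^sup>2 \<partial>\<mu>) \<le> a\<^sup>2 * (2 + 2 * (measure \<mu> UNIV)\<^sup>2) * (\<integral>x. (f x)\<^sup>2 \<partial>\<mu>)"
proof -
  let ?n = "\<integral>x. \<bar>f x\<bar> \<partial>\<mu>" and ?m = "measure \<mu> UNIV"
  have sq: "integrable \<mu> (\<lambda>x. (f x)\<^sup>2)" using f by (simp add: L2_space_def)
  have sqle: "(g x)\<^sup>2 \<le> a\<^sup>2 * (2 * (f x)\<^sup>2 + 2 * ?n\<^sup>2)" for x
  proof -
    have "(g x)\<^sup>2 \<le> (a * envelope f x)\<^sup>2" using le by (rule power2_le_iff_abs_le[THEN iffD2, rotated]) (simp add: assms envelope_nonneg)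
    also have "\<dots> = a\<^sup>2 * (\<bar>f x\<bar> + ?n)\<^sup>2" by (simp add: envelope_def power_mult_distrib)
    also have "(\<bar>f x\<bar> + ?n)\<^sup>2 \<le> 2 * (f x)\<^sup>2 + 2 * ?n\<^sup>2"
      using sum_squares_bound[of "\<bar>f x\<bar>" ?n] by (simp add: power2_sum)
    finally show ?thesis by (simp add: mult_left_mono)
  qed
  have int: "integrable \<mu> (\<lambda>x. a\<^sup>2 * (2 * (f x)\<^sup>2 + 2 * ?n\<^sup>2))" using sq by simp
  have gi: "integrable \<mu> (\<lambda>x. (g x)\<^sup>2)"
    by (rule Bochner_Integration.integrable_bound[OF int])
       (use g in measurable, use sqle in \<open>auto intro: order_trans[OF _ abs_ge_self]\<close>)
  then show "g \<in> L2_space \<mu>" using g by (simp add: L2_space_def)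
  have "(\<integral>x. (g x)\<^sup>2 \<partial>\<mu>) \<le> (\<integral>x. a\<^sup>2 * (2 * (f x)\<^sup>2 + 2 * ?n\<^sup>2) \<partial>\<mu>)"
    by (intro integral_mono gi int sqle)
  also have "\<dots> = a\<^sup>2 * (2 * (\<integral>x. (f x)\<^sup>2 \<partial>\<mu>) + 2 * ?m * ?n\<^sup>2)"
    using sq by (simp add: space_UNIV)
  also have "\<dots> \<le> a\<^sup>2 * (2 * (\<integral>x. (f x)\<^sup>2 \<partial>\<mu>) + 2 * ?m * (?m * (\<integral>x. (f x)\<^sup>2 \<partial>\<mu>)))"
    by (intro mult_left_mono add_left_mono L1_le_L2 f) auto
  finally show "(\<integral>x. (g x)\<^sup>2 \<partial>\<mu>) \<le> a\<^sup>2 * (2 + 2 * ?m\<^sup>2) * (\<integral>x. (f x)\<^sup>2 \<partial>\<mu>)"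
    by (simp add: power2_eq_square algebra_simps)
qed

text \<open>The integral of \<open>envelope f\<close> is \<open>1 + measure \<mu> UNIV\<close> times
  the L1 norm of f, so passing to the envelope of \<open>g\<close> costs the factor
  \<open>2 + measure \<mu> UNIV\<close>. The factor \<open>rate + growth\<close> comes from
  \<open>lap\<close> being \<open>rate\<close> times the identity minus \<open>jump\<close>.\<close>

lemma lap_dominated:
  assumes f: "integrable \<mu> f" and g: "integrable \<mu> g" and "0 \<le> a"
    and le: "\<And>x. \<bar>g x\<bar> \<le> a * envelope f x"
  shows "\<bar>lap g x\<bar> \<le> a * ((rate + growth) * (2 + measure \<mu> UNIV)) * envelope f x"
proof -
  let ?n = "\<integral>x. \<bar>f x\<bar> \<partial>\<mu>" and ?m = "measure \<mu> UNIV"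
  have n: "0 \<le> ?n" by (simp add: integral_nonneg_AE)
  have "(\<integral>x. \<bar>g x\<bar> \<partial>\<mu>) \<le> (\<integral>x. a * envelope f x \<partial>\<mu>)"
    using f g le by (intro integral_mono) auto
  also have "\<dots> = a * ((1 + ?m) * ?n)"
    using f by (simp add: envelope_def space_UNIV algebra_simps)
  finally have "envelope g x \<le> a * envelope f x + a * ((1 + ?m) * ?n)"
    using le[of x] by (simp add: envelope_def)
  also have "\<dots> \<le> a * envelope f x + a * ((1 + ?m) * envelope f x)"
    using assms(3) by (intro add_left_mono mult_left_mono) (auto simp: envelope_def)
  finally have *: "envelope g x \<le> a * (2 + ?m) * envelope f x" by (simp add: algebra_simps)
  have "\<bar>lap g x\<bar> \<le> rate * \<bar>g x\<bar> + \<bar>jump g x\<bar>"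
    unfolding lap_eq[OF g] using abs_triangle_ineq4[of "rate * g x" "jump g x"] rate_nonneg by (simp add: abs_mult)
  also have "\<dots> \<le> rate * envelope g x + growth * envelope g x"
    using rate_nonneg order_trans[OF abs_le_envelope envelope_jump[OF g, of x]] by (intro add_mono mult_left_mono abs_le_envelope) auto
  also have "\<dots> \<le> (rate + growth) * (a * (2 + ?m) * envelope f x)"
    unfolding distrib_right[symmetric]
    using rate_nonneg growth_pos by (intro mult_left_mono *) auto
  finally show ?thesis by (simp add: mult_ac)
qed

definition graph_norm_bound :: real where
  "graph_norm_bound = sqrt ((2 + 2 * (measure \<mu> UNIV)\<^sup>2) * (1 + ((rate + growth) * (2 + measure \<mu> UNIV))\<^sup>2))"

text \<open>With c from \<open>lap_dominated\<close> and d from \<open>dominated_L2\<close>, the two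
  parts of the squared norm contribute a^2 d and (a c)^2 d; \<open>graph_norm_bound\<close> is the
  square root of d (1 + c^2).\<close>

lemma dominated_graph_norm:
  assumes f: "f \<in> L2_space \<mu>" and g: "g \<in> borel_measurable \<mu>" and a: "0 \<le> a"
    and le: "\<And>x. \<bar>g x\<bar> \<le> a * envelope f x"
  shows "graph_norm g \<le> a * (graph_norm_bound * graph_norm f)"
proof -
  define c d where "c = (rate + growth) * (2 + measure \<mu> UNIV)" and "d = 2 + 2 * (measure \<mu> UNIV)\<^sup>2"
  let ?F = "\<integral>x. (f x)\<^sup>2 \<partial>\<mu>"
  have c: "0 \<le> a * c" using a rate_nonneg growth_pos by (auto simp: c_def)
  have graph_norm_bound: "graph_norm_bound\<^sup>2 = d * (1 + c\<^sup>2)" by (simp add: graph_norm_bound_def c_def d_def)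
  note gI = L2_integrable[OF dominated_L2(1)[OF f g a le]]
  have "(graph_norm g)\<^sup>2 = (\<integral>x. (g x)\<^sup>2 \<partial>\<mu>) + (\<integral>x. (lap g x)\<^sup>2 \<partial>\<mu>)"
    by (simp add: graph_norm_def integral_nonneg_AE)
  also have "\<dots> \<le> a\<^sup>2 * d * ?F + (a * c)\<^sup>2 * d * ?F"
    unfolding c_def d_def
    by (intro add_mono dominated_L2(2)[OF f g a le]
        dominated_L2(2)[OF f lap_measurable[OF gI] c[unfolded c_def] lap_dominated[OF L2_integrable[OF f] gI a le]])
  also have "\<dots> = (a * graph_norm_bound)\<^sup>2 * ?F"
    by (simp add: graph_norm_bound power_mult_distrib algebra_simps)
  also have "\<dots> \<le> (a * graph_norm_bound)\<^sup>2 * (graph_norm f)\<^sup>2"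
    by (intro mult_left_mono) (auto simp: graph_norm_def integral_nonneg_AE)
  also have "\<dots> = (a * (graph_norm_bound * graph_norm f))\<^sup>2"
    by (simp add: power_mult_distrib mult_ac)
  finally show ?thesis
    by (rule power2_le_imp_le) (use a in \<open>simp add: graph_norm_bound_def graph_norm_def integral_nonneg_AE\<close>)
qed

lemma graph_norm_nonneg: "0 \<le> graph_norm f"
  by (simp add: graph_norm_def integral_nonneg_AE)

text \<open>Strong continuity and the limit of the difference quotient are both reduced by this
  lemma to a pointwise estimate whose scalar factor tends to 0.\<close>

lemma dominated_graph_norm_tendsto:
  assumes f: "f \<in> L2_space \<mu>" and g: "\<And>t. g t \<in> borel_measurable \<mu>"
    and le: "eventually (\<lambda>t. 0 \<le> a t \<and> (\<forall>x. \<bar>g t x\<bar> \<le> a t * envelope f x)) F" and a: "(a \<longlongrightarrow> 0) F"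
  shows "((\<lambda>t. graph_norm (g t)) \<longlongrightarrow> 0) F"
proof (rule tendsto_sandwich)
  show "eventually (\<lambda>t. 0 \<le> graph_norm (g t)) F" by (simp add: graph_norm_nonneg)
  show "eventually (\<lambda>t. graph_norm (g t) \<le> a t * (graph_norm_bound * graph_norm f)) F"
    using le by eventually_elim (auto intro: dominated_graph_norm[OF f g])
  show "((\<lambda>t. a t * (graph_norm_bound * graph_norm f)) \<longlongrightarrow> 0) F" using tendsto_mult_left_zero[OF a] .
qed simp

lemma heat_dominated:
  assumes "integrable \<mu> f" "0 \<le> t"
  shows "\<bar>heat t f x\<bar> \<le> exp (- (rate * t)) * exp (t * growth) * envelope f x"
  unfolding heat_def using egf_bound[OF jump_pow_bound[OF assms(1)] assms(2), of x]
  by (simp add: abs_mult mult_ac)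

text \<open>As in the product rule, first the scalar factor changes with the series kept at s, then
  the series changes.\<close>

lemma heat_diff_dominated:
  assumes "integrable \<mu> f" "0 \<le> t" "0 \<le> s"
  shows "\<bar>heat t f x - heat s f x\<bar> \<le>
    (\<bar>exp (- (rate * t)) - exp (- (rate * s))\<bar> * exp (s * growth)
      + exp (- (rate * t)) * \<bar>exp (t * growth) - exp (s * growth)\<bar>) * envelope f x"
proof -
  let ?E = "\<lambda>t. egf (\<lambda>n. (jump ^^ n) f x) t"
  have eq: "heat t f x - heat s f x = (exp (- (rate * t)) - exp (- (rate * s))) * ?E s
       + exp (- (rate * t)) * (?E t - ?E s)"
    by (simp add: heat_def algebra_simps)
  have "\<bar>(exp (- (rate * t)) - exp (- (rate * s))) * ?E s\<bar>
      \<le> \<bar>exp (- (rate * t)) - exp (- (rate * s))\<bar> * (envelope f x * exp (s * growth))"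
    unfolding abs_mult by (intro mult_left_mono egf_bound[OF jump_pow_bound[OF assms(1)] assms(3)]) auto
  moreover have "\<bar>exp (- (rate * t)) * (?E t - ?E s)\<bar>
      \<le> exp (- (rate * t)) * (envelope f x * \<bar>exp (t * growth) - exp (s * growth)\<bar>)"
    unfolding abs_mult abs_exp_cancel
    using growth_pos assms(2,3) envelope_nonneg
    by (intro mult_left_mono egf_diff_bound[OF jump_pow_bound[OF assms(1)]]) auto
  ultimately show ?thesis
    unfolding eq by (simp add: algebra_simps)
qed

text \<open>Inserting f + t jump f + R for the series splits the error into three terms. Their
  coefficients tend to 0 with t, as the quotients of the two exponentials tend to
  \<open>- rate\<close> and \<open>growth\<close>.\<close>

lemma heat_quotient_dominated:
  assumes "integrable \<mu> f" "0 < t"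
  shows "\<bar>(heat t f x - f x) / t - - lap f x\<bar> \<le>
    (\<bar>(exp (- (rate * t)) - 1) / t + rate\<bar> + \<bar>exp (- (rate * t)) - 1\<bar> * growth
       + exp (- (rate * t)) * ((exp (t * growth) - 1) / t - growth)) * envelope f x"
proof -
  let ?E = "egf (\<lambda>n. (jump ^^ n) f x) t" and ?e = "exp (- (rate * t))"
  define R where "R = ?E - f x - t * jump f x"
  have R: "\<bar>R\<bar> \<le> envelope f x * (exp (t * growth) - 1 - t * growth)"
    using egf_taylor_bound[OF jump_pow_bound[OF assms(1)], of t x] assms(2) by (simp add: R_def)
  have "?E = f x + t * jump f x + R" by (simp add: R_def)
  then have eq: "(heat t f x - f x) / t - - lap f x =
      ((?e - 1) / t + rate) * f x + (?e - 1) * jump f x + ?e * (R / t)"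
    using assms(2) unfolding lap_eq[OF assms(1)] heat_def by (simp add: field_simps)
  have "\<bar>((?e - 1) / t + rate) * f x\<bar> \<le> \<bar>(?e - 1) / t + rate\<bar> * envelope f x"
    unfolding abs_mult by (intro mult_left_mono abs_le_envelope) auto
  moreover have "\<bar>(?e - 1) * jump f x\<bar> \<le> \<bar>?e - 1\<bar> * (growth * envelope f x)"
    unfolding abs_mult by (intro mult_left_mono order_trans[OF abs_le_envelope envelope_jump[OF assms(1)]]) auto
  moreover have "\<bar>?e * (R / t)\<bar> \<le> ?e * (((exp (t * growth) - 1) / t - growth) * envelope f x)"
  proof -
    have "\<bar>R / t\<bar> \<le> envelope f x * (exp (t * growth) - 1 - t * growth) / t"
      using R assms(2) by (simp add: divide_right_mono)
    also have "\<dots> = ((exp (t * growth) - 1) / t - growth) * envelope f x"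
      using assms(2) by (simp add: field_simps)
    finally show ?thesis unfolding abs_mult abs_exp_cancel by (intro mult_left_mono) auto
  qed
  moreover have "\<bar>u + v + w\<bar> \<le> U * d + V * growth * d + ?e * W * d"
    if "\<bar>u\<bar> \<le> U * d" "\<bar>v\<bar> \<le> V * (growth * d)" "\<bar>w\<bar> \<le> ?e * (W * d)" for u v w U V W d :: real
    using that unfolding mult.assoc by linarith
  ultimately show ?thesis
    unfolding eq distrib_right[of _ _ "envelope f x"] by blast
qed

lemma exp_quotient_limit: "((\<lambda>t. (exp (c * t) - 1) / t) \<longlongrightarrow> c) (at_right (0::real))" for c :: real
proof -
  have "((\<lambda>t. exp (c * t)) has_real_derivative c) (at 0)"
    by (auto intro!: derivative_eq_intros)
  then show ?thesis
    by (auto simp: has_field_derivative_iff intro: filterlim_at_within_not_equal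
        elim: tendsto_mono[OF at_le[OF subset_UNIV]])
qed

lemma heat_L2:
  assumes "f \<in> L2_space \<mu>" "0 \<le> t" shows "heat t f \<in> L2_space \<mu>"
  by (rule dominated_L2(1)[OF assms(1) heat_measurable[OF L2_integrable[OF assms(1)]] _
        heat_dominated[OF L2_integrable[OF assms(1)] assms(2)]]) simp

section \<open>Strong continuity, the generator and the Markov property\<close>

lemma heat_C0_semigroup: "C0_semigroup \<mu> (L2_space \<mu>) graph_norm heat"
  unfolding C0_semigroup_def
proof (intro conjI allI impI ballI)
  show "\<exists>C. \<forall>f\<in>L2_space \<mu>. graph_norm (heat t f) \<le> C * graph_norm f" if "0 \<le> t" for t
    using dominated_graph_norm[OF _ heat_measurable _ heat_dominated] that L2_integrable
    by (intro exI[of _ "exp (- (rate * t)) * exp (t * growth) * graph_norm_bound"]) (simp add: mult.assoc)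
next
  fix f s assume f: "f \<in> L2_space \<mu>" and s: "(0::real) \<le> s"
  note fi = L2_integrable[OF f]
  let ?a = "\<lambda>t. \<bar>exp (- (rate * t)) - exp (- (rate * s))\<bar> * exp (s * growth)
      + exp (- (rate * t)) * \<bar>exp (t * growth) - exp (s * growth)\<bar>"
  show "((\<lambda>t. graph_norm (\<lambda>x. heat t f x - heat s f x)) \<longlongrightarrow> 0) (at s within {0..})"
  proof (rule dominated_graph_norm_tendsto[OF f])
    show "(\<lambda>x. heat t f x - heat s f x) \<in> borel_measurable \<mu>" for t
      by (intro borel_measurable_diff heat_measurable fi)
    have "eventually (\<lambda>t. t \<in> {0..}) (at s within {0..})" by (simp add: eventually_at_filter)
    then show "eventually (\<lambda>t. 0 \<le> ?a t \<and> (\<forall>x. \<bar>heat t f x - heat s f x\<bar> \<le> ?a t * envelope f x)) (at s within {0..})"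
      by eventually_elim (use heat_diff_dominated[OF fi _ s] in auto)
    have "(?a \<longlongrightarrow> \<bar>exp (- (rate * s)) - exp (- (rate * s))\<bar> * exp (s * growth)
      + exp (- (rate * s)) * \<bar>exp (s * growth) - exp (s * growth)\<bar>) (at s within {0..})"
      by (intro tendsto_intros)
    then show "(?a \<longlongrightarrow> 0) (at s within {0..})" by simp
  qed
next
  show "AE x in \<mu>. heat t f x = heat t g x"
    if "f \<in> L2_space \<mu>" "g \<in> L2_space \<mu>" "AE x in \<mu>. f x = g x" for t f g
    by (rule heat_cong_AE[OF L2_integrable[OF that(1)] L2_integrable[OF that(2)] that(3)])
qed (auto intro: heat_L2 simp: heat_linear[OF L2_integrable L2_integrable] heat_zero heat_add[OF L2_integrable])

lemma L2_diff:
  assumes "f \<in> L2_space \<mu>" "g \<in> L2_space \<mu>" shows "(\<lambda>x. f x - g x) \<in> L2_space \<mu>"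
proof -
  have [measurable]: "f \<in> borel_measurable \<mu>" "g \<in> borel_measurable \<mu>" using assms by (auto simp: L2_space_def)
  have "integrable \<mu> (\<lambda>x. (f x - g x)\<^sup>2)"
  proof (rule Bochner_Integration.integrable_bound)
    show "integrable \<mu> (\<lambda>x. 2 * (f x)\<^sup>2 + 2 * (g x)\<^sup>2)" using assms by (simp add: L2_space_def)
    have "(f x - g x)\<^sup>2 \<le> 2 * (f x)\<^sup>2 + 2 * (g x)\<^sup>2" for x
      using sum_squares_bound[of "f x" "- g x"] by (simp add: power2_diff)
    then show "AE x in \<mu>. norm ((f x - g x)\<^sup>2) \<le> norm (2 * (f x)\<^sup>2 + 2 * (g x)\<^sup>2)" by simp
  qed measurable
  then show ?thesis by (simp add: L2_space_def)
qed

lemma lap_L2: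
  assumes "f \<in> L2_space \<mu>" shows "lap f \<in> L2_space \<mu>"
proof (rule dominated_L2(1)[OF assms lap_measurable[OF L2_integrable[OF assms]]])
  show "\<bar>lap f x\<bar> \<le> 1 * ((rate + growth) * (2 + measure \<mu> UNIV)) * envelope f x" for x
    using L2_integrable[OF assms] by (rule lap_dominated) (auto simp: L2_integrable[OF assms] abs_le_envelope)
qed (use rate_nonneg growth_pos in simp)

lemma heat_quotient_tendsto:
  assumes f: "f \<in> L2_space \<mu>"
  shows "((\<lambda>t. graph_norm (\<lambda>x. (heat t f x - f x) / t - - lap f x)) \<longlongrightarrow> 0) (at_right 0)"
proof (rule dominated_graph_norm_tendsto[OF f])
  note fi = L2_integrable[OF f]
  let ?a = "\<lambda>t. \<bar>(exp (- (rate * t)) - 1) / t + rate\<bar> + \<bar>exp (- (rate * t)) - 1\<bar> * growth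
       + exp (- (rate * t)) * ((exp (t * growth) - 1) / t - growth)"
  show "(\<lambda>x. (heat t f x - f x) / t - - lap f x) \<in> borel_measurable \<mu>" for t
    using fi by (intro borel_measurable_diff borel_measurable_uminus borel_measurable_divide heat_measurable lap_measurable) auto
  have "0 \<le> ?a t" if "0 < t" for t
  proof -
    have "t * growth \<le> exp (t * growth) - 1" using exp_ge_add_one_self[of "t * growth"] by linarith
    then have "growth \<le> (exp (t * growth) - 1) / t" using that by (simp add: field_simps)
    then show ?thesis using growth_pos by simp
  qed
  moreover have "eventually (\<lambda>t. 0 < t) (at_right (0::real))" by (rule eventually_at_right_less)
  ultimately show "eventually (\<lambda>t. 0 \<le> ?a t \<and> (\<forall>x. \<bar>(heat t f x - f x) / t - - lap f x\<bar> \<le> ?a t * envelope f x)) (at_right 0)"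
    using heat_quotient_dominated[OF fi] by (elim eventually_mono) blast
  have "(?a \<longlongrightarrow> \<bar>- rate + rate\<bar> + \<bar>exp (- (rate * 0)) - 1\<bar> * growth
       + exp (- (rate * 0)) * (growth - growth)) (at_right 0)"
    using exp_quotient_limit[of "- rate"] exp_quotient_limit[of growth]
    by (intro tendsto_intros) (auto simp: mult.commute)
  then show "(?a \<longlongrightarrow> 0) (at_right 0)" by simp
qed

lemma graph_norm_cong_AE:
  assumes "f \<in> L2_space \<mu>" "g \<in> L2_space \<mu>" "AE x in \<mu>. f x = g x"
  shows "graph_norm f = graph_norm g"
proof -
  note fg = L2_integrable[OF assms(1)] L2_integrable[OF assms(2)]
  have "AE x in \<mu>. lap f x = lap g x"
    using jump_cong_AE[OF fg assms(3)] assms(3) by eventually_elim (simp add: lap_eq fg)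
  then have "(\<integral>x. (lap f x)\<^sup>2 \<partial>\<mu>) = (\<integral>x. (lap g x)\<^sup>2 \<partial>\<mu>)"
    by (intro integral_cong_AE borel_measurable_power lap_measurable fg) auto
  moreover have "(\<integral>x. (f x)\<^sup>2 \<partial>\<mu>) = (\<integral>x. (g x)\<^sup>2 \<partial>\<mu>)"
    using assms by (intro integral_cong_AE borel_measurable_power) (auto simp: L2_space_def)
  ultimately show ?thesis by (simp add: graph_norm_def)
qed

lemma L2_norm_tendsto:
  assumes "((\<lambda>t. graph_norm (h t)) \<longlongrightarrow> 0) F"
  shows "((\<lambda>t. \<integral>x. (h t x)\<^sup>2 \<partial>\<mu>) \<longlongrightarrow> 0) F"
proof (rule tendsto_sandwich[of "\<lambda>_. 0"])
  show "((\<lambda>t. (graph_norm (h t))\<^sup>2) \<longlongrightarrow> 0) F" using tendsto_power[OF assms, of 2] by simp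
  show "eventually (\<lambda>t. (\<integral>x. (h t x)\<^sup>2 \<partial>\<mu>) \<le> (graph_norm (h t))\<^sup>2) F"
    by (auto simp: graph_norm_def integral_nonneg_AE)
qed (auto simp: integral_nonneg_AE)

text \<open>The L2 part of the graph norm already determines a function almost everywhere, and the
  squared L2 distance of the two limits is bounded by quantities that tend to 0.\<close>

lemma L2_limit_unique:
  assumes q: "eventually (\<lambda>t. q t \<in> L2_space \<mu>) F" and g: "g \<in> L2_space \<mu>" and h: "h \<in> L2_space \<mu>"
    and lim: "((\<lambda>t. graph_norm (\<lambda>x. q t x - g x)) \<longlongrightarrow> 0) F" "((\<lambda>t. graph_norm (\<lambda>x. q t x - h x)) \<longlongrightarrow> 0) F"
    and F: "F \<noteq> bot"
  shows "AE x in \<mu>. h x = g x"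
proof -
  have "((\<lambda>t. 2 * (\<integral>x. (q t x - g x)\<^sup>2 \<partial>\<mu>) + 2 * (\<integral>x. (q t x - h x)\<^sup>2 \<partial>\<mu>)) \<longlongrightarrow> 2 * 0 + 2 * 0) F"
    by (intro tendsto_intros L2_norm_tendsto lim)
  moreover have "eventually (\<lambda>t. (\<integral>x. (h x - g x)\<^sup>2 \<partial>\<mu>) \<le> 2 * (\<integral>x. (q t x - g x)\<^sup>2 \<partial>\<mu>) + 2 * (\<integral>x. (q t x - h x)\<^sup>2 \<partial>\<mu>)) F"
    using q
  proof eventually_elim
    case (elim t)
    note qg = L2_diff[OF elim g] and qh = L2_diff[OF elim h]
    \<comment> \<open>Parallelogram law, with the square of
      \<open>(q t x - g x) + (q t x - h x)\<close> dropped.\<close>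
    have le: "(h x - g x)\<^sup>2 \<le> 2 * (q t x - g x)\<^sup>2 + 2 * (q t x - h x)\<^sup>2" for x
      using zero_le_power2[of "(q t x - g x) + (q t x - h x)"] by (simp add: power2_eq_square algebra_simps)
    have "(\<integral>x. (h x - g x)\<^sup>2 \<partial>\<mu>) \<le> (\<integral>x. 2 * (q t x - g x)\<^sup>2 + 2 * (q t x - h x)\<^sup>2 \<partial>\<mu>)"
      using qg qh L2_diff[OF h g] by (intro integral_mono le) (auto simp: L2_space_def)
    then show ?case using qg qh by (simp add: L2_space_def)
  qed
  ultimately have "(\<integral>x. (h x - g x)\<^sup>2 \<partial>\<mu>) \<le> 2 * 0 + 2 * 0"
    using F tendsto_lowerbound by blast
  then have "(\<integral>x. (h x - g x)\<^sup>2 \<partial>\<mu>) = 0"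
    by (simp add: integral_nonneg_AE antisym)
  then show ?thesis
    using L2_diff[OF h g] integral_nonneg_eq_0_iff_AE[of \<mu> "\<lambda>x. (h x - g x)\<^sup>2"] by (simp add: L2_space_def)
qed

lemma L2_scale: "f \<in> L2_space \<mu> \<Longrightarrow> (\<lambda>x. c * f x) \<in> L2_space \<mu>"
  by (auto simp: L2_space_def power_mult_distrib)

text \<open>The difference quotients converge to \<open>- lap f\<close> for every f in the space, so
  the domain is everything. One direction is then uniqueness of limits, the other the invariance of
  the norm under almost everywhere equality.\<close>

lemma heat_has_generator: "has_generator \<mu> (L2_space \<mu>) graph_norm heat (\<lambda>f x. - lap f x)"
  unfolding has_generator_def
proof (intro ballI)
  fix f g assume f: "f \<in> L2_space \<mu>" and g: "g \<in> L2_space \<mu>"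
  let ?q = "\<lambda>t x. (heat t f x - f x) / t"
  have neg_lap: "(\<lambda>x. - lap f x) \<in> L2_space \<mu>" using L2_scale[OF lap_L2[OF f], of "-1"] by simp
  have q: "?q t \<in> L2_space \<mu>" if "0 < t" for t
    using L2_scale[OF L2_diff[OF heat_L2[OF f] f], of t "1 / t"] that by simp
  have ev: "eventually (\<lambda>t. 0 < t) (at_right (0::real))" by (rule eventually_at_right_less)
  show "((\<lambda>t. graph_norm (\<lambda>x. ?q t x - g x)) \<longlongrightarrow> 0) (at_right 0) \<longleftrightarrow> (AE x in \<mu>. - lap f x = g x)"
  proof
    assume "((\<lambda>t. graph_norm (\<lambda>x. ?q t x - g x)) \<longlongrightarrow> 0) (at_right 0)"
    then show "AE x in \<mu>. - lap f x = g x"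
      using ev by (intro L2_limit_unique[OF _ g neg_lap _ heat_quotient_tendsto[OF f]]) (auto elim: eventually_mono intro: q)
  next
    assume ae: "AE x in \<mu>. - lap f x = g x"
    have "eventually (\<lambda>t. graph_norm (\<lambda>x. ?q t x - - lap f x) = graph_norm (\<lambda>x. ?q t x - g x)) (at_right 0)"
      using ev
    proof eventually_elim
      case (elim t)
      show ?case
        by (intro graph_norm_cong_AE L2_diff q elim g neg_lap) (use ae in auto)
    qed
    then show "((\<lambda>t. graph_norm (\<lambda>x. ?q t x - g x)) \<longlongrightarrow> 0) (at_right 0)"
      by (rule Lim_transform_eventually[OF heat_quotient_tendsto[OF f]])
  qed
qed

lemma heat_markov:
  assumes "emeasure \<mu> UNIV \<noteq> 0" shows "markov_property \<mu> (L2_space \<mu>) heat"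
proof -
  have one: "(\<lambda>x. 1) \<in> L2_space \<mu>" by (simp add: L2_space_def)
  have sub: "AE x in \<mu>. heat t f x \<le> 1" if "0 \<le> t" "f \<in> L2_space \<mu>" "AE x in \<mu>. f x \<le> 1" for t f
  proof -
    note fi = L2_integrable[OF that(2)]
    \<comment> \<open>The upper bound 1 follows from positivity applied to 1 - f, since constants
      are fixed; the difference is written in the form that \<open>heat_linear\<close>
      expects.\<close>
    have "AE x in \<mu>. 0 \<le> heat t (\<lambda>x. 1 * 1 + (-1) * f x) x"
      using fi that by (intro heat_nonneg_AE) auto
    then show ?thesis
      using fi by (subst (asm) heat_linear) (auto simp: heat_one)
  qed
  define m where "m = measure \<mu> UNIV"
  have m: "0 < m" "emeasure \<mu> UNIV = ennreal m"
    using assms by (simp_all add: m_def emeasure_eq_measure measure_le_0_iff order.strict_iff_order)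
  define \<pi> where "\<pi> = density \<mu> (\<lambda>_. ennreal (1 / m))"
  have int: "integrable \<pi> h \<longleftrightarrow> integrable \<mu> h" and val: "(\<integral>x. h x \<partial>\<pi>) = (\<integral>x. h x \<partial>\<mu>) / m"
    if "integrable \<mu> h" for h :: "'a \<Rightarrow> real"
    using that m(1) by (simp_all add: \<pi>_def integrable_density integral_density)
  have "prob_space \<pi>"
    using m sets.top[of \<mu>]
    by (intro prob_spaceI) (simp add: \<pi>_def emeasure_density_const space_UNIV ennreal_mult[symmetric])
  moreover have "absolutely_continuous \<mu> \<pi>"
    unfolding \<pi>_def by (intro absolutely_continuousI_density) simp
  moreover have "sets \<pi> = sets \<mu>" by (simp add: \<pi>_def)
  ultimately have inv: "\<exists>\<pi>. prob_space \<pi> \<and> sets \<pi> = sets \<mu> \<and> absolutely_continuous \<mu> \<pi> \<and>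
        (\<forall>t\<ge>0. \<forall>f\<in>L2_space \<mu>. integrable \<pi> f \<longrightarrow>
           integrable \<pi> (heat t f) \<and> (\<integral>x. heat t f x \<partial>\<pi>) = (\<integral>x. f x \<partial>\<pi>))"
    by (intro exI[of _ \<pi>]) (auto simp: int val L2_integrable heat_integrable heat_integral)
  show ?thesis
    unfolding markov_property_def
    by (intro conjI allI impI ballI inv sub one heat_nonneg_AE L2_integrable) (auto simp: heat_one)
qed

end

section \<open>Discretely valued fields\<close>

text \<open>\<open>kabs_less_one\<close> expresses discreteness: no absolute value lies strictly
  between \<open>kabs \<pi>\<close> and 1. All nonzero values are therefore integral powers of
  \<open>kabs \<pi>\<close>, and the balls around a point are indexed by integers.\<close>

locale valued_field =
  fixes \<pi> :: "'k::{field,metric_space}"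
  assumes dist_kabs: "dist x y = kabs (x - y :: 'k)"
    and kabs_mult: "kabs (x * y :: 'k) = kabs x * kabs y"
    and kabs_add: "kabs (x + y :: 'k) \<le> max (kabs x) (kabs y)"
    and kabs_pi: "0 < kabs \<pi>" "kabs \<pi> < 1"
    and kabs_less_one: "kabs (x :: 'k) < 1 \<Longrightarrow> kabs x \<le> kabs \<pi>"
    and finite_residue_field: "finite (residue_field :: 'k set set)"
begin

abbreviation q :: real where "q \<equiv> kabs \<pi>"

lemma kabs_nonneg [simp]: "0 \<le> kabs (x :: 'k)"
  by (simp add: kabs_def)

lemma kabs_eq_0 [simp]: "kabs (x :: 'k) = 0 \<longleftrightarrow> x = 0"
  by (simp add: kabs_def)

lemma kabs_zero [simp]: "kabs (0 :: 'k) = 0"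
  by simp

lemma kabs_pos [simp]: "0 < kabs (x :: 'k) \<longleftrightarrow> x \<noteq> 0"
  by (simp add: kabs_def)

lemma pi_nonzero: "\<pi> \<noteq> 0"
  using kabs_pi by auto

lemma kabs_one [simp]: "kabs (1 :: 'k) = 1"
  using kabs_mult[of 1 1] kabs_eq_0[of 1] by simp

lemma kabs_minus [simp]: "kabs (- x :: 'k) = kabs x"
proof -
  have "kabs (- 1 :: 'k) ^ 2 = 1"
    using kabs_mult[of "- 1" "- 1"] by (simp add: power2_eq_square)
  then have "kabs (- 1 :: 'k) = 1"
    using kabs_nonneg[of "- 1"] by (simp add: power2_eq_1_iff)
  then show ?thesis using kabs_mult[of "- 1" x] by simp
qed

lemma kabs_diff: "kabs (x - y :: 'k) \<le> max (kabs x) (kabs y)"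
  using kabs_add[of x "- y"] by simp

lemma kabs_diff_commute: "kabs (x - y :: 'k) = kabs (y - x)"
  using kabs_minus[of "x - y"] by simp

lemma kabs_power: "kabs (x ^ n :: 'k) = kabs x ^ n"
  by (induction n) (auto simp: kabs_mult)

lemma kabs_inverse: "kabs (inverse x :: 'k) = inverse (kabs x)"
proof (cases "x = 0")
  case False
  then have "kabs x * kabs (inverse x) = 1" using kabs_mult[of x "inverse x"] by simp
  then show ?thesis by (metis inverse_unique)
qed simp

lemma kabs_power_int: "kabs (x powi k :: 'k) = kabs x powi k"
  by (simp add: power_int_def kabs_power kabs_inverse)

lemma kabs_prod: "kabs (\<Prod>i\<in>I. f i :: 'k) = (\<Prod>i\<in>I. kabs (f i))"
  by (induction I rule: infinite_finite_induct) (auto simp: kabs_mult)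

lemma kabs_sum_le:
  assumes "\<And>i. i \<in> I \<Longrightarrow> kabs (f i :: 'k) \<le> C" "0 \<le> C"
  shows "kabs (\<Sum>i\<in>I. f i) \<le> C"
  using assms
proof (induction I rule: infinite_finite_induct)
  case (insert i I)
  then have "max (kabs (f i)) (kabs (sum f I)) \<le> C" by auto
  with kabs_add[of "f i" "sum f I"] have "kabs (f i + sum f I) \<le> C" by (rule order_trans)
  then show ?case using insert(1,2) by simp
qed auto

lemma q_powi_pos [simp]: "0 < q powi k"
  using kabs_pi by simp

lemma q_powi_less_iff: "q powi j < q powi k \<longleftrightarrow> k < j"
  using kabs_pi power_int_strict_decreasing[of _ _ q] by (metis linorder_neqE_linordered_idom order_less_asym order_less_irrefl)

lemma q_powi_le_iff: "q powi j \<le> q powi k \<longleftrightarrow> k \<le> j"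
  using q_powi_less_iff[of k j] by linarith

lemma q_powi_small:
  assumes "0 < r" obtains n :: nat where "q powi int n < r"
  using real_arch_pow_inv[OF assms kabs_pi(2)] by auto

lemma q_powi_bracket:
  assumes "0 < r" obtains k where "q powi k \<le> r" "r < q powi (k - 1)"
proof -
  obtain n where n: "q powi int n < r" using q_powi_small[OF assms] .
  obtain m where m: "q powi int m < inverse r" using q_powi_small assms by (meson inverse_positive_iff_positive)
  have m': "r < q powi (- int m)"
    using m assms kabs_pi by (simp add: power_int_minus) (metis inverse_inverse_eq inverse_less_iff_less inverse_positive_iff_positive kabs_pi(1) zero_less_power)
  \<comment> \<open>Exponents are searched upwards from \<open>- int m\<close>, where the inequality
    still fails; the least natural index is thus positive and its predecessor gives the strict upper
    bound.\<close>
  let ?P = "\<lambda>i::nat. q powi (int i - int m) \<le> r"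
  have "?P (n + m)" using n by simp
  then have L: "?P (LEAST i. ?P i)" by (rule LeastI)
  have "(LEAST i. ?P i) \<noteq> 0" using L m' by (metis (no_types, lifting) diff_0 linorder_not_le of_nat_0)
  then obtain i where i: "(LEAST i. ?P i) = Suc i" by (metis not0_implies_Suc)
  then have "\<not> ?P i" by (metis lessI not_less_Least)
  then show thesis using that[of "int (Suc i) - int m"] L i by (simp add: algebra_simps)
qed

text \<open>Multiplying x by \<open>\<pi> powi (1 - k)\<close> brings its value below 1, hence by
  discreteness to at most \<open>q\<close>, and the bracket of \<open>kabs x\<close> closes.\<close>

lemma kabs_value_group:
  assumes "(x :: 'k) \<noteq> 0" obtains k where "kabs x = q powi k"
proof -
  obtain k where k: "q powi k \<le> kabs x" "kabs x < q powi (k - 1)"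
    using q_powi_bracket[of "kabs x"] assms by auto
  have "kabs (x * \<pi> powi (1 - k)) < 1"
  proof -
    have "kabs (x * \<pi> powi (1 - k)) < q powi (k - 1) * q powi (1 - k)"
      unfolding kabs_mult kabs_power_int using k(2) by (intro mult_strict_right_mono) auto
    also have "\<dots> = 1" using kabs_pi by (simp flip: power_int_add)
    finally show ?thesis .
  qed
  then have "kabs (x * \<pi> powi (1 - k)) \<le> q" by (rule kabs_less_one)
  then have "kabs x * q powi (1 - k) * q powi (k - 1) \<le> q * q powi (k - 1)"
    unfolding kabs_mult kabs_power_int by (rule mult_right_mono) simp
  moreover have "q powi (1 - k) * q powi (k - 1) = 1" "q * q powi (k - 1) = q powi k"
    using kabs_pi power_int_add[of q "1 - k" "k - 1"] power_int_add[of q 1 "k - 1"] by auto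
  ultimately have "kabs x \<le> q powi k" by (simp only: mult.assoc mult_1_right)
  then show thesis using k(1) by (intro that[of k] order.antisym)
qed

subsection \<open>Balls in powers of the field\<close>

lemma vabs_le_iff: "vabs (z :: 'k ^ 'n::finite) \<le> r \<longleftrightarrow> (\<forall>i. kabs (z $ i) \<le> r)"
  unfolding vabs_def by (subst Max_le_iff) auto

lemma vabs_less_iff: "vabs (z :: 'k ^ 'n::finite) < r \<longleftrightarrow> (\<forall>i. kabs (z $ i) < r)"
  unfolding vabs_def by (subst Max_less_iff) auto

lemma kabs_le_vabs: "kabs (z $ i) \<le> vabs (z :: 'k ^ 'n::finite)"
  using vabs_le_iff[of z "vabs z"] by simp

lemma vabs_nonneg [simp]: "0 \<le> vabs (z :: 'k ^ 'n::finite)"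
  using order_trans[OF kabs_nonneg kabs_le_vabs] .

lemma vabs_eq_0 [simp]: "vabs (z :: 'k ^ 'n::finite) = 0 \<longleftrightarrow> z = 0"
proof
  assume "vabs z = 0"
  then have "kabs (z $ i) \<le> 0" for i using kabs_le_vabs[of z i] by simp
  then have "kabs (z $ i) = 0" for i by (intro antisym) simp_all
  then show "z = 0" by (simp add: vec_eq_iff)
next
  assume "z = 0"
  then have "vabs z \<le> 0" by (simp add: vabs_le_iff)
  then show "vabs z = 0" by (simp add: antisym)
qed

lemma vabs_zero [simp]: "vabs (0 :: 'k ^ 'n::finite) = 0"
  by simp

lemma vabs_minus [simp]: "vabs (- z :: 'k ^ 'n::finite) = vabs z"
  by (simp add: vabs_def)

lemma vabs_diff_commute: "vabs (z - w :: 'k ^ 'n::finite) = vabs (w - z)"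
  using vabs_minus[of "z - w"] by simp

lemma vabs_add: "vabs (z + w :: 'k ^ 'n::finite) \<le> max (vabs z) (vabs w)"
  unfolding vabs_le_iff
proof
  fix i
  have "kabs ((z + w) $ i) \<le> max (kabs (z $ i)) (kabs (w $ i))" using kabs_add by simp
  also have "\<dots> \<le> max (vabs z) (vabs w)" by (intro max.mono kabs_le_vabs)
  finally show "kabs ((z + w) $ i) \<le> max (vabs z) (vabs w)" .
qed

lemma vabs_diff: "vabs (z - w :: 'k ^ 'n::finite) \<le> max (vabs z) (vabs w)"
  using vabs_add[of z "- w"] by simp

lemma vabs_scale: "vabs (a *s z :: 'k ^ 'n::finite) = kabs a * vabs z"
proof (rule antisym)
  show "vabs (a *s z) \<le> kabs a * vabs z"
    unfolding vabs_le_iff by (auto simp: kabs_mult intro!: mult_left_mono kabs_le_vabs)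
  have "Max (range (\<lambda>i. kabs (z $ i))) \<in> range (\<lambda>i. kabs (z $ i))" by (intro Max_in) auto
  then obtain i where "vabs z = kabs (z $ i)" unfolding vabs_def by blast
  then show "kabs a * vabs z \<le> vabs (a *s z)"
    using kabs_le_vabs[of "a *s z" i] by (simp add: kabs_mult)
qed

lemma mem_kball: "z \<in> kball a r \<longleftrightarrow> vabs (z - a :: 'k ^ 'n::finite) \<le> r"
  by (simp add: kball_def)

lemma kball_recenter:
  assumes "b \<in> kball a r" shows "kball (a :: 'k ^ 'n::finite) r = kball b r"
proof -
  have "vabs (z - b) \<le> r \<longleftrightarrow> vabs (z - a) \<le> r" for z
    using assms vabs_add[of "z - a" "a - b"] vabs_add[of "z - b" "b - a"] vabs_diff_commute[of a b]
    by (auto simp: mem_kball)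
  then show ?thesis by (auto simp: mem_kball)
qed

text \<open>Coordinates only take values in the value group, so a radius may be rounded down to a
  power of \<open>q\<close>, the same for all centres.\<close>

lemma kball_level:
  assumes "0 < r" obtains k where "\<And>a :: 'k ^ 'n::finite. kball a r = kball a (q powi k)"
proof -
  obtain k where k: "q powi k \<le> r" "r < q powi (k - 1)" using q_powi_bracket[OF assms] .
  have "kabs x \<le> r \<longleftrightarrow> kabs x \<le> q powi k" for x :: 'k
  proof
    assume r: "kabs x \<le> r"
    show "kabs x \<le> q powi k"
    proof (cases "x = 0")
      case False
      then obtain j where j: "kabs x = q powi j" by (rule kabs_value_group)
      then have "k - 1 < j" using r k(2) q_powi_less_iff[of j "k - 1"] by linarith
      then show ?thesis using j q_powi_le_iff by simp
    qed simp
  qed (use k in simp)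
  then show thesis by (intro that[of k]) (auto simp: mem_kball vabs_le_iff)
qed

lemma kball_subset_iff: "kball (a :: 'k ^ 'n::finite) (q powi j) \<subseteq> kball a (q powi k) \<longleftrightarrow> k \<le> j"
proof
  \<comment> \<open>All coordinates of \<open>w\<close> have value exactly \<open>q powi j\<close>,
    so \<open>a + w\<close> lies in the ball of level j and in none of smaller radius around
    a.\<close>
  define w :: "'k ^ 'n" where "w = (\<chi> i. \<pi> powi j)"
  have w: "vabs w \<le> r \<longleftrightarrow> q powi j \<le> r" for r by (simp add: w_def vabs_le_iff kabs_power_int)
  assume "kball a (q powi j) \<subseteq> kball a (q powi k)"
  moreover have "a + w \<in> kball a (q powi j)" using w by (simp add: mem_kball)
  ultimately have "a + w \<in> kball a (q powi k)" by blast
  then show "k \<le> j" using w by (simp add: mem_kball q_powi_le_iff)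
next
  assume "k \<le> j"
  then show "kball a (q powi j) \<subseteq> kball a (q powi k)"
    using q_powi_le_iff[of j k] by (auto simp: mem_kball)
qed

lemma open_kball:
  assumes "0 < r" shows "open (kball (a :: 'k ^ 'n::finite) r)"
  unfolding open_vec_def
proof
  fix x assume x: "x \<in> kball a r"
  have "y \<in> kball a r" if "\<forall>i. y $ i \<in> ball (x $ i) r" for y
  proof -
    have "vabs (y - x) < r" using that by (simp add: vabs_less_iff dist_kabs kabs_diff_commute)
    then show ?thesis unfolding kball_recenter[OF x] by (simp add: mem_kball)
  qed
  then show "\<exists>A. (\<forall>i. open (A i) \<and> x $ i \<in> A i) \<and> (\<forall>y. (\<forall>i. y $ i \<in> A i) \<longrightarrow> y \<in> kball a r)"
    using assms by (intro exI[of _ "\<lambda>i. ball (x $ i) r"]) auto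
qed

lemma open_contains_kball:
  assumes "open S" "(a :: 'k ^ 'n::finite) \<in> S"
  obtains r where "0 < r" "kball a r \<subseteq> S"
proof -
  obtain A where A: "\<forall>i. open (A i) \<and> a $ i \<in> A i" "\<forall>y. (\<forall>i. y $ i \<in> A i) \<longrightarrow> y \<in> S"
    using bspec[OF iffD1[OF open_vec_def assms(1)] assms(2)] by (elim exE conjE)
  have "\<forall>i. \<exists>e>0. cball (a $ i) e \<subseteq> A i"
    using A(1) by (simp add: open_contains_cball)
  from choice[OF this] obtain e where "\<forall>i. 0 < e i \<and> cball (a $ i) (e i) \<subseteq> A i"
    by (elim exE)
  then have e: "\<And>i. 0 < e i" "\<And>i. cball (a $ i) (e i) \<subseteq> A i" by simp_all
  let ?r = "Min (range e)"
  have "0 < ?r" using e(1) by (subst Min_gr_iff) auto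
  moreover have "kball a ?r \<subseteq> S"
  proof
    fix y assume "y \<in> kball a ?r"
    then have "kabs ((y - a) $ i) \<le> ?r" for i
      unfolding mem_kball vabs_le_iff by blast
    moreover have "?r \<le> e i" for i by (intro Min_le) auto
    ultimately have "kabs (y $ i - a $ i) \<le> e i" for i
      by (metis order_trans vector_minus_component)
    then have "y $ i \<in> cball (a $ i) (e i)" for i by (simp add: dist_kabs kabs_diff_commute)
    then have "\<forall>i. y $ i \<in> A i" using e(2) by blast
    then show "y \<in> S" by (rule A(2)[THEN spec, THEN mp])
  qed
  ultimately show thesis by (rule that)
qed

end

lemma padic_abs_prime:
  assumes "prime p" shows "padic_abs p (of_nat p) = 1 / real p"
proof -
  have "multiplicity (int p) (int p) = 1" using assms by (intro multiplicity_self) auto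
  then show ?thesis
    using assms quotient_of_int[of "int p"] prime_gt_0_nat[OF assms]
    by (simp add: padic_abs_def powr_minus_divide)
qed

text \<open>The image of p has absolute value p^(-s) < 1 and is nonzero in characteristic 0; being a
  multiple of the generator of \<open>max_ideal\<close>, it forces that generator to be
  nonzero.\<close>

lemma padic_valued_field:
  assumes "padic_number_field p TYPE('k::{field_char_0,metric_space})"
  obtains \<pi> :: "'k::{field_char_0,metric_space}" where "valued_field \<pi>"
proof -
  note defn = assms[unfolded padic_number_field_def]
  have p: "prime p" using defn by (elim conjE)
  have "\<forall>x y :: 'k. dist x y = kabs (x - y)" using defn by (elim conjE)
  then have dk: "\<And>x y :: 'k. dist x y = kabs (x - y)" by (elim allE)
  have "\<forall>x y :: 'k. kabs (x * y) = kabs x * kabs y" using defn by (elim conjE)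
  then have m: "\<And>x y :: 'k. kabs (x * y) = kabs x * kabs y" by (elim allE)
  have "\<forall>x y :: 'k. kabs (x + y) \<le> max (kabs x) (kabs y)" using defn by (elim conjE)
  then have ad: "\<And>x y :: 'k. kabs (x + y) \<le> max (kabs x) (kabs y)" by (elim allE)
  have s_ex: "\<exists>s>0. \<forall>r. kabs (of_rat r :: 'k) = padic_abs p r powr s" using defn by (elim conjE)
  have pi_ex: "\<exists>\<pi> :: 'k. max_ideal = (\<lambda>x. \<pi> * x) ` val_ring \<and>
        kabs \<pi> = 1 / real (card (residue_field :: 'k set set))" using defn by (elim conjE)
  obtain s where s: "s > 0" "\<And>r. kabs (of_rat r :: 'k) = padic_abs p r powr s" using s_ex by auto
  obtain \<pi> :: 'k where \<pi>: "max_ideal = (\<lambda>x. \<pi> * x) ` val_ring" "kabs \<pi> = 1 / real (card (residue_field :: 'k set set))"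
    using pi_ex by auto
  have p1: "kabs (of_nat p :: 'k) = (1 / real p) powr s"
    using s(2)[of "of_nat p"] padic_abs_prime[OF p] by simp
  have "kabs (of_nat p :: 'k) < 1"
    unfolding p1 using prime_gt_1_nat[OF p] s(1) by (simp add: powr_divide divide_less_eq)
  then have "(of_nat p :: 'k) \<in> max_ideal" by (simp add: max_ideal_def)
  then obtain x where x: "of_nat p = \<pi> * x" "x \<in> val_ring" unfolding \<pi>(1) by blast
  have "\<pi> \<noteq> 0" using x(1) prime_gt_0_nat[OF p] by auto
  then have pos: "0 < kabs \<pi>" by (simp add: kabs_def)
  \<comment> \<open>An infinite residue field would have \<open>card\<close> 0, and
    \<open>kabs \<pi>\<close> would be 1 / 0 = 0.\<close>
  then have fin: "finite (residue_field :: 'k set set)"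
    unfolding \<pi>(2) by (metis card.infinite div_by_0 of_nat_0 order_less_irrefl)
  have m1: "kabs (1::'k) = 1"
    using m[of 1 1] by (simp add: kabs_def)
  have "1 \<in> (val_ring :: 'k set)" by (simp add: val_ring_def m1)
  then have "\<pi> \<in> max_ideal" unfolding \<pi>(1) by (metis image_eqI mult.right_neutral)
  then have lt: "kabs \<pi> < 1" by (simp add: max_ideal_def)
  have le: "kabs x \<le> kabs \<pi>" if x: "kabs x < 1" for x :: 'k
  proof -
    have "x \<in> max_ideal" using x by (simp add: max_ideal_def)
    then obtain y where "x = \<pi> * y" "kabs y \<le> 1" unfolding \<pi>(1) val_ring_def by blast
    then show ?thesis using pos by (simp add: m mult_left_le)
  qed
  show thesis
    by (rule that[of \<pi>]) (unfold_locales; fact dk m ad pos lt le fin)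
qed

section \<open>Chains of balls\<close>

lemma is_chart_inj: "is_chart c \<Longrightarrow> inj_on (snd c) (fst c)"
  unfolding is_chart_def homeomorphism_def by (metis inj_on_inverseI)

lemma is_chart_open_preimage:
  assumes "is_chart c" "B \<subseteq> fst c" "open (snd c ` B)" shows "open B"
proof -
  have "continuous_on (fst c) (snd c)" "open (fst c)"
    using assms(1) unfolding is_chart_def homeomorphism_def by auto
  then have "open (snd c -` (snd c ` B) \<inter> fst c)"
    using assms(3) by (simp add: continuous_on_open_vimage)
  moreover have "snd c -` (snd c ` B) \<inter> fst c = B"
    using is_chart_inj[OF assms(1)] assms(2) by (auto dest: inj_onD)
  ultimately show ?thesis by simp
qed

context valued_field
begin

text \<open>Records which radii occur among the proper subballs of F around x, measured in the chart
  c. Gaps are possible: \<open>balls_in\<close> demands a common radius in all charts containing the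
  set and excludes faces.\<close>

definition ball_level ::
  "('x::topological_space, 'k, 'n::finite) chart set \<Rightarrow> ('x, 'k, 'n) chart \<Rightarrow> 'x set \<Rightarrow> 'x \<Rightarrow> int \<Rightarrow> bool" where
  "ball_level \<A> c F x k \<longleftrightarrow>
     (\<exists>B\<in>balls_in \<A>. B \<subset> F \<and> x \<in> B \<and> snd c ` B = kball (snd c x) (q powi k))"

text \<open>Every point of a ball is a centre of it, so the set of points with a given level is a
  union of balls.\<close>

lemma open_ball_level:
  fixes \<A> :: "('x::topological_space, 'k, 'n::finite) chart set"
  assumes "is_chart c" "F \<subseteq> fst c"
  shows "open {x. ball_level \<A> c F x k}"
proof -
  have "{x. ball_level \<A> c F x k} =
      \<Union>{B \<in> balls_in \<A>. B \<subset> F \<and> (\<exists>x\<in>B. snd c ` B = kball (snd c x) (q powi k))}"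
  proof (intro equalityI subsetI)
    fix y assume "y \<in> \<Union>{B \<in> balls_in \<A>. B \<subset> F \<and> (\<exists>x\<in>B. snd c ` B = kball (snd c x) (q powi k))}"
    then obtain B x where B: "B \<in> balls_in \<A>" "B \<subset> F" "x \<in> B" "snd c ` B = kball (snd c x) (q powi k)" "y \<in> B"
      by blast
    then have "snd c y \<in> kball (snd c x) (q powi k)" by blast
    then have "snd c ` B = kball (snd c y) (q powi k)"
      using B(4) kball_recenter by metis
    then show "y \<in> {x. ball_level \<A> c F x k}" using B unfolding ball_level_def by blast
  qed (auto simp: ball_level_def)
  moreover have "open B" if "B \<subset> F" "\<exists>x\<in>B. snd c ` B = kball (snd c x) (q powi k)" for B
    using that assms(2) by (intro is_chart_open_preimage[OF assms(1)]) (auto simp: open_kball)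
  ultimately show ?thesis by (simp add: open_Union)
qed

lemma ball_has_level:
  fixes \<A> :: "('x::topological_space, 'k, 'n::finite) chart set"
  assumes "c \<in> \<A>" "B \<in> balls_in \<A>" "B \<subseteq> fst c" "x \<in> B"
  obtains k where "snd c ` B = kball (snd c x) (q powi k)"
proof -
  obtain r a where r: "r > 0" "snd c ` B = kball a r"
    using assms unfolding balls_in_def by blast
  obtain k where k: "\<And>a :: 'k ^ 'n. kball a r = kball a (q powi k)"
    by (rule kball_level[OF r(1), where 'n = 'n]) blast
  have "snd c x \<in> kball a r" using r(2) assms(4) by blast
  then have "kball a r = kball (snd c x) r" by (rule kball_recenter)
  then show thesis using that[of k] r(2) k by simp
qed

lemma level_subset_iff:
  fixes c :: "('x::topological_space, 'k, 'n::finite) chart"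
  assumes "inj_on (snd c) (fst c)" "B \<subseteq> fst c" "C \<subseteq> fst c"
    "snd c ` B = kball (snd c x) (q powi j)" "snd c ` C = kball (snd c x) (q powi k)"
  shows "B \<subseteq> C \<longleftrightarrow> k \<le> j" "B \<subset> C \<longleftrightarrow> k < j"
proof -
  have 1: "B \<subseteq> C \<longleftrightarrow> k \<le> j" 
    using inj_on_image_subset_iff[OF assms(1-3)] assms(4,5) kball_subset_iff[of "snd c x" j k] by simp
  have 2: "C \<subseteq> B \<longleftrightarrow> j \<le> k"
    using inj_on_image_subset_iff[OF assms(1,3,2)] assms(4,5) kball_subset_iff[of "snd c x" k j] by simp
  show "B \<subseteq> C \<longleftrightarrow> k \<le> j" by (rule 1)
  show "B \<subset> C \<longleftrightarrow> k < j" unfolding less_le_not_le 1 2 by linarith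
qed

lemma ball_chain_mem:
  assumes "ball_chain \<A> F x \<gamma>" shows "x \<in> \<gamma> i"
  using assms unfolding ball_chain_def by blast

lemma ball_chain_subset:
  assumes "ball_chain \<A> F x \<gamma>" shows "\<gamma> (Suc i) \<subset> F"
proof (induction i)
  case 0 show ?case using assms unfolding ball_chain_def by metis
next
  case (Suc i)
  have "\<gamma> (Suc (Suc i)) \<subset> \<gamma> (Suc i)" using assms unfolding ball_chain_def by blast
  then show ?case using Suc by blast
qed

text \<open>A chain from F to x runs through all balls of F around x; these are linearly ordered and
  indexed by integers in a chart, so a chain exists if and only if there is a largest ball and
  there are arbitrarily small ones.\<close>

lemma ball_chain_levels:
  fixes \<A> :: "('x::topological_space, 'k, 'n::finite) chart set"
  assumes c: "c \<in> \<A>" "is_chart c" and F: "F \<subseteq> fst c" and chain: "ball_chain \<A> F x \<gamma>"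
  shows "\<exists>k. ball_level \<A> c F x k \<and> (\<forall>j<k. \<not> ball_level \<A> c F x j)"
    and "\<exists>k>m. ball_level \<A> c F x k"
proof -
  have zero: "\<gamma> 0 = F"
    using chain unfolding ball_chain_def by (elim conjE)
  have "\<forall>i. \<gamma> (Suc i) \<in> balls_in \<A> \<and> \<gamma> (Suc i) \<subset> \<gamma> i \<and>
      \<not> (\<exists>B\<in>balls_in \<A>. \<gamma> (Suc i) \<subset> B \<and> B \<subset> \<gamma> i)"
    using chain unfolding ball_chain_def by (elim conjE)
  then have ball: "\<gamma> (Suc i) \<in> balls_in \<A>" and dec: "\<gamma> (Suc i) \<subset> \<gamma> i"
    and max: "\<not> (\<exists>B\<in>balls_in \<A>. \<gamma> (Suc i) \<subset> B \<and> B \<subset> \<gamma> i)" for i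
    by simp_all
  note sub = ball_chain_subset[OF chain] and mem = ball_chain_mem[OF chain]
  have sub': "\<gamma> (Suc i) \<subseteq> fst c" for i using sub[of i] F by blast
  have "\<forall>i. \<exists>k. snd c ` \<gamma> (Suc i) = kball (snd c x) (q powi k)"
    by (intro allI, rule ball_has_level[OF c(1) ball sub' mem]) (rule exI)
  from choice[OF this] obtain \<kappa> where "\<forall>i. snd c ` \<gamma> (Suc i) = kball (snd c x) (q powi \<kappa> i)"
    by (elim exE)
  then have \<kappa>: "\<And>i. snd c ` \<gamma> (Suc i) = kball (snd c x) (q powi \<kappa> i)" by (rule spec)
  have lev: "ball_level \<A> c F x (\<kappa> i)" for i
    unfolding ball_level_def by (intro bexI[of _ "\<gamma> (Suc i)"] conjI ball sub mem \<kappa>)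
  have step: "\<kappa> i < \<kappa> (Suc i)" for i
    using level_subset_iff(2)[OF is_chart_inj[OF c(2)] sub' sub' \<kappa> \<kappa>, of "Suc i" i] dec[of "Suc i"] by simp
  \<comment> \<open>A ball of smaller exponent would lie strictly between F and the first ball of
    the chain.\<close>
  have "\<not> ball_level \<A> c F x j" if "j < \<kappa> 0" for j
  proof
    assume "ball_level \<A> c F x j"
    then obtain B where B: "B \<in> balls_in \<A>" "B \<subset> F" "snd c ` B = kball (snd c x) (q powi j)"
      unfolding ball_level_def by blast
    have "B \<subseteq> fst c" using B(2) F by blast
    then have "\<gamma> (Suc 0) \<subset> B"
      using level_subset_iff(2)[OF is_chart_inj[OF c(2)] sub' _ \<kappa> B(3), of 0] that by simp
    then show False using max[of 0] B(1,2) zero by auto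
  qed
  then show "\<exists>k. ball_level \<A> c F x k \<and> (\<forall>j<k. \<not> ball_level \<A> c F x j)" using lev by blast
  have "\<kappa> 0 + int i \<le> \<kappa> i" for i
  proof (induction i)
    case (Suc i) then show ?case using step[of i] by simp
  qed simp
  from this[of "nat (m - \<kappa> 0 + 1)"] have "m < \<kappa> (nat (m - \<kappa> 0 + 1))" by linarith
  then show "\<exists>k>m. ball_level \<A> c F x k" using lev by blast
qed

lemma levels_ball_chain:
  fixes \<A> :: "('x::topological_space, 'k, 'n::finite) chart set"
  assumes c: "c \<in> \<A>" "is_chart c" and F: "F \<in> faces \<A>" "F \<subseteq> fst c"
    and k0: "ball_level \<A> c F x k0" "\<And>j. j < k0 \<Longrightarrow> \<not> ball_level \<A> c F x j"
    and unb: "\<And>m. \<exists>k>m. ball_level \<A> c F x k"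
  shows "\<exists>\<gamma>. ball_chain \<A> F x \<gamma>"
proof -
  \<comment> \<open>Counting from the lowest level \<open>k0\<close> makes the levels natural
    numbers, so that \<open>enumerate\<close> lists the balls by decreasing radius.\<close>
  define N where "N = {n. ball_level \<A> c F x (k0 + int n)}"
  have inf: "infinite N"
    unfolding infinite_nat_iff_unbounded
  proof
    fix m
    obtain k where k: "k > k0 + int m" "ball_level \<A> c F x k" using unb by blast
    then have "nat (k - k0) > m" "nat (k - k0) \<in> N" by (auto simp: N_def)
    then show "\<exists>n>m. n \<in> N" by blast
  qed
  define e where "e = enumerate N"
  have e_mem: "e i \<in> N" for i unfolding e_def by (rule enumerate_in_set[OF inf])
  have "\<forall>i. \<exists>B. B \<in> balls_in \<A> \<and> B \<subset> F \<and> x \<in> B \<and> snd c ` B = kball (snd c x) (q powi (k0 + int (e i)))"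
    using e_mem unfolding N_def ball_level_def by (simp add: Bex_def)
  from choice[OF this] obtain C where "\<forall>i. C i \<in> balls_in \<A> \<and> C i \<subset> F \<and> x \<in> C i
      \<and> snd c ` C i = kball (snd c x) (q powi (k0 + int (e i)))" by (elim exE)
  then have C: "\<And>i. C i \<in> balls_in \<A>" "\<And>i. C i \<subset> F" "\<And>i. x \<in> C i"
    "\<And>i. snd c ` C i = kball (snd c x) (q powi (k0 + int (e i)))" by simp_all
  have C': "C i \<subseteq> fst c" for i using C(2)[of i] F by blast
  note iff = level_subset_iff(2)[OF is_chart_inj[OF c(2)]]
  define \<gamma> where "\<gamma> = case_nat F C"
  \<comment> \<open>The level of a ball in between would itself belong to \<open>N\<close> and lie
    strictly between two consecutive enumerated levels, or below the first one.\<close>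
  have no_between: "\<not> (\<exists>B\<in>balls_in \<A>. \<gamma> (Suc i) \<subset> B \<and> B \<subset> \<gamma> i)" for i
  proof
    assume "\<exists>B\<in>balls_in \<A>. \<gamma> (Suc i) \<subset> B \<and> B \<subset> \<gamma> i"
    then obtain B where B: "B \<in> balls_in \<A>" "C i \<subset> B" "B \<subset> \<gamma> i" by (auto simp: \<gamma>_def)
    have BF: "B \<subset> F" using B(3) C(2) by (cases i) (auto simp: \<gamma>_def)
    then have B': "B \<subseteq> fst c" "x \<in> B" using F C(3) B(2) by blast+
    obtain j where j: "snd c ` B = kball (snd c x) (q powi j)"
      using ball_has_level[OF c(1) B(1) B'] .
    have lev: "ball_level \<A> c F x j" unfolding ball_level_def using B(1) BF B'(2) j by blast
    then have "k0 \<le> j" using k0(2) by force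
    have less: "j < k0 + int (e i)" using iff[OF C' B'(1) C(4) j, of i] B(2) by simp
    have mem: "nat (j - k0) \<in> N" using lev \<open>k0 \<le> j\<close> by (simp add: N_def)
    show False
    proof (cases i)
      case 0
      have "0 \<in> N" using k0(1) by (simp add: N_def)
      then have "e i = 0" using 0 by (simp add: e_def enumerate_0 Least_equality)
      then show False using less \<open>k0 \<le> j\<close> by simp
    next
      case (Suc i')
      have "k0 + int (e i') < j" using iff[OF B'(1) C' j C(4), of i'] B(3) Suc by (simp add: \<gamma>_def)
      then have "e i' < nat (j - k0)" by simp
      then have "e (Suc i') \<le> nat (j - k0)"
        unfolding e_def enumerate_Suc''[OF inf] using mem by (intro Least_le) simp
      then show False using less Suc \<open>k0 \<le> j\<close> by simp
    qed
  qed
  have dec: "\<gamma> (Suc i) \<subset> \<gamma> i" for i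
  proof (cases i)
    case (Suc i')
    have "e i' < e (Suc i')" unfolding e_def by (rule enumerate_step[OF inf])
    then show ?thesis using iff[OF C' C' C(4) C(4), of "Suc i'" i'] Suc by (simp add: \<gamma>_def)
  qed (use C(2) in \<open>simp add: \<gamma>_def\<close>)
  have "(\<Inter>i. \<gamma> i) = {x}"
  proof (intro equalityI subsetI)
    fix y assume y: "y \<in> (\<Inter>i. \<gamma> i)"
    have yC: "y \<in> C i" for i
    proof -
      have "y \<in> \<gamma> (Suc i)" using y by (rule INT_D) (rule UNIV_I)
      then show ?thesis unfolding \<gamma>_def nat.case .
    qed
    have "vabs (snd c y - snd c x) \<le> 0"
    proof (rule ccontr)
      assume "\<not> ?thesis"
      then have "0 < vabs (snd c y - snd c x)" by simp
      then obtain n where n: "q powi int n < vabs (snd c y - snd c x)" by (rule q_powi_small)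
      \<comment> \<open>The i-th enumerated level is at least \<open>k0 + int i\<close>, so at this
        index the radius is at most \<open>q powi int n\<close>, less than the distance between the
        two images.\<close>
      define i where "i = nat (int n - k0)"
      have "i \<le> e i" unfolding e_def by (rule le_enumerate[OF inf])
      then have "int n \<le> k0 + int (e i)" by (simp add: i_def)
      moreover have "vabs (snd c y - snd c x) \<le> q powi (k0 + int (e i))"
        using C(4)[of i] yC[of i] by (simp add: mem_kball[symmetric]) blast
      ultimately show False using n q_powi_le_iff[of "k0 + int (e i)" "int n"] by linarith
    qed
    then have "vabs (snd c y - snd c x) = 0" by (intro order.antisym) simp_all
    then have "snd c y = snd c x" by simp
    then have "y = x" using inj_onD[OF is_chart_inj[OF c(2)]] yC C(3) C' by blast
    then show "y \<in> {x}" by simp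
  next
    fix y assume "y \<in> {x}"
    moreover have "x \<in> \<gamma> i" for i using C(2,3) by (cases i) (auto simp: \<gamma>_def)
    ultimately show "y \<in> (\<Inter>i. \<gamma> i)" by blast
  qed
  then have "ball_chain \<A> F x \<gamma>"
    unfolding ball_chain_def using F(1) dec no_between C(1) by (simp add: \<gamma>_def)
  then show ?thesis by blast
qed

text \<open>Existence of a chain is a condition on the levels with quantifiers over integers only,
  and each level set is open, so countable operations suffice.\<close>

lemma ball_chain_borel:
  fixes \<A> :: "('x::topological_space, 'k, 'n::finite) chart set"
  assumes c: "c \<in> \<A>" "is_chart c" and F: "F \<subseteq> fst c"
  shows "{x. \<exists>\<gamma>. ball_chain \<A> F x \<gamma>} \<in> sets borel"
proof (cases "F \<in> faces \<A>")
  case True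
  let ?P = "\<lambda>x. (\<exists>k. ball_level \<A> c F x k \<and> (\<forall>j. j < k \<longrightarrow> \<not> ball_level \<A> c F x j))
      \<and> (\<forall>m. \<exists>k. m < k \<and> ball_level \<A> c F x k)"
  have "(\<exists>\<gamma>. ball_chain \<A> F x \<gamma>) = ?P x" for x
  proof
    assume "\<exists>\<gamma>. ball_chain \<A> F x \<gamma>"
    then obtain \<gamma> where "ball_chain \<A> F x \<gamma>" ..
    then show "?P x" using ball_chain_levels[OF c F] by auto
  next
    assume P: "?P x"
    then obtain k where "ball_level \<A> c F x k" "\<forall>j. j < k \<longrightarrow> \<not> ball_level \<A> c F x j" by auto
    then show "\<exists>\<gamma>. ball_chain \<A> F x \<gamma>" using P by (intro levels_ball_chain[OF c True F]) auto
  qed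
  moreover have "Measurable.pred borel (\<lambda>x. ball_level \<A> c F x k)" for k
    using open_ball_level[OF c(2) F, of \<A> k] by (simp add: pred_def)
  note this [measurable]
  have "{x \<in> space borel. ?P x} \<in> sets borel"
    by measurable
  ultimately show ?thesis by simp
next
  case False
  then have "{x. \<exists>\<gamma>. ball_chain \<A> F x \<gamma>} = {}" by (auto simp: ball_chain_def)
  then show ?thesis by simp
qed

end

section \<open>The path distance takes finitely many values\<close>

lemma finite_faces:
  assumes "finite \<A>" shows "finite (faces \<A>)"
proof -
  have "nerve (fst ` \<A>) \<subseteq> Pow (fst ` \<A>)" by (auto simp: nerve_def)
  then have "finite (nerve (fst ` \<A>))" using assms by (simp add: finite_subset)
  then show ?thesis by (simp add: faces_def)
qed

lemma face_subset_chart: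
  assumes "F \<in> faces \<A>" obtains c where "c \<in> \<A>" "F \<subseteq> fst c"
proof -
  obtain \<sigma> where "F = \<Inter>\<sigma>" "\<sigma> \<subseteq> fst ` \<A>" "\<sigma> \<noteq> {}"
    using assms unfolding faces_def nerve_def by auto
  then obtain U where "U \<in> \<sigma>" "U \<in> fst ` \<A>" "F \<subseteq> U" by blast
  then show thesis using that by auto
qed

definition chain_faces :: "('x, 'k::{field,metric_space}, 'n::finite) chart set \<Rightarrow> 'x \<Rightarrow> 'x set set" where
  "chain_faces \<A> x = {F. \<exists>\<gamma>. ball_chain \<A> F x \<gamma>}"

definition link_costs ::
  "('x, 'k::{field,metric_space}, 'n::finite) chart set \<Rightarrow> 'x measure \<Rightarrow> 'x set set \<Rightarrow> 'x set set \<Rightarrow> ennreal set" where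
  "link_costs \<A> \<mu> S T = {\<Sum>s\<leftarrow>l. emeasure \<mu> s | F G l. F \<in> S \<and> G \<in> T \<and> link \<A> F G l}"

lemma chain_faces_subset: "chain_faces \<A> x \<subseteq> faces \<A>"
  by (auto simp: chain_faces_def ball_chain_def)

lemma link_rev: "link \<A> F G l \<Longrightarrow> link \<A> G F (rev l)"
  unfolding link_def successively_rev by (auto simp: hd_rev last_rev successively_mono disj_commute)

lemma link_costs_sym: "link_costs \<A> \<mu> S T = link_costs \<A> \<mu> T S"
proof -
  have "link_costs \<A> \<mu> S T \<subseteq> link_costs \<A> \<mu> T S" for S T
  proof
    fix z assume "z \<in> link_costs \<A> \<mu> S T"
    then obtain F G l where "z = (\<Sum>s\<leftarrow>l. emeasure \<mu> s)" "F \<in> S" "G \<in> T" "link \<A> F G l"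
      unfolding link_costs_def by blast
    then have "z = (\<Sum>s\<leftarrow>rev l. emeasure \<mu> s)" "F \<in> S" "G \<in> T" "link \<A> G F (rev l)"
      by (auto simp: link_rev rev_map[symmetric] sum_list_rev)
    then show "z \<in> link_costs \<A> \<mu> T S" unfolding link_costs_def by blast
  qed
  then show ?thesis by blast
qed

text \<open>A point y of \<open>\<gamma> i\<close> other than x is itself an element of the poset.
  The singleton of y is properly contained in \<open>\<gamma> i\<close> because that set has the
  nonempty proper subset \<open>\<gamma> (Suc i)\<close>; hence y is removed.\<close>

lemma punctured_chain_subset:
  assumes "ball_chain \<A> F z \<gamma>" shows "punctured \<A> (\<gamma> i) x \<subseteq> {x}"
proof
  fix y assume y: "y \<in> punctured \<A> (\<gamma> i) x"
  show "y \<in> {x}"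
  proof (rule ccontr)
    assume ne: "y \<notin> {x}"
    have "z \<in> \<gamma> (Suc i)" "\<gamma> (Suc i) \<subset> \<gamma> i"
      using assms unfolding ball_chain_def by blast+
    then have "\<gamma> i \<noteq> {y}" by (metis psubsetE subset_singletonD empty_iff)
    then have "{y} \<subset> \<gamma> i"
      using y unfolding punctured_def by blast
    moreover have "{y} \<in> face_ball_poset \<A>" unfolding face_ball_poset_def by blast
    ultimately have "y \<notin> punctured \<A> (\<gamma> i) x"
      using ne unfolding punctured_def by auto
    then show False using y by blast
  qed
qed

lemma path_lengths_eq:
  assumes null: "\<And>x. emeasure \<mu> {x} = 0" and sets: "\<And>x. {x} \<in> sets \<mu>"
  shows "path_lengths \<A> \<mu> x y = link_costs \<A> \<mu> (chain_faces \<A> x) (chain_faces \<A> y)"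
proof -
  \<comment> \<open>The endpoint \<open>z\<close> is left free, since the chain ending at y is
    punctured at x too.\<close>
  have zero: "(\<Sum>i. emeasure \<mu> (punctured \<A> (\<gamma> i) x)) = 0" if "ball_chain \<A> F z \<gamma>" for F z \<gamma>
  proof -
    have "emeasure \<mu> (punctured \<A> (\<gamma> i) x) = 0" for i
      using emeasure_mono[OF punctured_chain_subset[OF that] sets, of i x] null[of x] by simp
    then show ?thesis by simp
  qed
  show ?thesis
  proof (intro equalityI subsetI)
    fix z assume "z \<in> path_lengths \<A> \<mu> x y"
    then obtain F G \<gamma> \<delta> l where *: "z = (\<Sum>i. emeasure \<mu> (punctured \<A> (\<gamma> i) x)) + (\<Sum>i. emeasure \<mu> (punctured \<A> (\<delta> i) x))
        + (\<Sum>s\<leftarrow>l. emeasure \<mu> s)" "ball_chain \<A> F x \<gamma>" "ball_chain \<A> G y \<delta>" "link \<A> F G l"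
      unfolding path_lengths_def by blast
    then have "z = (\<Sum>s\<leftarrow>l. emeasure \<mu> s)" using zero by simp
    then show "z \<in> link_costs \<A> \<mu> (chain_faces \<A> x) (chain_faces \<A> y)"
      unfolding link_costs_def chain_faces_def using *(2-4) by blast
  next
    fix z assume "z \<in> link_costs \<A> \<mu> (chain_faces \<A> x) (chain_faces \<A> y)"
    then obtain F G \<gamma> \<delta> l where *: "z = (\<Sum>s\<leftarrow>l. emeasure \<mu> s)" "ball_chain \<A> F x \<gamma>" "ball_chain \<A> G y \<delta>" "link \<A> F G l"
      unfolding link_costs_def chain_faces_def by blast
    then have "z = (\<Sum>i. emeasure \<mu> (punctured \<A> (\<gamma> i) x)) + (\<Sum>i. emeasure \<mu> (punctured \<A> (\<delta> i) x))
        + (\<Sum>s\<leftarrow>l. emeasure \<mu> s)" using zero by simp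
    then show "z \<in> path_lengths \<A> \<mu> x y"
      unfolding path_lengths_def using *(2-4) by blast
  qed
qed

text \<open>A kernel that factors through a finite set is a finite combination of indicators of
  measurable rectangles.\<close>

lemma finite_valued_kernel_measurable:
  fixes g :: "'s \<Rightarrow> 's \<Rightarrow> real"
  assumes "finite P" and S: "\<And>x. S x \<in> P" "\<And>s. {x. S x = s} \<in> sets \<mu>" and space: "space \<mu> = UNIV"
  shows "(\<lambda>(x, y). g (S x) (S y)) \<in> borel_measurable (\<mu> \<Otimes>\<^sub>M \<mu>)"
proof -
  have ind: "g (S x) (S y) = (\<Sum>s\<in>P. \<Sum>t\<in>P. g s t * (indicator {x. S x = s} x * indicator {y. S y = t} y))" for x y
  proof -
    have "(\<Sum>t\<in>P. g s t * (indicator {x. S x = s} x * indicator {y. S y = t} y)) =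
        (if S x = s then g s (S y) else 0)" for s
      using assms(1) S(1)[of y] by (auto simp: indicator_def if_distrib[of "\<lambda>b. _ * b"] sum.delta cong: if_cong)
    then show ?thesis using assms(1) S(1)[of x] by (simp add: sum.delta)
  qed
  note S(2) [measurable]
  have "(\<lambda>p. \<Sum>s\<in>P. \<Sum>t\<in>P. g s t * (indicator {x. S x = s} (fst p) * indicator {y. S y = t} (snd p)))
      \<in> borel_measurable (\<mu> \<Otimes>\<^sub>M \<mu>)"
    by measurable
  then show ?thesis by (simp only: ind case_prod_unfold)
qed

lemma VT_bounded_kernel:
  fixes \<A> :: "('x::t1_space, 'k::{field,metric_space}, 'n::finite) chart set"
  assumes "finite \<A>" and sets: "sets \<mu> = sets borel" and fin: "finite_measure \<mu>"
    and null: "\<And>x. emeasure \<mu> {x} = 0"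
    and borel: "\<And>F. F \<in> faces \<A> \<Longrightarrow> {x. \<exists>\<gamma>. ball_chain \<A> F x \<gamma>} \<in> sets borel"
  obtains k M where "bounded_kernel \<mu> k M"
    and "\<And>f x y. VT_integrand \<A> \<mu> \<alpha> f x y = k x y * (f x - f y)"
proof -
  \<comment> \<open>\<open>g\<close> is a real function on all pairs: if no link exists the infimum
    is infinite, \<open>enn2real\<close> turns it into 0, and 0 to any power under
    \<open>powr\<close> is 0.\<close>
  define g where "g = (\<lambda>S T. enn2real (Inf (link_costs \<A> \<mu> S T)) powr (- (real CARD('n) * \<alpha>)))"
  define P where "P = Pow (faces \<A>)"
  have P: "finite P" "chain_faces \<A> x \<in> P" for x
    unfolding P_def using finite_faces[OF assms(1)] chain_faces_subset[of \<A> x] by auto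
  have space: "space \<mu> = UNIV" using sets_eq_imp_space_eq[OF sets] by simp
  have level: "{x. chain_faces \<A> x = S} \<in> sets \<mu>" for S
  proof (cases "S \<subseteq> faces \<A>")
    case True
    have "{x. chain_faces \<A> x = S} =
        {x \<in> space \<mu>. \<forall>F\<in>faces \<A>. x \<in> {x. \<exists>\<gamma>. ball_chain \<A> F x \<gamma>} \<longleftrightarrow> F \<in> S}"
    proof -
      have "chain_faces \<A> x = S \<longleftrightarrow> (\<forall>F\<in>faces \<A>. F \<in> chain_faces \<A> x \<longleftrightarrow> F \<in> S)" for x
        using chain_faces_subset[of \<A> x] True by blast
      then show ?thesis unfolding space by (simp add: chain_faces_def)
    qed
    also have "\<dots> \<in> sets \<mu>"
    proof (rule sets.sets_Collect_finite_All[OF _ finite_faces[OF assms(1)]])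
      fix F assume "F \<in> faces \<A>"
      then have E: "{x. \<exists>\<gamma>. ball_chain \<A> F x \<gamma>} \<in> sets \<mu>" using borel sets by simp
      show "{x \<in> space \<mu>. x \<in> {x. \<exists>\<gamma>. ball_chain \<A> F x \<gamma>} \<longleftrightarrow> F \<in> S} \<in> sets \<mu>"
      proof (cases "F \<in> S")
        case True
        then show ?thesis using E unfolding space by simp
      next
        case False
        then show ?thesis using sets.compl_sets[OF E] unfolding space by (simp add: set_diff_eq)
      qed
    qed
    finally show ?thesis .
  next
    case False
    then have "{x. chain_faces \<A> x = S} = {}" using chain_faces_subset[of \<A>] by blast
    then show ?thesis by (metis sets.empty_sets)
  qed
  show thesis
  \<comment> \<open>The finitely many values of \<open>g\<close> are nonnegative, so their sum
    bounds each of them.\<close>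
  proof (rule that[of "\<lambda>x y. g (chain_faces \<A> x) (chain_faces \<A> y)" "\<Sum>S\<in>P. \<Sum>T\<in>P. g S T"])
    interpret finite_measure \<mu> by (rule fin)
    have g0: "0 \<le> g S T" for S T by (simp add: g_def)
    show "bounded_kernel \<mu> (\<lambda>x y. g (chain_faces \<A> x) (chain_faces \<A> y)) (\<Sum>S\<in>P. \<Sum>T\<in>P. g S T)"
    proof
      show "space \<mu> = UNIV" by (rule space)
      show "(\<lambda>(x, y). g (chain_faces \<A> x) (chain_faces \<A> y)) \<in> borel_measurable (\<mu> \<Otimes>\<^sub>M \<mu>)"
        by (rule finite_valued_kernel_measurable[OF P level space])
      fix x y
      show "0 \<le> g (chain_faces \<A> x) (chain_faces \<A> y)" by (rule g0)
      have "g (chain_faces \<A> x) (chain_faces \<A> y) \<le> (\<Sum>T\<in>P. g (chain_faces \<A> x) T)"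
        by (rule member_le_sum) (use P g0 in auto)
      also have "\<dots> \<le> (\<Sum>S\<in>P. \<Sum>T\<in>P. g S T)"
        by (rule member_le_sum[of _ P "\<lambda>S. \<Sum>T\<in>P. g S T"]) (use P g0 in \<open>auto intro: sum_nonneg\<close>)
      finally show "g (chain_faces \<A> x) (chain_faces \<A> y) \<le> (\<Sum>S\<in>P. \<Sum>T\<in>P. g S T)" .
      show "g (chain_faces \<A> x) (chain_faces \<A> y) = g (chain_faces \<A> y) (chain_faces \<A> x)"
        unfolding g_def by (subst link_costs_sym) simp
    qed
    show "VT_integrand \<A> \<mu> \<alpha> f x y = g (chain_faces \<A> x) (chain_faces \<A> y) * (f x - f y)" for f x y
    \<comment> \<open>On the diagonal \<open>path_dist\<close> is 0 by definition whereas
      \<open>g\<close> may give a positive value; the factor \<open>f x - f y\<close> removes the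
      discrepancy.\<close>
    proof (cases "x = y")
      case False
      have "{x} \<in> sets \<mu>" for x unfolding sets by simp
      then show ?thesis
        using False by (simp add: VT_integrand_def path_dist_def path_lengths_eq[OF null] g_def)
    qed (simp add: VT_integrand_def)
  qed
qed

lemma VT_semigroup:
  assumes "bounded_kernel \<mu> k M"
    and k: "\<And>f x y. VT_integrand \<A> \<mu> \<alpha> f x y = k x y * (f x - f y)"
    and pos: "emeasure \<mu> UNIV \<noteq> 0"
  shows "\<exists>T. C0_semigroup \<mu> (VT_sobolev \<A> \<mu> \<alpha>) (VT_norm \<A> \<mu> \<alpha>) T \<and>
             has_generator \<mu> (VT_sobolev \<A> \<mu> \<alpha>) (VT_norm \<A> \<mu> \<alpha>) T
               (\<lambda>f x. - VT_operator \<A> \<mu> \<alpha> f x) \<and>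
             markov_property \<mu> (VT_sobolev \<A> \<mu> \<alpha>) T"
proof -
  interpret bounded_kernel \<mu> k M by fact
  have op: "VT_operator \<A> \<mu> \<alpha> = lap"
    unfolding VT_operator_def lap_def k by (rule refl)
  have norm: "VT_norm \<A> \<mu> \<alpha> = graph_norm"
    unfolding VT_norm_def graph_norm_def op by (rule refl)
  \<comment> \<open>For a bounded kernel the integrability and image conditions hold automatically,
    and the Sobolev space is all of L2 as a set.\<close>
  have sob: "VT_sobolev \<A> \<mu> \<alpha> = L2_space \<mu>"
    unfolding VT_sobolev_def op k using lap_L2 lap_integrand_integrable L2_integrable by auto
  show ?thesis
    unfolding norm sob op using heat_C0_semigroup heat_has_generator heat_markov[OF pos] by blast
qed

section \<open>Derivatives of analytic maps\<close>

context valued_field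
begin

text \<open>The ultrametric inequality bounds the remainder by the largest term, not by the sum. If
  the remainder exceeded B, it would be the sum of a smaller error and of finitely many terms of
  size at most B.\<close>

lemma has_sum_tail_bound:
  assumes sum: "(u has_sum s) UNIV" and X: "finite X" and le: "\<And>\<nu>. \<nu> \<notin> X \<Longrightarrow> kabs (u \<nu> :: 'k) \<le> B" and B: "0 \<le> B"
  shows "kabs (s - sum u X) \<le> B"
proof (rule ccontr)
  assume gt: "\<not> ?thesis"
  define e where "e = kabs (s - sum u X)"
  have "0 < e" using gt B unfolding e_def by linarith
  then have "eventually (\<lambda>Y. dist (sum u Y) s < e) (finite_subsets_at_top UNIV)"
    using sum unfolding has_sum_def by (rule tendstoD[rotated])
  then obtain Y where Y: "finite Y" "\<And>Z. finite Z \<Longrightarrow> Y \<subseteq> Z \<Longrightarrow> dist (sum u Z) s < e"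
    unfolding eventually_finite_subsets_at_top by auto
  have "dist (sum u (X \<union> Y)) s < e" using Y X by simp
  then have 1: "kabs (s - sum u (X \<union> Y)) < e" by (simp add: dist_kabs kabs_diff_commute)
  have 2: "kabs (sum u (Y - X)) \<le> B" using le B by (intro kabs_sum_le) auto
  have "sum u (X \<union> Y) = sum u X + sum u (Y - X)"
    using sum.union_disjoint[of X "Y - X" u] X Y(1) by auto
  then have "s - sum u X = (s - sum u (X \<union> Y)) + sum u (Y - X)" by simp
  then have "e \<le> max (kabs (s - sum u (X \<union> Y))) (kabs (sum u (Y - X)))"
    unfolding e_def using kabs_add by metis
  then show False using 1 2 gt by (simp add: e_def max_def split: if_splits)
qed

text \<open>A term outside a large finite set is the difference of two partial sums that are both
  within 1 of the limit.\<close>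

lemma has_sum_terms_bounded:
  assumes sum: "(u has_sum (s :: 'k)) UNIV"
  obtains C where "0 \<le> C" "\<And>\<nu>. kabs (u \<nu>) \<le> C"
proof -
  have "eventually (\<lambda>Y. dist (sum u Y) s < 1) (finite_subsets_at_top UNIV)"
    using sum unfolding has_sum_def by (rule tendstoD) simp
  then obtain Y where Y: "finite Y" "\<And>Z. finite Z \<Longrightarrow> Y \<subseteq> Z \<Longrightarrow> dist (sum u Z) s < 1"
    unfolding eventually_finite_subsets_at_top by auto
  let ?C = "1 + (\<Sum>\<nu>\<in>Y. kabs (u \<nu>))"
  have nn: "0 \<le> (\<Sum>\<nu>\<in>Y. kabs (u \<nu>))" by (simp add: sum_nonneg)
  have "kabs (u \<nu>) \<le> ?C" for \<nu>
  proof (cases "\<nu> \<in> Y")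
    case True
    then have "kabs (u \<nu>) \<le> (\<Sum>\<nu>\<in>Y. kabs (u \<nu>))" using Y(1) by (intro member_le_sum) auto
    then show ?thesis by simp
  next
    case False
    have 1: "kabs (sum u (insert \<nu> Y) - s) < 1" "kabs (sum u Y - s) < 1"
      using Y(2)[of "insert \<nu> Y"] Y(2)[of Y] Y(1) by (auto simp: dist_kabs)
    have "u \<nu> = (sum u (insert \<nu> Y) - s) - (sum u Y - s)" using False Y(1) by simp
    then have "kabs (u \<nu>) \<le> max (kabs (sum u (insert \<nu> Y) - s)) (kabs (sum u Y - s))"
      using kabs_diff by metis
    then show ?thesis using 1 nn by (simp add: max_def split: if_splits)
  qed
  then show thesis using that[of ?C] nn by simp
qed

lemma matrix_vabs_bound:
  fixes M :: "'k ^ 'n::finite ^ 'm::finite"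
  obtains C where "0 < C" "\<And>h. vabs (M *v h) \<le> C * vabs h"
proof -
  let ?C = "1 + (\<Sum>i\<in>UNIV. \<Sum>j\<in>UNIV. kabs (M $ i $ j))"
  have nn: "0 \<le> (\<Sum>i\<in>UNIV. \<Sum>j\<in>UNIV. kabs (M $ i $ j))" by (intro sum_nonneg) auto
  have entry: "kabs (M $ i $ j) \<le> ?C" for i j
  proof -
    have "kabs (M $ i $ j) \<le> (\<Sum>j\<in>UNIV. kabs (M $ i $ j))" by (intro member_le_sum) auto
    also have "\<dots> \<le> (\<Sum>i\<in>UNIV. \<Sum>j\<in>UNIV. kabs (M $ i $ j))"
      by (intro member_le_sum[of i UNIV "\<lambda>i. \<Sum>j\<in>UNIV. kabs (M $ i $ j)"]) (auto intro: sum_nonneg)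
    finally show ?thesis by simp
  qed
  have "vabs (M *v h) \<le> ?C * vabs h" for h
    unfolding vabs_le_iff matrix_vector_mult_def
    using entry nn by (auto simp: kabs_mult intro!: kabs_sum_le mult_mono kabs_le_vabs)
  then show thesis using that[of ?C] nn by simp
qed

lemma small_multiple:
  assumes "0 < \<delta>" obtains t :: 'k where "t \<noteq> 0" "kabs t * vabs (h :: 'k ^ 'n::finite) < \<delta>"
proof -
  have "0 < \<delta> / (vabs h + 1)" using assms vabs_nonneg[of h] by (simp add: add_nonneg_pos)
  then obtain n where n: "q powi int n < \<delta> / (vabs h + 1)" by (rule q_powi_small)
  have v: "0 < vabs h + 1" using vabs_nonneg[of h] by linarith
  have "q powi int n * vabs h \<le> q powi int n * (vabs h + 1)"
    using q_powi_pos[of "int n"] by (intro mult_left_mono) auto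
  also have "\<dots> < \<delta>" using n v by (simp add: field_simps)
  finally show thesis using that[of "\<pi> ^ n"] pi_nonzero by (simp add: kabs_power)
qed

text \<open>This makes the description in \<open>kderiv\<close> meaningful. The vector h is scaled
  into the region where both estimates hold, and the scalar cancels by homogeneity.\<close>

lemma has_kderiv_unique:
  fixes f :: "'k ^ 'n::finite \<Rightarrow> 'k ^ 'm::finite"
  assumes "has_kderiv f M a" "has_kderiv f N a" shows "M = N"
proof -
  have "M *v h = N *v h" for h
  proof -
    have le: "vabs (M *v h - N *v h) \<le> e * vabs h" if e: "0 < e" for e
    proof -
      obtain d1 where d1: "d1 > 0" "\<And>h. vabs h < d1 \<Longrightarrow> vabs (f (a + h) - f a - M *v h) \<le> e * vabs h"
        using assms(1) e unfolding has_kderiv_def by auto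
      obtain d2 where d2: "d2 > 0" "\<And>h. vabs h < d2 \<Longrightarrow> vabs (f (a + h) - f a - N *v h) \<le> e * vabs h"
        using assms(2) e unfolding has_kderiv_def by auto
      have "0 < min d1 d2" using d1(1) d2(1) by simp
      then obtain t :: 'k where t: "t \<noteq> 0" "kabs t * vabs h < min d1 d2" by (rule small_multiple)
      let ?h = "t *s h"
      have h: "vabs ?h < d1" "vabs ?h < d2" using t(2) by (simp_all add: vabs_scale)
      have "t *s (M *v h - N *v h) = (f (a + ?h) - f a - N *v ?h) - (f (a + ?h) - f a - M *v ?h)"
        by (simp add: vector_scalar_commute vec_eq_iff algebra_simps)
      then have "kabs t * vabs (M *v h - N *v h) \<le>
          max (vabs (f (a + ?h) - f a - N *v ?h)) (vabs (f (a + ?h) - f a - M *v ?h))"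
        using vabs_diff vabs_scale by metis
      also have "\<dots> \<le> e * vabs ?h" using d1(2)[OF h(1)] d2(2)[OF h(2)] by simp
      finally have "kabs t * vabs (M *v h - N *v h) \<le> kabs t * (e * vabs h)"
        by (simp add: vabs_scale mult_ac)
      then show ?thesis using t(1) by simp
    qed
    have "vabs (M *v h - N *v h) \<le> 0"
    proof (rule field_le_epsilon)
      fix e :: real assume e: "0 < e"
      have v: "0 < vabs h + 1" using vabs_nonneg[of h] by linarith
      have "vabs (M *v h - N *v h) \<le> e / (vabs h + 1) * vabs h" using e v by (intro le) simp
      also have "\<dots> \<le> e / (vabs h + 1) * (vabs h + 1)" using e v by (intro mult_left_mono) auto
      also have "\<dots> = e" using v by simp
      finally show "vabs (M *v h - N *v h) \<le> 0 + e" by simp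
    qed
    then have "vabs (M *v h - N *v h) = 0" by (intro order.antisym) simp_all
    then show ?thesis by simp
  qed
  then show ?thesis by (simp add: matrix_eq)
qed

lemma kderiv_eq: "has_kderiv f M a \<Longrightarrow> kderiv f a = M" for f :: "'k ^ 'n::finite \<Rightarrow> 'k ^ 'm::finite"
  unfolding kderiv_def by (rule the_equality) (auto intro: has_kderiv_unique)

lemma has_kderiv_cong:
  fixes f :: "'k ^ 'n::finite \<Rightarrow> 'k ^ 'm::finite"
  assumes f: "has_kderiv f M a" and S: "open S" "a \<in> S" and eq: "\<And>z. z \<in> S \<Longrightarrow> f z = g z"
  shows "has_kderiv g M a"
  unfolding has_kderiv_def
proof (intro allI impI)
  fix e :: real assume "0 < e"
  then obtain d where d: "d > 0" "\<And>h. vabs h < d \<Longrightarrow> vabs (f (a + h) - f a - M *v h) \<le> e * vabs h"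
    using f unfolding has_kderiv_def by auto
  obtain r where r: "0 < r" "kball a r \<subseteq> S" using open_contains_kball[OF S] .
  have "vabs (g (a + h) - g a - M *v h) \<le> e * vabs h" if "vabs h < min d r" for h
  proof -
    have "a + h \<in> kball a r" using that by (simp add: mem_kball)
    then have "g (a + h) = f (a + h)" using r eq by auto
    moreover have "g a = f a" using S(2) eq by simp
    ultimately show ?thesis using d(2) that by simp
  qed
  then show "\<exists>\<delta>>0. \<forall>h. vabs h < \<delta> \<longrightarrow> vabs (g (a + h) - g a - M *v h) \<le> e * vabs h"
    using d(1) r(1) by (intro exI[of _ "min d r"]) simp
qed

lemma has_kderiv_id: "has_kderiv (\<lambda>z. z) (mat 1) (a :: 'k ^ 'n::finite)"
  unfolding has_kderiv_def by (auto intro!: exI[of _ 1] mult_nonneg_nonneg)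

text \<open>The two errors combine by a maximum rather than a sum, so each may use the whole of
  e.\<close>

lemma has_kderiv_compose:
  fixes f :: "'k ^ 'n::finite \<Rightarrow> 'k ^ 'm::finite" and g :: "'k ^ 'm \<Rightarrow> 'k ^ 'l::finite"
  assumes f: "has_kderiv f M a" and g: "has_kderiv g N (f a)"
  shows "has_kderiv (g \<circ> f) (N ** M) a"
  unfolding has_kderiv_def
proof (intro allI impI)
  fix e :: real assume e: "0 < e"
  obtain CM where CM: "0 < CM" "\<And>h. vabs (M *v h) \<le> CM * vabs h" using matrix_vabs_bound by blast
  obtain CN where CN: "0 < CN" "\<And>h. vabs (N *v h) \<le> CN * vabs h" using matrix_vabs_bound by blast
  define C where "C = max CM 1"
  have C: "0 < C" "CM \<le> C" "1 \<le> C" using CM(1) by (auto simp: C_def)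
  \<comment> \<open>The bound 1 keeps the increment k of f below \<open>C * vabs h\<close>; the
    bound \<open>e / CN\<close> makes the error of f harmless after applying N.\<close>
  define e1 where "e1 = min 1 (e / CN)"
  have e1: "0 < e1" "e1 \<le> 1" "CN * e1 \<le> e" using e CN(1) by (auto simp: e1_def min_def field_simps)
  obtain d1 where d1: "d1 > 0" "\<And>h. vabs h < d1 \<Longrightarrow> vabs (f (a + h) - f a - M *v h) \<le> e1 * vabs h"
    using f e1(1) unfolding has_kderiv_def by auto
  have "0 < e / C" using e C by simp
  then obtain d2 where d2: "d2 > 0" "\<And>h. vabs h < d2 \<Longrightarrow> vabs (g (f a + h) - g (f a) - N *v h) \<le> e / C * vabs h"
    using g unfolding has_kderiv_def by auto
  have "vabs ((g \<circ> f) (a + h) - (g \<circ> f) a - (N ** M) *v h) \<le> e * vabs h" if h: "vabs h < min d1 (d2 / C)" for h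
  proof -
    define k where "k = f (a + h) - f a"
    define r where "r = k - M *v h"
    have r: "vabs r \<le> e1 * vabs h" using d1(2) h by (simp add: r_def k_def)
    have "vabs r \<le> C * vabs h"
      by (rule order_trans[OF r]) (use e1 C in \<open>intro mult_right_mono, auto\<close>)
    moreover have "vabs (M *v h) \<le> C * vabs h"
      by (rule order_trans[OF CM(2)]) (use C in \<open>intro mult_right_mono, auto\<close>)
    moreover have "vabs k \<le> max (vabs r) (vabs (M *v h))"
      using vabs_add[of r "M *v h"] by (simp add: r_def)
    ultimately have k: "vabs k \<le> C * vabs h" by simp
    also have "\<dots> < d2" using h C by (simp add: field_simps)
    finally have "vabs (g (f a + k) - g (f a) - N *v k) \<le> e / C * vabs k" by (rule d2(2))
    also have "\<dots> \<le> e / C * (C * vabs h)" using k e C by (intro mult_left_mono) auto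
    also have "\<dots> = e * vabs h" using C by simp
    finally have 1: "vabs (g (f a + k) - g (f a) - N *v k) \<le> e * vabs h" .
    have "vabs (N *v r) \<le> CN * (e1 * vabs h)"
      by (rule order_trans[OF CN(2)]) (use CN(1) r in \<open>intro mult_left_mono, auto\<close>)
    also have "\<dots> \<le> e * vabs h" using e1(3) by (simp add: mult.assoc[symmetric] mult_right_mono)
    finally have 2: "vabs (N *v r) \<le> e * vabs h" .
    have "(g \<circ> f) (a + h) - (g \<circ> f) a - (N ** M) *v h = (g (f a + k) - g (f a) - N *v k) + N *v r"
      by (simp add: r_def k_def matrix_vector_mul_assoc[symmetric] matrix_vector_mult_diff_distrib)
    then show ?thesis using order_trans[OF vabs_add max.boundedI[OF 1 2]] by (simp only:)
  qed
  then show "\<exists>\<delta>>0. \<forall>h. vabs h < \<delta> \<longrightarrow> vabs ((g \<circ> f) (a + h) - (g \<circ> f) a - (N ** M) *v h) \<le> e * vabs h"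
    using d1(1) d2(1) C(1) by (intro exI[of _ "min d1 (d2 / C)"]) simp
qed

lemma multi_index_degree_le_1:
  "{\<nu> :: 'n::finite \<Rightarrow> nat. (\<Sum>i\<in>UNIV. \<nu> i) \<le> 1} = insert (\<lambda>_. 0) (range (\<lambda>i k. if k = i then 1 else 0))"
proof (intro equalityI subsetI)
  fix \<nu> :: "'n \<Rightarrow> nat" assume "\<nu> \<in> {\<nu>. (\<Sum>i\<in>UNIV. \<nu> i) \<le> 1}"
  then consider "(\<Sum>i\<in>UNIV. \<nu> i) = 0" | "(\<Sum>i\<in>UNIV. \<nu> i) = 1" by fastforce
  then show "\<nu> \<in> insert (\<lambda>_. 0) (range (\<lambda>i k. if k = i then 1 else 0))"
  proof cases
    case 1 then show ?thesis by (auto simp: fun_eq_iff)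
  next
    case 2
    then obtain i where "\<nu> i = 1" "\<And>k. i \<noteq> k \<Longrightarrow> \<nu> k = 0"
      by (subst (asm) sum_eq_1_iff) auto
    then have "\<nu> = (\<lambda>k. if k = i then 1 else 0)" by (auto simp: fun_eq_iff)
    then show ?thesis by blast
  qed
qed auto

text \<open>The coefficients of degree 1 form the derivative. Convergence at one point of radius
  \<rho> bounds all coefficients as in a Cauchy estimate, so the terms of degree at least 2 are
  quadratically small in h.\<close>

lemma kanalytic_has_kderiv:
  fixes f :: "'k ^ 'n::finite \<Rightarrow> 'k ^ 'm::finite"
  assumes "kanalytic_on f S" "open S" "a \<in> S"
  obtains M where "has_kderiv f M a"
proof -
  obtain r and c :: "'m \<Rightarrow> ('n \<Rightarrow> nat) \<Rightarrow> 'k" where r: "r > 0" and c: "\<And>z j. z \<in> S \<Longrightarrow> vabs (z - a) < r \<Longrightarrow>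
      ((\<lambda>\<nu>. c j \<nu> * (\<Prod>i\<in>UNIV. (z $ i - a $ i) ^ \<nu> i)) has_sum (f z $ j)) UNIV"
    using assms(1,3) unfolding kanalytic_on_def by blast
  obtain r' where r': "0 < r'" "kball a r' \<subseteq> S" using open_contains_kball[OF assms(2,3)] .
  have "0 < min r r'" using r r' by simp
  then obtain m where m: "q powi int m < min r r'" by (rule q_powi_small)
  define \<rho> where "\<rho> = q powi int m"
  have \<rho>: "0 < \<rho>" "\<rho> < r" "\<rho> < r'" using m kabs_pi(1) by (auto simp: \<rho>_def)
  have near: "((\<lambda>\<nu>. c j \<nu> * (\<Prod>i\<in>UNIV. (h $ i) ^ \<nu> i)) has_sum (f (a + h) $ j)) UNIV" if "vabs h \<le> \<rho>" for h j
  proof -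
    have "a + h \<in> S" using that \<rho> r'(2) by (auto simp: mem_kball)
    then show ?thesis using c[of "a + h" j] that \<rho> by simp
  qed
  define X where "X = {\<nu> :: 'n \<Rightarrow> nat. (\<Sum>i\<in>UNIV. \<nu> i) \<le> 1}"
  define \<epsilon> where "\<epsilon> = (\<lambda>(i::'n) k. if k = i then 1 else 0 :: nat)"
  have X: "X = insert (\<lambda>_. 0) (range \<epsilon>)"
    unfolding X_def \<epsilon>_def by (rule multi_index_degree_le_1)
  have finX: "finite X" by (simp add: X)
  have inj: "inj \<epsilon>" by (auto simp: inj_def \<epsilon>_def fun_eq_iff split: if_splits)
  have "(\<lambda>_. 0) \<noteq> \<epsilon> i" for i
  proof
    assume "(\<lambda>_. 0) = \<epsilon> i"
    from fun_cong[OF this, of i] show False by (simp add: \<epsilon>_def)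
  qed
  then have zero_notin: "(\<lambda>_. 0) \<notin> range \<epsilon>" by blast
  have monom: "(\<Prod>k\<in>UNIV. (h $ k) ^ \<epsilon> i k) = h $ i" for h :: "'k ^ 'n" and i
    unfolding \<epsilon>_def by (simp add: if_distrib[of "\<lambda>n. _ ^ n"] prod.delta cong: if_cong)
  \<comment> \<open>At h = 0 only the constant monomial survives, so the tail bound applies with B =
    0.\<close>
  have center: "f a $ j = c j (\<lambda>_. 0)" for j
  proof -
    have "kabs (f (a + 0) $ j - (\<Sum>\<nu>\<in>{\<lambda>_. 0}. c j \<nu> * (\<Prod>i\<in>UNIV. ((0 :: 'k ^ 'n) $ i) ^ \<nu> i))) \<le> 0"
    proof (rule has_sum_tail_bound[OF near])
      fix \<nu> :: "'n \<Rightarrow> nat" assume "\<nu> \<notin> {\<lambda>_. 0}"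
      then obtain i where "\<nu> i \<noteq> 0" by auto
      then have "(\<Prod>i\<in>UNIV. ((0 :: 'k ^ 'n) $ i) ^ \<nu> i) = 0" by (intro prod_zero) auto
      then show "kabs (c j \<nu> * (\<Prod>i\<in>UNIV. ((0 :: 'k ^ 'n) $ i) ^ \<nu> i)) \<le> 0"
        by (simp only: mult_zero_right kabs_zero order_refl)
    qed (use \<rho> in auto)
    then have "kabs (f a $ j - c j (\<lambda>_. 0)) = 0" by (intro order.antisym) simp_all
    then show ?thesis by simp
  qed
  have "\<exists>C\<ge>0. \<forall>\<nu>. kabs (c j \<nu>) * \<rho> ^ (\<Sum>i\<in>UNIV. \<nu> i) \<le> C" for j
  proof -
    \<comment> \<open>At this point every coordinate has value exactly \<rho>, so bounded terms
      there mean bounded \<open>kabs (c j \<nu>)\<close> times \<rho> to the degree of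
      \<nu>.\<close>
    have "vabs ((\<chi> i. \<pi> ^ m) :: 'k ^ 'n) \<le> \<rho>" by (simp add: vabs_le_iff kabs_power \<rho>_def)
    then obtain C where C: "0 \<le> C" "\<And>\<nu>. kabs (c j \<nu> * (\<Prod>i\<in>UNIV. ((\<chi> i. \<pi> ^ m) $ i) ^ \<nu> i)) \<le> C"
      using has_sum_terms_bounded[OF near] by blast
    have "kabs (c j \<nu>) * \<rho> ^ (\<Sum>i\<in>UNIV. \<nu> i) \<le> C" for \<nu>
      using C(2)[of \<nu>] by (simp add: kabs_mult kabs_prod kabs_power \<rho>_def power_sum)
    then show ?thesis using C(1) by blast
  qed
  then obtain C where C: "\<And>j. 0 \<le> C j" "\<And>j \<nu>. kabs (c j \<nu>) * \<rho> ^ (\<Sum>i\<in>UNIV. \<nu> i) \<le> C j" by metis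
  define D where "D = (\<Sum>j\<in>UNIV. C j)"
  have D: "0 \<le> D" "C j \<le> D" for j
    unfolding D_def using C(1) by (auto intro: sum_nonneg member_le_sum)
  define M :: "'k ^ 'n ^ 'm" where "M = (\<chi> j i. c j (\<epsilon> i))"
  have quad: "vabs (f (a + h) - f a - M *v h) \<le> D / \<rho>\<^sup>2 * (vabs h * vabs h)" if h: "vabs h \<le> \<rho>" for h
    unfolding vabs_le_iff
  proof
    fix j
    let ?u = "\<lambda>\<nu>. c j \<nu> * (\<Prod>i\<in>UNIV. (h $ i) ^ \<nu> i)"
    have "sum ?u X = ?u (\<lambda>_. 0) + (\<Sum>i\<in>UNIV. ?u (\<epsilon> i))"
      unfolding X using zero_notin by (simp add: sum.reindex[OF inj])
    then have "(f (a + h) - f a - M *v h) $ j = f (a + h) $ j - sum ?u X"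
      by (simp add: monom center M_def matrix_vector_mult_def)
    moreover have "kabs (f (a + h) $ j - sum ?u X) \<le> D / \<rho>\<^sup>2 * (vabs h * vabs h)"
    proof (rule has_sum_tail_bound[OF near[OF h] finX])
      fix \<nu> assume "\<nu> \<notin> X"
      define d where "d = (\<Sum>i\<in>UNIV. \<nu> i)"
      have d: "2 \<le> d" using \<open>\<nu> \<notin> X\<close> by (simp add: X_def d_def)
      have "kabs (\<Prod>i\<in>UNIV. (h $ i) ^ \<nu> i) = (\<Prod>i\<in>UNIV. kabs (h $ i) ^ \<nu> i)"
        by (simp add: kabs_prod kabs_power)
      also have "\<dots> \<le> (\<Prod>i\<in>UNIV. vabs h ^ \<nu> i)"
        by (intro prod_mono conjI power_mono kabs_le_vabs) auto
      also have "\<dots> = vabs h ^ d" by (simp add: d_def power_sum)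
      finally have "kabs (?u \<nu>) \<le> kabs (c j \<nu>) * vabs h ^ d"
        unfolding kabs_mult by (intro mult_left_mono) auto
      also have "\<dots> = (kabs (c j \<nu>) * \<rho> ^ d) * (vabs h / \<rho>) ^ d"
        using \<rho>(1) by (simp add: power_divide)
      also have "\<dots> \<le> D * (vabs h / \<rho>) ^ 2"
      proof (intro mult_mono)
        show "kabs (c j \<nu>) * \<rho> ^ d \<le> D" unfolding d_def using C(2) D(2) order_trans by blast
        show "(vabs h / \<rho>) ^ d \<le> (vabs h / \<rho>) ^ 2"
          using \<rho>(1) h d by (intro power_decreasing) auto
      qed (use D \<rho> in auto)
      also have "\<dots> = D / \<rho>\<^sup>2 * (vabs h * vabs h)" by (simp add: power_divide power2_eq_square)
      finally show "kabs (?u \<nu>) \<le> D / \<rho>\<^sup>2 * (vabs h * vabs h)" .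
    qed (use D in simp)
    ultimately show "kabs ((f (a + h) - f a - M *v h) $ j) \<le> D / \<rho>\<^sup>2 * (vabs h * vabs h)" by (simp only:)
  qed
  have "has_kderiv f M a"
    unfolding has_kderiv_def
  proof (intro allI impI)
    fix e :: real assume e: "0 < e"
    define E where "E = D / \<rho>\<^sup>2 + 1"
    have E: "0 < E" "D / \<rho>\<^sup>2 \<le> E" using D(1) by (auto simp: E_def add_nonneg_pos)
    have "vabs (f (a + h) - f a - M *v h) \<le> e * vabs h" if h: "vabs h < min \<rho> (e / E)" for h
    proof -
      have "E * vabs h \<le> e" using h E by (simp add: field_simps)
      then have "E * (vabs h * vabs h) \<le> e * vabs h"
        by (simp add: mult.assoc[symmetric] mult_right_mono)
      moreover have "D / \<rho>\<^sup>2 * (vabs h * vabs h) \<le> E * (vabs h * vabs h)"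
        using E by (intro mult_right_mono) auto
      ultimately show ?thesis using quad[of h] h by linarith
    qed
    then show "\<exists>\<delta>>0. \<forall>h. vabs h < \<delta> \<longrightarrow> vabs (f (a + h) - f a - M *v h) \<le> e * vabs h"
      using \<rho>(1) E(1) e by (intro exI[of _ "min \<rho> (e / E)"]) simp
  qed
  then show thesis by (rule that)
qed

end

section \<open>Tangent spaces and their lattices\<close>

context valued_field
begin

lemma chart_image_open:
  fixes c :: "('x::topological_space, 'k, 'n::finite) chart"
  assumes "is_chart c" "open V" "V \<subseteq> fst c"
  shows "open (snd c ` V)"
proof -
  let ?g = "inv_into (fst c) (snd c)"
  have "continuous_on (snd c ` fst c) ?g" "open (snd c ` fst c)"
    using assms(1) unfolding is_chart_def homeomorphism_def by auto
  then have "open (?g -` V \<inter> snd c ` fst c)"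
    using assms(2) by (simp add: continuous_on_open_vimage)
  moreover have "?g -` V \<inter> snd c ` fst c = snd c ` V"
    using is_chart_inj[OF assms(1)] assms(3) by (force simp: inv_into_f_f subset_iff)
  ultimately show ?thesis by simp
qed

lemma transition_apply:
  assumes "is_chart c" "y \<in> fst c" shows "transition c d (snd c y) = snd d y"
  using is_chart_inj[OF assms(1)] assms(2) by (simp add: transition_def inv_into_f_f)

lemma transition_has_jacobian:
  fixes \<A> :: "('x::topological_space, 'k, 'n::finite) chart set"
  assumes A: "analytic_atlas \<A>" and c: "c \<in> \<A>" "d \<in> \<A>" "x \<in> fst c \<inter> fst d"
  shows "has_kderiv (transition c d) (jacobian c d x) (snd c x)"
proof -
  have ch: "is_chart c" "is_chart d" and an: "kanalytic_on (transition c d) (snd c ` (fst c \<inter> fst d))"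
    using A c unfolding analytic_atlas_def by auto
  have "open (snd c ` (fst c \<inter> fst d))"
    using ch by (intro chart_image_open) (auto simp: is_chart_def)
  then obtain M where "has_kderiv (transition c d) M (snd c x)"
    using kanalytic_has_kderiv[OF an] c(3) by blast
  then show ?thesis unfolding jacobian_def using kderiv_eq by metis
qed

text \<open>Near x the transition from c to e is the composite through d; the chain rule and
  uniqueness of derivatives give the relation.\<close>

lemma jacobian_cocycle:
  fixes \<A> :: "('x::topological_space, 'k, 'n::finite) chart set"
  assumes A: "analytic_atlas \<A>" and c: "c \<in> \<A>" "d \<in> \<A>" "e \<in> \<A>" "x \<in> fst c" "x \<in> fst d" "x \<in> fst e"
  shows "jacobian d e x ** jacobian c d x = jacobian c e x"
proof -
  have ch: "is_chart c" "is_chart d" "is_chart e" using A c unfolding analytic_atlas_def by auto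
  let ?S = "fst c \<inter> fst d \<inter> fst e"
  have op: "open (snd c ` ?S)" using ch by (intro chart_image_open) (auto simp: is_chart_def)
  have comp: "has_kderiv (transition d e \<circ> transition c d) (jacobian d e x ** jacobian c d x) (snd c x)"
  proof (rule has_kderiv_compose)
    show "has_kderiv (transition c d) (jacobian c d x) (snd c x)"
      using transition_has_jacobian[OF A] c by blast
    show "has_kderiv (transition d e) (jacobian d e x) (transition c d (snd c x))"
      unfolding transition_apply[OF ch(1) c(4)] using transition_has_jacobian[OF A] c by blast
  qed
  have "has_kderiv (transition c e) (jacobian d e x ** jacobian c d x) (snd c x)"
  proof (rule has_kderiv_cong[OF comp op])
    show "snd c x \<in> snd c ` ?S" using c by blast
    fix z assume "z \<in> snd c ` ?S"
    then obtain y where "z = snd c y" "y \<in> ?S" by blast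
    then show "(transition d e \<circ> transition c d) z = transition c e z"
      using ch by (simp add: transition_apply)
  qed
  moreover have "has_kderiv (transition c e) (jacobian c e x) (snd c x)"
    using transition_has_jacobian[OF A] c by blast
  ultimately show ?thesis by (rule has_kderiv_unique)
qed

lemma jacobian_self:
  fixes \<A> :: "('x::topological_space, 'k, 'n::finite) chart set"
  assumes A: "analytic_atlas \<A>" and c: "c \<in> \<A>" "x \<in> fst c"
  shows "jacobian c c x = mat 1"
proof -
  have ch: "is_chart c" using A c unfolding analytic_atlas_def by auto
  have op: "open (snd c ` fst c)" using ch by (simp add: is_chart_def)
  have "has_kderiv (transition c c) (mat 1) (snd c x)"
    by (rule has_kderiv_cong[OF has_kderiv_id op]) (use c ch in \<open>auto simp: transition_apply\<close>)
  moreover have "has_kderiv (transition c c) (jacobian c c x) (snd c x)"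
    using transition_has_jacobian[OF A c(1) c(1)] c(2) by blast
  ultimately show ?thesis using has_kderiv_unique by metis
qed

text \<open>A vector in the chart c is carried to the other charts around x by the Jacobians; the
  cocycle relation says that the result is a tangent vector.\<close>

lemma tangent_space_coordinates:
  fixes \<A> :: "('x::topological_space, 'k, 'n::finite) chart set"
  assumes A: "analytic_atlas \<A>" and c: "c \<in> \<A>" "x \<in> fst c"
  shows "(\<lambda>v. v c) ` tangent_space \<A> x = UNIV"
proof -
  have "w \<in> (\<lambda>v. v c) ` tangent_space \<A> x" for w
  proof (rule image_eqI)
    let ?v = "\<lambda>d. if d \<in> \<A> \<and> x \<in> fst d then jacobian c d x *v w else 0"
    show "?v \<in> tangent_space \<A> x"
      unfolding tangent_space_def
      using jacobian_cocycle[OF A c(1) _ _ c(2)] by (auto simp: matrix_vector_mul_assoc)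
    show "w = ?v c" using c jacobian_self[OF A c] by simp
  qed
  then show ?thesis by blast
qed

section \<open>Submodules of the field and the generator of the top exterior power\<close>

lemma val_submodule_ball: "val_submodule {x :: 'k. kabs x \<le> r}" if "0 \<le> r"
proof -
  have "kabs (x + y) \<le> r" if "kabs x \<le> r" "kabs y \<le> r" for x y :: 'k
    using order_trans[OF kabs_add max.boundedI[OF that]] .
  moreover have "kabs (a * x) \<le> r" if "a \<in> val_ring" "kabs x \<le> r" for a x :: 'k
    using that mult_mono[of "kabs a" 1 "kabs x" r] by (simp add: kabs_mult val_ring_def)
  ultimately show ?thesis using that by (simp add: val_submodule_def)
qed

lemma principal_eq_ball:
  assumes "(d :: 'k) \<noteq> 0" shows "(\<lambda>a. a * d) ` val_ring = {x :: 'k. kabs x \<le> kabs d}"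
proof (intro equalityI subsetI)
  fix x :: 'k assume "x \<in> {x :: 'k. kabs x \<le> kabs d}"
  then have "kabs x \<le> kabs d" by simp
  then have "kabs (x / d) \<le> 1"
    using assms by (simp add: divide_inverse kabs_mult kabs_inverse) (simp add: divide_inverse[symmetric] divide_le_eq_1)
  then show "x \<in> (\<lambda>a. a * d) ` val_ring"
    using assms by (intro image_eqI[of _ _ "x / d"]) (auto simp: val_ring_def)
qed (auto simp: val_ring_def kabs_mult mult_left_le_one_le)

text \<open>A bounded set in a discretely valued field has an element d of largest absolute value,
  and the submodule it generates is the ball of radius \<open>kabs d\<close>.\<close>

lemma val_submodule_hull_principal:
  assumes bound: "\<And>x. x \<in> D \<Longrightarrow> kabs (x :: 'k) \<le> R" and nz: "x0 \<in> D" "x0 \<noteq> 0"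
  shows "\<exists>d. d \<noteq> 0 \<and> val_submodule hull D = (\<lambda>a. a * d) ` val_ring"
proof -
  obtain k0 where k0: "kabs x0 = q powi k0" using nz(2) by (rule kabs_value_group)
  have "0 < R" using bound[OF nz(1)] nz(2) kabs_pos[of x0] by linarith
  then obtain b where b: "q powi b \<le> R" "R < q powi (b - 1)" by (rule q_powi_bracket)
  \<comment> \<open>Exponents of elements of D are at least b; counting from b turns the largest
    absolute value into a least natural number.\<close>
  let ?P = "\<lambda>n::nat. \<exists>x\<in>D. kabs x = q powi (b + int n)"
  have lower: "b \<le> k" if "x \<in> D" "kabs x = q powi k" for x k
    using bound[OF that(1)] that(2) b(2) q_powi_less_iff[of k "b - 1"] by simp
  have "?P (nat (k0 - b))" using k0 nz(1) lower[OF nz(1) k0] by auto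
  then have "?P (LEAST n. ?P n)" by (rule LeastI)
  then obtain d where d: "d \<in> D" "kabs d = q powi (b + int (LEAST n. ?P n))" by blast
  have dnz: "d \<noteq> 0" using d(2) q_powi_pos kabs_pos by metis
  have max: "kabs x \<le> kabs d" if x: "x \<in> D" for x
  proof (cases "x = 0")
    case False
    then obtain k where k: "kabs x = q powi k" by (rule kabs_value_group)
    have "b \<le> k" using lower[OF x k] .
    then have "?P (nat (k - b))" using x k by auto
    then have "(LEAST n. ?P n) \<le> nat (k - b)" by (rule Least_le)
    then show ?thesis unfolding k d(2) q_powi_le_iff using \<open>b \<le> k\<close> by linarith
  qed simp
  have "val_submodule hull D = {x :: 'k. kabs x \<le> kabs d}"
  proof (rule hull_unique)
    show "D \<subseteq> {x :: 'k. kabs x \<le> kabs d}" using max by blast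
    show "val_submodule {x :: 'k. kabs x \<le> kabs d}" by (rule val_submodule_ball) simp
    fix T assume T: "D \<subseteq> T" "val_submodule T"
    then have "(\<lambda>a. a * d) ` val_ring \<subseteq> T" using d(1) unfolding val_submodule_def by blast
    then show "{x :: 'k. kabs x \<le> kabs d} \<subseteq> T" unfolding principal_eq_ball[OF dnz] .
  qed
  then show ?thesis using dnz principal_eq_ball[OF dnz] by auto
qed

lemma kabs_det_bound:
  fixes M :: "'k ^ 'n::finite ^ 'n"
  assumes "\<And>i j. kabs (M $ i $ j) \<le> R"
  shows "kabs (det M) \<le> R ^ CARD('n)"
  unfolding det_def
proof (rule kabs_sum_le)
  have "0 \<le> R" using assms[of undefined undefined] kabs_nonneg order_trans by blast
  then show "0 \<le> R ^ CARD('n)" by simp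
  fix p :: "'n \<Rightarrow> 'n"
  have "kabs (of_int (sign p) :: 'k) = 1" by (cases "sign p = 1") (auto simp: sign_def)
  moreover have "(\<Prod>i\<in>UNIV. kabs (M $ i $ p i)) \<le> (\<Prod>i\<in>(UNIV::'n set). R)"
    using assms by (intro prod_mono) auto
  ultimately show "kabs (of_int (sign p) * (\<Prod>i\<in>UNIV. M $ i $ p i)) \<le> R ^ CARD('n)"
    by (simp add: kabs_mult kabs_prod)
qed

text \<open>A basis chosen from W has n elements, and the matrix with these rows is invertible
  because the rows span.\<close>

lemma spanning_set_nonzero_det:
  fixes W :: "('k ^ 'n::finite) set"
  assumes "vec.span W = UNIV"
  obtains b :: "'n \<Rightarrow> 'k ^ 'n" where "\<And>i. b i \<in> W" "det (\<chi> i. b i) \<noteq> 0"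
proof -
  obtain B where B: "B \<subseteq> W" "vec.independent B" "W \<subseteq> vec.span B" "card B = vec.dim W"
    using vec.basis_exists[of W] by blast
  have span: "vec.span B = UNIV"
    using vec.span_mono[OF B(3)] assms by (auto simp: vec.span_span)
  have "card B = CARD('n)"
    by (metis B(4) assms vec.dim_span vec_dim_card)
  moreover have "finite B" using B(2) vec.finiteI_independent by blast
  ultimately obtain b :: "'n \<Rightarrow> 'k ^ 'n" where b: "bij_betw b UNIV B"
    using finite_same_card_bij[of "UNIV :: 'n set" B] by auto
  have "rows (\<chi> i. b i) = B"
    using bij_betw_imp_surj_on[OF b] by (auto simp: rows_def row_def vec_lambda_eta)
  then have "\<exists>N. N ** (\<chi> i. b i) = mat 1"
    using matrix_left_invertible_span_rows_gen[of "\<chi> i. b i"] span by simp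
  then have "det (\<chi> i. b i) \<noteq> 0"
    using invertible_det_nz invertible_left_inverse by blast
  moreover have "b i \<in> W" for i using b B(1) by (auto simp: bij_betw_def)
  ultimately show thesis by (rule that[rotated])
qed

text \<open>Positivity keeps the density away from the default 1 / 0 = 0. Finite generation bounds
  the coordinates in \<Lambda> x and hence the determinants, so a generator for the choice operator
  exists; spanning supplies a nonzero determinant.\<close>

lemma generator_abs_pos:
  fixes \<A> :: "('x::topological_space, 'k, 'n::finite) chart set"
  assumes A: "analytic_atlas \<A>" and L: "integral_structure \<A> \<Lambda>" and c: "c \<in> \<A>" "x \<in> fst c"
  shows "0 < generator_abs \<Lambda> c x"
proof -
  obtain S where S: "finite S" "S \<subseteq> tangent_space \<A> x" "\<Lambda> x = lin_combs val_ring S"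
    "lin_combs UNIV S = tangent_space \<A> x"
    using L unfolding integral_structure_def by blast
  let ?W = "(\<lambda>v. v c) ` S"
  let ?D = "{det (\<chi> i. v i c) | v :: 'n \<Rightarrow> ('x, 'k, 'n) chart \<Rightarrow> 'k ^ 'n. \<forall>i. v i \<in> \<Lambda> x}"
  have "w \<in> vec.span ?W" for w
  proof -
    obtain v where v: "v \<in> lin_combs UNIV S" "w = v c"
      using tangent_space_coordinates[OF A c] S(4) by blast
    then obtain a where w: "w = (\<Sum>u\<in>S. a u *s u c)" unfolding lin_combs_def by auto
    show ?thesis
      unfolding w by (rule vec.span_sum, rule vec.span_scale, rule vec.span_base) blast
  qed
  then have "vec.span ?W = UNIV" by blast
  then obtain b where b: "\<And>i. b i \<in> ?W" "det (\<chi> i. b i) \<noteq> 0" by (rule spanning_set_nonzero_det) blast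
  have "\<forall>i. \<exists>v\<in>S. b i = v c" using b(1) by blast
  from bchoice[of UNIV "\<lambda>i v. v \<in> S \<and> b i = v c"] this
  obtain v where v: "\<And>i. v i \<in> S" "\<And>i. b i = v i c" by blast
  have SL: "u \<in> \<Lambda> x" if u: "u \<in> S" for u
  proof -
    have "u = (\<lambda>c. \<Sum>w\<in>S. (if w = u then 1 else 0) *s w c)"
      using u S(1) by (simp add: if_distrib[of "\<lambda>a. a *s _"] sum.delta cong: if_cong)
    moreover have "\<forall>w\<in>S. (if w = u then 1 else 0 :: 'k) \<in> val_ring" by (simp add: val_ring_def)
    ultimately show ?thesis unfolding S(3) lin_combs_def mem_Collect_eq
      by (intro exI[of _ "\<lambda>w. if w = u then 1 else 0"] conjI)
  qed
  have x0: "det (\<chi> i. b i) \<in> ?D" using v SL by (auto intro!: exI[of _ v])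
  define R where "R = (\<Sum>u\<in>S. vabs (u c))"
  have R: "vabs (u c) \<le> R" if "u \<in> S" for u
    unfolding R_def using that S(1) by (intro member_le_sum) auto
  have coords: "kabs (u c $ j) \<le> R" if "u \<in> \<Lambda> x" for u j
  proof -
    obtain a where a: "u = (\<lambda>c. \<Sum>w\<in>S. a w *s w c)" "\<forall>w\<in>S. a w \<in> val_ring"
      using \<open>u \<in> \<Lambda> x\<close> unfolding S(3) lin_combs_def by blast
    have "kabs (\<Sum>w\<in>S. a w * w c $ j) \<le> R"
    proof (rule kabs_sum_le)
      show "0 \<le> R" unfolding R_def by (simp add: sum_nonneg)
      fix w assume w: "w \<in> S"
      have "kabs (a w) * kabs (w c $ j) \<le> 1 * R"
        using a(2) w order_trans[OF kabs_le_vabs R[OF w]] by (intro mult_mono) (auto simp: val_ring_def)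
      then show "kabs (a w * w c $ j) \<le> R" by (simp add: kabs_mult)
    qed
    then show ?thesis by (simp add: a(1))
  qed
  have "kabs z \<le> R ^ CARD('n)" if "z \<in> ?D" for z
    using that coords by (auto intro!: kabs_det_bound)
  from val_submodule_hull_principal[OF this x0 b(2)]
  have ex: "\<exists>\<omega>. wedge_lattice \<Lambda> c x = (\<lambda>a. a * \<omega>) ` val_ring" unfolding wedge_lattice_def by blast
  define \<omega> where "\<omega> = (SOME \<omega>. wedge_lattice \<Lambda> c x = (\<lambda>a. a * \<omega>) ` val_ring)"
  have \<omega>: "wedge_lattice \<Lambda> c x = (\<lambda>a. a * \<omega>) ` val_ring"
    unfolding \<omega>_def using ex by (rule someI_ex)
  have "det (\<chi> i. b i) \<in> wedge_lattice \<Lambda> c x"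
    unfolding wedge_lattice_def using x0 by (rule hull_inc)
  then have "\<omega> \<noteq> 0" using \<omega> b(2) by auto
  then show ?thesis unfolding generator_abs_def \<omega>_def[symmetric] by simp
qed

text \<open>The determinants only see the coordinate lattice in c, so local constancy of that
  lattice makes the density locally constant.\<close>

lemma generator_abs_cong:
  assumes "(\<lambda>v. v c) ` \<Lambda> y = (\<lambda>v. v c) ` \<Lambda> x"
  shows "generator_abs \<Lambda> c y = generator_abs \<Lambda> (c :: ('x, 'k, 'n::finite) chart) x"
proof -
  have "{det (\<chi> i. v i c) | v :: 'n \<Rightarrow> ('x, 'k, 'n) chart \<Rightarrow> 'k ^ 'n. \<forall>i. v i \<in> \<Lambda> x} =
    {det (\<chi> i. w i) | w. \<forall>i. w i \<in> (\<lambda>v. v c) ` \<Lambda> x}" (is "?L x = ?R x") for x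
  proof (intro equalityI subsetI)
    fix z assume "z \<in> ?R x"
    then obtain w where w: "z = det (\<chi> i. w i)" "\<forall>i. w i \<in> (\<lambda>v. v c) ` \<Lambda> x" by blast
    then have "\<forall>i. \<exists>v. v \<in> \<Lambda> x \<and> w i = v c" by blast
    from choice[OF this] obtain v where "\<forall>i. v i \<in> \<Lambda> x \<and> w i = v i c" by blast
    then show "z \<in> ?L x" using w(1) by auto
  qed blast
  then have "wedge_lattice \<Lambda> c y = wedge_lattice \<Lambda> c x" unfolding wedge_lattice_def using assms by simp
  then show ?thesis by (simp add: generator_abs_def)
qed

end

section \<open>Haar measure and the canonical measure\<close>

context valued_field
begin

lemma finite_residue_representatives:
  obtains R :: "'k set" where "finite R" "\<And>x. x \<in> val_ring \<Longrightarrow> \<exists>r\<in>R. kabs (x - r) < 1"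
proof -
  define rel where "rel = {(x, y). x \<in> val_ring \<and> y \<in> val_ring \<and> x - y \<in> (max_ideal :: 'k set)}"
  define R where "R = (\<lambda>C. SOME x. x \<in> C) ` (residue_field :: 'k set set)"
  have "finite R" unfolding R_def using finite_residue_field by simp
  moreover have "\<exists>r\<in>R. kabs (x - r) < 1" if x: "x \<in> val_ring" for x
  proof
    let ?C = "rel `` {x}"
    have C: "?C \<in> residue_field" unfolding residue_field_def rel_def[symmetric] using x by (rule quotientI)
    then show "(SOME y. y \<in> ?C) \<in> R" unfolding R_def by (rule imageI)
    have "x \<in> ?C" using x by (simp add: rel_def max_ideal_def)
    then have "(SOME y. y \<in> ?C) \<in> ?C" by (rule someI)
    moreover have "kabs (x - y) < 1" if "y \<in> ?C" for y using that by (simp add: rel_def max_ideal_def)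
    ultimately show "kabs (x - (SOME y. y \<in> ?C)) < 1" by blast
  qed
  ultimately show thesis by (rule that)
qed

lemma haar_unit_ball: "haar_measure h \<Longrightarrow> emeasure h (kball (0 :: 'k ^ 'n::finite) 1) = 1"
proof -
  have "{z :: 'k ^ 'n. \<forall>i. z $ i \<in> val_ring} = kball 0 1"
    by (auto simp: mem_kball vabs_le_iff val_ring_def)
  then show "haar_measure h \<Longrightarrow> emeasure h (kball (0 :: 'k ^ 'n::finite) 1) = 1"
    unfolding haar_measure_def by simp
qed

lemma haar_sets: "haar_measure h \<Longrightarrow> sets h = sets borel"
  by (simp add: haar_measure_def)

lemma haar_translate:
  "haar_measure h \<Longrightarrow> A \<in> sets borel \<Longrightarrow> emeasure h ((\<lambda>z. a + z) ` A) = emeasure h A"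
  unfolding haar_measure_def by blast

lemma kball_borel: "0 < r \<Longrightarrow> kball (a :: 'k ^ 'n::finite) r \<in> sets borel"
  by (simp add: open_kball)

lemma kball_translate: "kball (a :: 'k ^ 'n::finite) r = (\<lambda>z. a + z) ` kball 0 r"
proof (intro equalityI subsetI)
  fix z assume "z \<in> kball a r"
  then show "z \<in> (\<lambda>z. a + z) ` kball 0 r"
    by (intro image_eqI[of _ _ "z - a"]) (auto simp: mem_kball)
qed (auto simp: mem_kball)

lemma haar_kball_center:
  assumes "haar_measure h" "0 < r"
  shows "emeasure h (kball (a :: 'k ^ 'n::finite) r) = emeasure h (kball 0 r)"
  unfolding kball_translate[of a] using haar_translate[OF assms(1) kball_borel[OF assms(2)]] .

lemma haar_kball_finite:
  assumes "haar_measure h" "0 < r" "r \<le> 1"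
  shows "emeasure h (kball (a :: 'k ^ 'n::finite) r) \<le> 1"
proof -
  have "kball (0 :: 'k ^ 'n) r \<subseteq> kball 0 1" using assms(3) by (auto simp: mem_kball)
  then have "emeasure h (kball (0 :: 'k ^ 'n) r) \<le> emeasure h (kball (0 :: 'k ^ 'n) 1)"
    by (rule emeasure_mono) (simp add: haar_sets[OF assms(1)] kball_borel)
  then show ?thesis unfolding haar_kball_center[OF assms(1,2), of a] haar_unit_ball[OF assms(1)] .
qed

text \<open>Vectors of residue representatives give finitely many translates of the next smaller
  ball that cover the current one. A null ball would thus make the preceding ones null, up to the
  unit ball of measure 1.\<close>

lemma haar_kball_pos:
  assumes h: "haar_measure h"
  shows "emeasure h (kball (a :: 'k ^ 'n::finite) (q powi int m)) \<noteq> 0"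
proof -
  obtain R :: "'k set" where R: "finite R" "\<And>x. x \<in> val_ring \<Longrightarrow> \<exists>r\<in>R. kabs (x - r) < 1"
    using finite_residue_representatives by blast
  define V where "V = vec_lambda ` {f :: 'n \<Rightarrow> 'k. range f \<subseteq> R}"
  have "finite {f :: 'n \<Rightarrow> 'k. range f \<subseteq> R}"
    using finite_set_of_finite_funs[OF _ R(1), of "UNIV :: 'n set"] by (simp add: image_subset_iff)
  then have V: "finite V" by (simp add: V_def)
  have "emeasure h (kball (0 :: 'k ^ 'n) (q ^ m)) \<noteq> 0"
  proof (induction m)
    case 0
    show ?case using haar_unit_ball[OF h] by simp
  next
    case (Suc m)
    have pos: "0 < q ^ m" "0 < q ^ Suc m" using kabs_pi(1) by simp_all
    have "kball (0 :: 'k ^ 'n) (q ^ m) \<subseteq> (\<Union>v\<in>V. kball (\<pi> ^ m *s v) (q ^ Suc m))"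
    proof
      fix z :: "'k ^ 'n" assume "z \<in> kball 0 (q ^ m)"
      then have z: "kabs (z $ i) \<le> q ^ m" for i by (simp add: mem_kball vabs_le_iff)
      have "\<forall>i. \<exists>r. r \<in> R \<and> kabs (z $ i / \<pi> ^ m - r) < 1"
      proof
        fix i
        have "kabs (z $ i / \<pi> ^ m) \<le> 1"
          using z[of i] pos(1) by (simp add: divide_inverse kabs_mult kabs_inverse kabs_power)
            (simp add: divide_inverse[symmetric] divide_le_eq_1)
        then show "\<exists>r. r \<in> R \<and> kabs (z $ i / \<pi> ^ m - r) < 1"
          using R(2)[of "z $ i / \<pi> ^ m"] by (auto simp: val_ring_def)
      qed
      from choice[OF this] obtain f where f: "\<forall>i. f i \<in> R \<and> kabs (z $ i / \<pi> ^ m - f i) < 1" by (elim exE)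
      have "kabs (z $ i - \<pi> ^ m * f i) \<le> q ^ Suc m" for i
      proof -
        have "z $ i - \<pi> ^ m * f i = \<pi> ^ m * (z $ i / \<pi> ^ m - f i)"
          using pi_nonzero by (simp add: field_simps)
        moreover have "kabs (z $ i / \<pi> ^ m - f i) \<le> q" using f by (intro kabs_less_one) simp
        ultimately show ?thesis
          using pos(1) by (simp add: kabs_mult kabs_power mult.commute[of q])
      qed
      then have "z \<in> kball (\<pi> ^ m *s vec_lambda f) (q ^ Suc m)"
        by (simp add: mem_kball vabs_le_iff)
      moreover have "vec_lambda f \<in> V" using f by (auto simp: V_def)
      ultimately show "z \<in> (\<Union>v\<in>V. kball (\<pi> ^ m *s v) (q ^ Suc m))" by blast
    qed
    then have "emeasure h (kball (0 :: 'k ^ 'n) (q ^ m)) \<le> emeasure h (\<Union>v\<in>V. kball (\<pi> ^ m *s v) (q ^ Suc m))"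
      by (rule emeasure_mono) (use V pos in \<open>auto simp: haar_sets[OF h] intro!: sets.finite_UN kball_borel\<close>)
    also have "\<dots> \<le> (\<Sum>v\<in>V. emeasure h (kball (\<pi> ^ m *s v) (q ^ Suc m)))"
      using V pos by (intro emeasure_subadditive_finite) (auto simp: haar_sets[OF h] intro!: kball_borel)
    also have "\<dots> = (\<Sum>v\<in>V. emeasure h (kball (0 :: 'k ^ 'n) (q ^ Suc m)))"
      by (intro sum.cong refl haar_kball_center[OF h pos(2)])
    finally have le: "emeasure h (kball (0 :: 'k ^ 'n) (q ^ m))
        \<le> (\<Sum>v\<in>V. emeasure h (kball (0 :: 'k ^ 'n) (q ^ Suc m)))" .
    show ?case
    proof
      assume "emeasure h (kball (0 :: 'k ^ 'n) (q ^ Suc m)) = 0"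
      then have "emeasure h (kball (0 :: 'k ^ 'n) (q ^ m)) \<le> 0" using le by (simp only: sum.neutral_const)
      then show False using Suc by simp
    qed
  qed
  then show ?thesis using haar_kball_center[OF h, of "q powi int m" a] kabs_pi(1) by simp
qed

text \<open>All points have the same measure by translation, and the unit ball of measure 1 contains
  infinitely many, for instance those with all coordinates equal to a power of \<pi>.\<close>

lemma haar_singleton:
  assumes h: "haar_measure h"
  shows "emeasure h {a :: 'k ^ 'n::finite} = 0"
proof -
  have sets: "{b} \<in> sets h" for b by (simp add: haar_sets[OF h])
  have eq: "emeasure h {b} = emeasure h {a}" for b
    using haar_translate[OF h, of "{a}" "b - a"] by simp
  define x :: "nat \<Rightarrow> 'k ^ 'n" where "x = (\<lambda>n. \<chi> i. \<pi> ^ n)"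
  have inj: "inj x"
  proof
    fix m n assume "x m = x n"
    then have "\<pi> ^ m = \<pi> ^ n" by (simp add: x_def vec_eq_iff)
    then have "q powi int m = q powi int n" by (metis kabs_power power_int_of_nat)
    then show "m = n" using q_powi_less_iff[of "int m" "int n"] q_powi_less_iff[of "int n" "int m"] by linarith
  qed
  have le: "of_nat N * emeasure h {a} \<le> 1" for N :: nat
  proof -
    have "card (x ` {..<N}) = N"
      using card_image[OF inj_on_subset[OF inj subset_UNIV], of "{..<N}"] by simp
    then have "of_nat N * emeasure h {a} = (\<Sum>b\<in>x ` {..<N}. emeasure h {a})"
      by simp
    also have "\<dots> = (\<Sum>b\<in>x ` {..<N}. emeasure h {b})"
      by (intro sum.cong refl eq[symmetric])
    also have "\<dots> = emeasure h (x ` {..<N})"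
      using sets by (intro emeasure_eq_sum_singleton[symmetric]) auto
    also have "\<dots> \<le> emeasure h (kball 0 1)"
      using kabs_pi
      by (intro emeasure_mono) (auto simp: x_def mem_kball vabs_le_iff kabs_power power_le_one haar_sets[OF h] kball_borel)
    finally show ?thesis by (simp add: haar_unit_ball[OF h])
  qed
  from le[of 1] have "emeasure h {a} \<noteq> top" by (auto simp: top_unique)
  then obtain r where r: "0 \<le> r" "emeasure h {a} = ennreal r" by (cases "emeasure h {a}") auto
  have "r \<le> 0"
  proof (rule ccontr)
    assume "\<not> r \<le> 0"
    then obtain N :: nat where N: "1 < real N * r" using reals_Archimedean3[of r] by auto
    have "ennreal (real N * r) \<le> ennreal 1"
      using le[of N] r by (simp add: ennreal_mult ennreal_of_nat_eq_real_of_nat)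
    then show False using N by simp
  qed
  then show ?thesis using r by (simp add: ennreal_eq_0_iff)
qed

section \<open>Null points and finite total mass of the canonical measure\<close>

lemma canonical_singleton:
  fixes \<A> :: "('x::t1_space, 'k, 'n::finite) chart set"
  assumes A: "analytic_atlas \<A>" and \<mu>: "canonical_measure \<A> \<Lambda> \<mu>"
  shows "emeasure \<mu> {x} = 0"
proof -
  obtain h where h: "haar_measure h" and em: "\<And>c B. c \<in> \<A> \<Longrightarrow> B \<in> sets borel \<Longrightarrow> B \<subseteq> fst c \<Longrightarrow>
      emeasure \<mu> B = (\<integral>\<^sup>+ z. ennreal (1 / generator_abs \<Lambda> c (inv_into (fst c) (snd c) z)) * indicator (snd c ` B) z \<partial>h)"
    using \<mu> unfolding canonical_measure_def by blast
  obtain c where c: "c \<in> \<A>" "x \<in> fst c" using A unfolding analytic_atlas_def by blast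
  have "AE z in h. z \<notin> {snd c x}"
    by (rule AE_not_in) (simp add: null_sets_def haar_singleton[OF h] haar_sets[OF h])
  then have "AE z in h. ennreal (1 / generator_abs \<Lambda> c (inv_into (fst c) (snd c) z)) * indicator (snd c ` {x}) z = 0"
    by eventually_elim simp
  then have "(\<integral>\<^sup>+ z. ennreal (1 / generator_abs \<Lambda> c (inv_into (fst c) (snd c) z)) * indicator (snd c ` {x}) z \<partial>h) = (\<integral>\<^sup>+ z. 0 \<partial>h)"
    by (rule nn_integral_cong_AE)
  then show ?thesis using em[OF c(1), of "{x}"] c(2) by simp
qed

text \<open>On a small ball of a chart the density is constant, so the measure is a positive real
  number times the Haar measure of the ball.\<close>

lemma canonical_neighbourhood:
  fixes \<A> :: "('x::topological_space, 'k, 'n::finite) chart set"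
  assumes A: "analytic_atlas \<A>" and L: "integral_structure \<A> \<Lambda>" and \<mu>: "canonical_measure \<A> \<Lambda> \<mu>"
  shows "\<exists>U. open U \<and> x \<in> U \<and> emeasure \<mu> U < \<infinity> \<and> emeasure \<mu> U \<noteq> 0"
proof -
  obtain h where h: "haar_measure h" and em: "\<And>c B. c \<in> \<A> \<Longrightarrow> B \<in> sets borel \<Longrightarrow> B \<subseteq> fst c \<Longrightarrow>
      emeasure \<mu> B = (\<integral>\<^sup>+ z. ennreal (1 / generator_abs \<Lambda> c (inv_into (fst c) (snd c) z)) * indicator (snd c ` B) z \<partial>h)"
    using \<mu> unfolding canonical_measure_def by blast
  obtain c where c: "c \<in> \<A>" "x \<in> fst c" using A unfolding analytic_atlas_def by blast
  have ch: "is_chart c" using A c unfolding analytic_atlas_def by blast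
  obtain V where V: "open V" "x \<in> V" "V \<subseteq> fst c" "\<forall>y\<in>V. (\<lambda>v. v c) ` \<Lambda> y = (\<lambda>v. v c) ` \<Lambda> x"
    using L c unfolding integral_structure_def by blast
  have "open (snd c ` V)" "snd c x \<in> snd c ` V" using chart_image_open[OF ch V(1,3)] V(2) by auto
  then obtain r where r: "0 < r" "kball (snd c x) r \<subseteq> snd c ` V" by (rule open_contains_kball)
  \<comment> \<open>The bound 1 serves finiteness by comparison with the unit ball; the natural
    exponent serves \<open>haar_kball_pos\<close>.\<close>
  have "0 < min r 1" using r by simp
  then obtain m where m: "q powi int m < min r 1" by (rule q_powi_small)
  define \<rho> where "\<rho> = q powi int m"
  have \<rho>: "0 < \<rho>" "\<rho> < r" "\<rho> \<le> 1" unfolding \<rho>_def using m q_powi_pos[of "int m"] by (simp_all only: min_less_iff_conj less_imp_le)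
  let ?B = "kball (snd c x) \<rho>"
  have sub: "?B \<subseteq> snd c ` V" using r(2) \<rho>(2) by (auto simp: mem_kball)
  define U where "U = {y \<in> V. snd c y \<in> ?B}"
  have im: "snd c ` U = ?B" using sub by (auto simp: U_def)
  have UV: "U \<subseteq> V" by (auto simp: U_def)
  have op: "open U" using UV V(3) by (intro is_chart_open_preimage[OF ch]) (auto simp: im open_kball \<rho>(1))
  have "x \<in> U" using V(2) by (simp add: U_def mem_kball \<rho>(1) less_imp_le)
  have gen: "generator_abs \<Lambda> c (inv_into (fst c) (snd c) z) = generator_abs \<Lambda> c x" if z: "z \<in> ?B" for z
  proof -
    obtain y where y: "z = snd c y" "y \<in> V" using z sub by blast
    then have "inv_into (fst c) (snd c) z = y"
      using V(3) is_chart_inj[OF ch] by (auto simp: inv_into_f_f)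
    then show ?thesis using generator_abs_cong V(4) y(2) by metis
  qed
  have "emeasure \<mu> U = (\<integral>\<^sup>+ z. ennreal (1 / generator_abs \<Lambda> c (inv_into (fst c) (snd c) z)) * indicator ?B z \<partial>h)"
    using em[OF c(1), of U] op UV V(3) im by simp
  also have "\<dots> = (\<integral>\<^sup>+ z. ennreal (1 / generator_abs \<Lambda> c x) * indicator ?B z \<partial>h)"
    by (intro nn_integral_cong) (auto simp: indicator_def gen)
  also have "\<dots> = ennreal (1 / generator_abs \<Lambda> c x) * emeasure h ?B"
    by (intro nn_integral_cmult_indicator) (simp add: haar_sets[OF h] kball_borel \<rho>(1))
  finally have eq: "emeasure \<mu> U = ennreal (1 / generator_abs \<Lambda> c x) * emeasure h ?B" .
  have "emeasure h ?B \<le> 1" using \<rho> by (intro haar_kball_finite[OF h])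
  then have "emeasure h ?B < \<infinity>" by (rule le_less_trans) simp
  then have "emeasure \<mu> U < \<infinity>" unfolding eq by (simp add: ennreal_mult_less_top)
  moreover have "emeasure \<mu> U \<noteq> 0"
    unfolding eq using haar_kball_pos[OF h, of "snd c x" m] generator_abs_pos[OF A L c] by (simp add: \<rho>_def)
  ultimately show ?thesis using op \<open>x \<in> U\<close> by blast
qed

lemma canonical_finite:
  fixes \<A> :: "('x::topological_space, 'k, 'n::finite) chart set"
  assumes "compact (UNIV :: 'x set)"
    and A: "analytic_atlas \<A>" and L: "integral_structure \<A> \<Lambda>" and \<mu>: "canonical_measure \<A> \<Lambda> \<mu>"
  shows "finite_measure \<mu>" "emeasure \<mu> UNIV \<noteq> 0"
proof -
  have sets: "sets \<mu> = sets borel" using \<mu> by (simp add: canonical_measure_def)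
  then have space: "space \<mu> = UNIV" using sets_eq_imp_space_eq[OF sets] by simp
  have "\<forall>x. \<exists>U. open U \<and> x \<in> U \<and> emeasure \<mu> U < \<infinity> \<and> emeasure \<mu> U \<noteq> 0"
    using canonical_neighbourhood[OF A L \<mu>] by blast
  from choice[OF this] obtain U where U: "\<forall>x. open (U x) \<and> x \<in> U x \<and> emeasure \<mu> (U x) < \<infinity> \<and> emeasure \<mu> (U x) \<noteq> 0"
    by (elim exE)
  have "UNIV \<subseteq> (\<Union>x\<in>UNIV. U x)" using U by blast
  then obtain D where D: "finite D" "UNIV \<subseteq> (\<Union>x\<in>D. U x)"
    using compactE_image[OF assms(1), of UNIV U] U by metis
  have "emeasure \<mu> (\<Union>x\<in>D. U x) \<le> (\<Sum>x\<in>D. emeasure \<mu> (U x))"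
    using D U by (intro emeasure_subadditive_finite) (auto simp: sets)
  also have "\<dots> < \<infinity>" using D(1) U by simp
  finally have "emeasure \<mu> UNIV < \<infinity>" using D(2) by (simp add: top.extremum_unique)
  then show "finite_measure \<mu>" by (intro finite_measureI) (simp add: space)
  \<comment> \<open>Types are nonempty, so \<open>undefined\<close> names a point, whose
    neighbourhood already has nonzero measure.\<close>
  have "emeasure \<mu> (U undefined) \<le> emeasure \<mu> UNIV" by (rule emeasure_mono) (use sets in auto)
  then show "emeasure \<mu> UNIV \<noteq> 0" using U by (metis le_zero_eq)
qed

end

theorem mainTheorem5:
  fixes p :: nat
    and \<A> :: "('x::t2_space, 'k::{field_char_0,metric_space}, 'n::finite) chart set"
    and \<Lambda> :: "'x \<Rightarrow> (('x, 'k, 'n) chart \<Rightarrow> 'k ^ 'n) set"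
    and \<mu> :: "'x measure"
    and \<alpha> :: real
  assumes "padic_number_field p TYPE('k)"
    and "compact (UNIV :: 'x set)"
    and "analytic_atlas \<A>"
    and "finite \<A>"
    and "integrally_compatible \<A>"
    and "inj_on fst \<A>"
    and "connected_nerve (fst ` \<A>)"
    and "integral_structure \<A> \<Lambda>"
    and "canonical_measure \<A> \<Lambda> \<mu>"
    and "\<alpha> > 0"
  shows "\<exists>T. C0_semigroup \<mu> (VT_sobolev \<A> \<mu> \<alpha>) (VT_norm \<A> \<mu> \<alpha>) T \<and>
             has_generator \<mu> (VT_sobolev \<A> \<mu> \<alpha>) (VT_norm \<A> \<mu> \<alpha>) T
               (\<lambda>f x. - VT_operator \<A> \<mu> \<alpha> f x) \<and>
             markov_property \<mu> (VT_sobolev \<A> \<mu> \<alpha>) T"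
proof -
  obtain \<pi> :: 'k where "valued_field \<pi>" using padic_valued_field[OF assms(1)] .
  then interpret valued_field \<pi> .
  have sets: "sets \<mu> = sets borel" using assms(9) by (simp add: canonical_measure_def)
  have borel: "{x. \<exists>\<gamma>. ball_chain \<A> F x \<gamma>} \<in> sets borel" if F: "F \<in> faces \<A>" for F
  proof -
    \<comment> \<open>A face lies in one chart domain, so the levels of all its balls can be read in
      a single chart.\<close>
    obtain c where c: "c \<in> \<A>" "F \<subseteq> fst c" using face_subset_chart[OF F] .
    have "is_chart c" using assms(3) c(1) unfolding analytic_atlas_def by blast
    then show ?thesis using ball_chain_borel c by blast
  qed
  obtain k M where k: "bounded_kernel \<mu> k M"
    "\<And>f x y. VT_integrand \<A> \<mu> \<alpha> f x y = k x y * (f x - f y)"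
    using VT_bounded_kernel[OF assms(4) sets canonical_finite(1)[OF assms(2,3,8,9)]
        canonical_singleton[OF assms(3,9)] borel] by blast
  show ?thesis
    by (rule VT_semigroup[OF k canonical_finite(2)[OF assms(2,3,8,9)]])
qed

end
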